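(* Let $(X,d_{L_*})$ be a symmetric Laakso-type fractal space, i.e. the limit space, with its intrinsic metric, of a simple iterated graph system with generator $G_1$ that is doubling, non-degenerate and symmetric. Then the Ahlfors regular conformal dimension of $(X,d_{L_*})$ is the unique value $Q_*\ge1$ satisfying $\mathrm{Mod}_{Q_*}(\Theta^{(1)},G_1)=1$.
   Context: Graphs. A graph is a triple $G=(V,E,\xi)$ with $V$ a finite non-empty set (vertices), $E$ a finite set (edges) and $\xi\colon E\to\{\{v,w\}: v,w\in V,\ v\neq w\}$ (multiple edges allowed). Write $v\in e$ for $v\in\xi(e)$, $e\cap f:=\xi(e)\cap\xi(f)$, and $\deg(v)$ for the number of edges $e$ with $v\in e$. A path from $v_0$ to $v_k$ is an alternating sequence $[v_0,e_1,v_1,\dots,e_k,v_k]$ with $\xi(e_i)=\{v_{i-1},v_i\}$ for all $i$; $\Theta(A,B)$ is the set of all paths from a vertex of $A$ to a vertex of $B$; $d_G$ is the path metric. Simple iterated graph system (IGS). It consists of a finite connected graph $G_1=(V_1,E_1,\xi_1)$ (the generator), a finite non-empty set $I$, two injective maps $\phi_-,\phi_+\colon I\to V_1$, and a labelling $\xi_1(e)=\{e^-,e^+\}$ of the endpoints of each $e\in E_1$; set $I_\pm:=\phi_\pm(I)$ and $\phi_{e^\pm,e}:=\phi_\pm$. It is required that $I_-\cap I_+=\varnothing$ and that no edge has both endpoints in $I_-$ or both in $I_+$. Replacement graphs $G_n=(V_n,E_n,\xi_n)$ are defined recursively: $V_{n+1}:=(V_1\times E_n)/\sim$, where $\sim$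 is generated by $(\phi_{v,e}(i),e)\sim(\phi_{v,f}(i),f)$ for all $i\in I$ and all $e,f\in E_n$ sharing the endpoint $v$; the class of $(v,e)$ is $[v,e]$; $E_{n+1}:=E_1\times E_n$, $\xi_{n+1}(e,f):=\{[e^-,f],[e^+,f]\}$, with labels $(e,f)^\pm:=[e^\pm,f]$ and gluing maps $\phi_{(e,f)^\pm,(e,f)}:=\phi_\pm$. Projections on edges: $\pi_{n+1}(e,f):=f$ for $(e,f)\in E_{n+1}$, $\pi_{n,k}:=\pi_{k+1}\circ\dots\circ\pi_n$ for $n>k$, $\pi_{n,n}=\mathrm{id}$. For $e\in E_k$ write $|e|:=k$, and for $n\ge k$ let $e\cdot G_{n-k}$ be the subgraph of $G_n$ consisting of all edges $f\in E_n$ with $\pi_{n,k}(f)=e$ and their endpoints. The IGS is doubling if $\deg(v)=1$ for all $v\in I_-\cup I_+$; non-degenerate if no edge of $G_1$ joins a vertex of $I_-$ to a vertex of $I_+$; symmetric if there is a graph isomorphism $\eta\colon G_1\to G_1$ with $\eta\circ\phi_\pm=\phi_\mp$. Put $\Theta^{(1)}:=\Theta(I_-,I_+)$ (paths in $G_1$) and $L_*:=\min\{d_{G_1}(v,w): v\in I_-,w\in I_+\}$. Limit space and intrinsic metric. $\Sigma:=\{(e_i)_{i\ge1}: e_i\in E_i,\ \pi_{i+1}(e_{i+1})=e_i\ \forall i\}$ and $X:=\Sigma/\sim$ with $(e_i)\sim(f_i)$ iff $e_i\cap f_i\ne\varnothing$ for all $i$. For $v\neq w$ in $V_n$ let $d_n(v,w)$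 be the infimum of $\sum_{e\in\Omega}L_*^{-|e|}$ over all sets $\Omega\subset\bigcup_{i=1}^nE_i$ such that $v$ and $w$ are connected by a path in $\bigcup_{e\in\Omega}e\cdot G_{n-|e|}$; $d_n(v,v)=0$; $d_n(e,f):=\min\{d_n(v,w):v\in e,w\in f\}$ for $e,f\in E_n$. Then $d_{L_*}([(e_i)],[(f_i)]):=\lim_{i\to\infty}d_i(e_i,f_i)$, which is a well-defined metric on $X$. Modulus. A function $\rho\colon E_1\to[0,1]$ is $\Theta^{(1)}$-admissible if $\sum_{i=1}^k\rho(e_i)\ge1$ for every $[v_0,e_1,\dots,e_k,v_k]\in\Theta^{(1)}$; for $p\ge1$, $\mathrm{Mod}_p(\Theta^{(1)},G_1):=\inf\{\sum_{e\in E_1}\rho(e)^p:\rho\colon E_1\to[0,1]\text{ is }\Theta^{(1)}\text{-admissible}\}$. Conformal dimension. A metric space is $Q$-Ahlfors regular ($Q>0$) if there are a Radon measure $\mu$ and $C\ge1$ with $C^{-1}r^Q\le\mu(B(x,r))\le Cr^Q$ for all $x$ and $0<r\le2\,\mathrm{diam}$. Metrics $d,\delta$ on a set are quasisymmetrically equivalent if the identity map is a homeomorphism and there is a homeomorphism $\psi\colon[0,\infty)\to[0,\infty)$ with $\delta(x,y)/\delta(x,z)\le\psi(d(x,y)/d(x,z))$ for all $x,y,z$, $x\neq z$. $\mathcal{G}_{\mathrm{AR}}(X,d)$ is the set of metrics on $X$ quasisymmetrically equivalent to $d$ that are $Q$-Ahlfors regular for some $Q\ge1$, and the Ahlfors regular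 conformal dimension is $\dim_{\mathrm{AR}}(X,d):=\inf\{\dim_{\mathrm H}(X,\delta):\delta\in\mathcal{G}_{\mathrm{AR}}(X,d)\}$. *)

theory Defs
  imports "HOL-Analysis.Analysis"
begin

section \<open>Multigraphs\<close>

record ('v, 'e) mgraph =
  verts :: "'v set"
  edges :: "'e set"
  ends :: "'e \<Rightarrow> 'v set"

definition mgraph :: "('v, 'e, 'more) mgraph_scheme \<Rightarrow> bool" where
  "mgraph G \<longleftrightarrow> finite (verts G) \<and> verts G \<noteq> {} \<and> finite (edges G) \<and>
     (\<forall>e\<in>edges G. \<exists>v\<in>verts G. \<exists>w\<in>verts G. v \<noteq> w \<and> ends G e = {v, w})"

definition degree :: "('v, 'e, 'more) mgraph_scheme \<Rightarrow> 'v \<Rightarrow> nat" where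
  "degree G v = card {e \<in> edges G. v \<in> ends G e}"

text \<open>The alternating sequence \<open>[v\<^sub>0, e\<^sub>1, v\<^sub>1, \<dots>, e\<^sub>k, v\<^sub>k]\<close> is stored as the vertex list
  \<open>vs = [v\<^sub>0, \<dots>, v\<^sub>k]\<close> together with the edge list \<open>es = [e\<^sub>1, \<dots>, e\<^sub>k]\<close>; repetitions are allowed.\<close>

definition is_path :: "('v, 'e, 'more) mgraph_scheme \<Rightarrow> 'v list \<times> 'e list \<Rightarrow> bool" where
  "is_path G = (\<lambda>(vs, es). length vs = Suc (length es) \<and> set vs \<subseteq> verts G \<and> set es \<subseteq> edges G \<and>
     (\<forall>i<length es. ends G (es ! i) = {vs ! i, vs ! Suc i}))"

definition paths_between ::
  "('v, 'e, 'more) mgraph_scheme \<Rightarrow> 'v set \<Rightarrow> 'v set \<Rightarrow> ('v list \<times> 'e list) set" where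
  "paths_between G A B = {(vs, es). is_path G (vs, es) \<and> hd vs \<in> A \<and> last vs \<in> B}"

definition path_dist :: "('v, 'e, 'more) mgraph_scheme \<Rightarrow> 'v \<Rightarrow> 'v \<Rightarrow> nat" where
  "path_dist G v w = (LEAST k. \<exists>(vs, es) \<in> paths_between G {v} {w}. length es = k)"

definition connected_mgraph :: "('v, 'e, 'more) mgraph_scheme \<Rightarrow> bool" where
  "connected_mgraph G \<longleftrightarrow> (\<forall>v\<in>verts G. \<forall>w\<in>verts G. paths_between G {v} {w} \<noteq> {})"

definition mgraph_iso ::
  "('v, 'e, 'm) mgraph_scheme \<Rightarrow> ('w, 'f, 'n) mgraph_scheme \<Rightarrow> ('v \<Rightarrow> 'w) \<Rightarrow> ('e \<Rightarrow> 'f) \<Rightarrow> bool" where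
  "mgraph_iso G H \<eta> \<epsilon> \<longleftrightarrow> bij_betw \<eta> (verts G) (verts H) \<and> bij_betw \<epsilon> (edges G) (edges H) \<and>
     (\<forall>e\<in>edges G. ends H (\<epsilon> e) = \<eta> ` ends G e)"

definition edge_subgraph :: "('v, 'e, 'more) mgraph_scheme \<Rightarrow> 'e set \<Rightarrow> ('v, 'e) mgraph" where
  "edge_subgraph G F = \<lparr>verts = (\<Union>e\<in>F. ends G e), edges = F, ends = ends G\<rparr>"


section \<open>Simple iterated graph systems\<close>

datatype side = Minus | Plus

text \<open>A graph with labelled endpoints; \<open>lab G Minus e\<close> and \<open>lab G Plus e\<close> are \<open>e\<^sup>-\<close> and \<open>e\<^sup>+\<close>.\<close>

record ('v, 'e) lgraph = "('v, 'e) mgraph" +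
  lab :: "side \<Rightarrow> 'e \<Rightarrow> 'v"

record ('v, 'e, 'i) igs =
  gen :: "('v, 'e) lgraph"
  idx :: "'i set"
  glue :: "side \<Rightarrow> 'i \<Rightarrow> 'v"

definition boundary :: "('v, 'e, 'i) igs \<Rightarrow> side \<Rightarrow> 'v set" where
  "boundary S s = glue S s ` idx S"

definition simple_igs :: "('v, 'e, 'i) igs \<Rightarrow> bool" where
  "simple_igs S \<longleftrightarrow>
     mgraph (gen S) \<and> connected_mgraph (gen S) \<and>
     finite (idx S) \<and> idx S \<noteq> {} \<and>
     (\<forall>s. inj_on (glue S s) (idx S) \<and> glue S s ` idx S \<subseteq> verts (gen S)) \<and>
     (\<forall>e\<in>edges (gen S). ends (gen S) e = {lab (gen S) Minus e, lab (gen S) Plus e}) \<and>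
     boundary S Minus \<inter> boundary S Plus = {} \<and>
     (\<forall>e\<in>edges (gen S). \<forall>s. \<not> ends (gen S) e \<subseteq> boundary S s)"

definition doubling_igs :: "('v, 'e, 'i) igs \<Rightarrow> bool" where
  "doubling_igs S \<longleftrightarrow> (\<forall>v \<in> boundary S Minus \<union> boundary S Plus. degree (gen S) v = 1)"

definition nondegenerate_igs :: "('v, 'e, 'i) igs \<Rightarrow> bool" where
  "nondegenerate_igs S \<longleftrightarrow>
     \<not> (\<exists>e\<in>edges (gen S). \<exists>v\<in>boundary S Minus. \<exists>w\<in>boundary S Plus. ends (gen S) e = {v, w})"

definition symmetric_igs :: "('v, 'e, 'i) igs \<Rightarrow> bool" where
  "symmetric_igs S \<longleftrightarrow> (\<exists>\<eta> \<epsilon>. mgraph_iso (gen S) (gen S) \<eta> \<epsilon> \<and>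
     (\<forall>i\<in>idx S. \<eta> (glue S Minus i) = glue S Plus i \<and> \<eta> (glue S Plus i) = glue S Minus i))"

definition Theta1 :: "('v, 'e, 'i) igs \<Rightarrow> ('v list \<times> 'e list) set" where
  "Theta1 S = paths_between (gen S) (boundary S Minus) (boundary S Plus)"

definition Lstar :: "('v, 'e, 'i) igs \<Rightarrow> nat" where
  "Lstar S = Min {path_dist (gen S) v w | v w. v \<in> boundary S Minus \<and> w \<in> boundary S Plus}"


section \<open>Replacement graphs\<close>

text \<open>All replacement graphs live in one type.  An edge of \<open>G\<^sub>n\<close> is a list of \<open>n\<close> edges of the
  generator: \<open>[e]\<close> stands for \<open>e \<in> E\<^sub>1\<close> and \<open>e # f\<close> for \<open>(e, f) \<in> E\<^sub>n\<^sub>+\<^sub>1 = E\<^sub>1 \<times> E\<^sub>n\<close>, so that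
  \<open>\<bar>e\<bar>\<close> is \<open>length e\<close> and \<open>\<pi>\<^sub>n\<^sub>+\<^sub>1\<close> is \<open>tl\<close>.  A vertex is a generator vertex (\<open>n = 1\<close>) or an
  equivalence class in \<open>V\<^sub>1 \<times> E\<^sub>n\<^sub>-\<^sub>1\<close> (\<open>n \<ge> 2\<close>).\<close>

datatype ('v, 'e) rvert = Base 'v | Class "('v \<times> 'e list) set"

type_synonym ('v, 'e) rgraph = "(('v, 'e) rvert, 'e list) lgraph"

definition glue_gen :: "('v, 'e, 'i) igs \<Rightarrow> ('v, 'e) rgraph \<Rightarrow> 'v \<times> 'e list \<Rightarrow> 'v \<times> 'e list \<Rightarrow> bool" where
  "glue_gen S H x y \<longleftrightarrow> (\<exists>s t i e f. i \<in> idx S \<and> e \<in> edges H \<and> f \<in> edges H \<and>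
     lab H s e = lab H t f \<and> x = (glue S s i, e) \<and> y = (glue S t i, f))"

definition glue_rel :: "('v, 'e, 'i) igs \<Rightarrow> ('v, 'e) rgraph \<Rightarrow> (('v \<times> 'e list) \<times> ('v \<times> 'e list)) set" where
  "glue_rel S H = {(x, y). x \<in> verts (gen S) \<times> edges H \<and> y \<in> verts (gen S) \<times> edges H \<and>
     equivclp (glue_gen S H) x y}"

definition glue_class :: "('v, 'e, 'i) igs \<Rightarrow> ('v, 'e) rgraph \<Rightarrow> 'v \<Rightarrow> 'e list \<Rightarrow> ('v, 'e) rvert" where
  "glue_class S H v e = Class (glue_rel S H `` {(v, e)})"

definition replace_step :: "('v, 'e, 'i) igs \<Rightarrow> ('v, 'e) rgraph \<Rightarrow> ('v, 'e) rgraph" where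
  "replace_step S H =
     \<lparr>verts = Class ` ((verts (gen S) \<times> edges H) // glue_rel S H),
      edges = {e # f | e f. e \<in> edges (gen S) \<and> f \<in> edges H},
      ends = (\<lambda>g. {glue_class S H (lab (gen S) Minus (hd g)) (tl g),
                   glue_class S H (lab (gen S) Plus (hd g)) (tl g)}),
      lab = (\<lambda>s g. glue_class S H (lab (gen S) s (hd g)) (tl g))\<rparr>"

definition base_graph :: "('v, 'e, 'i) igs \<Rightarrow> ('v, 'e) rgraph" where
  "base_graph S =
     \<lparr>verts = Base ` verts (gen S),
      edges = (\<lambda>e. [e]) ` edges (gen S),
      ends = (\<lambda>g. Base ` ends (gen S) (hd g)),
      lab = (\<lambda>s g. Base (lab (gen S) s (hd g)))\<rparr>"

text \<open>\<open>replacement S n\<close> is \<open>G\<^sub>n\<close> for \<open>n \<ge> 1\<close>; the value at \<open>0\<close> is not used.\<close>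

definition replacement :: "('v, 'e, 'i) igs \<Rightarrow> nat \<Rightarrow> ('v, 'e) rgraph" where
  "replacement S n = (replace_step S ^^ (n - 1)) (base_graph S)"

definition edge_proj :: "nat \<Rightarrow> nat \<Rightarrow> 'e list \<Rightarrow> 'e list" where
  "edge_proj n k = tl ^^ (n - k)"

text \<open>The edge set of the subgraph \<open>e \<cdot> G\<^bsub>n - \<bar>e\<bar>\<^esub>\<close> of \<open>G\<^sub>n\<close>.\<close>

definition cylinder :: "('v, 'e, 'i) igs \<Rightarrow> nat \<Rightarrow> 'e list \<Rightarrow> 'e list set" where
  "cylinder S n e = {f \<in> edges (replacement S n). edge_proj n (length e) f = e}"


section \<open>The limit space and its intrinsic metric\<close>

definition symbol_space :: "('v, 'e, 'i) igs \<Rightarrow> (nat \<Rightarrow> 'e list) set" where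
  "symbol_space S =
     {s \<in> (\<Pi>\<^sub>E i\<in>{1..}. edges (replacement S i)). \<forall>i\<ge>1. edge_proj (Suc i) i (s (Suc i)) = s i}"

definition limit_rel :: "('v, 'e, 'i) igs \<Rightarrow> ((nat \<Rightarrow> 'e list) \<times> (nat \<Rightarrow> 'e list)) set" where
  "limit_rel S = {(s, t). s \<in> symbol_space S \<and> t \<in> symbol_space S \<and>
     (\<forall>i\<ge>1. ends (replacement S i) (s i) \<inter> ends (replacement S i) (t i) \<noteq> {})}"

definition limit_space :: "('v, 'e, 'i) igs \<Rightarrow> (nat \<Rightarrow> 'e list) set set" where
  "limit_space S = symbol_space S // limit_rel S"

definition vert_dist :: "('v, 'e, 'i) igs \<Rightarrow> nat \<Rightarrow> ('v, 'e) rvert \<Rightarrow> ('v, 'e) rvert \<Rightarrow> real" where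
  "vert_dist S n v w = (if v = w then 0 else
     Inf {\<Sum>e\<in>\<Omega>. inverse (real (Lstar S)) ^ length e | \<Omega>.
       \<Omega> \<subseteq> (\<Union>i\<in>{1..n}. edges (replacement S i)) \<and>
       paths_between (edge_subgraph (replacement S n) (\<Union>e\<in>\<Omega>. cylinder S n e)) {v} {w} \<noteq> {}})"

definition edge_dist :: "('v, 'e, 'i) igs \<Rightarrow> nat \<Rightarrow> 'e list \<Rightarrow> 'e list \<Rightarrow> real" where
  "edge_dist S n e f =
     Min {vert_dist S n v w | v w. v \<in> ends (replacement S n) e \<and> w \<in> ends (replacement S n) f}"

text \<open>The value is the common limit over all pairs of representatives.  It is set to \<open>0\<close> outside the
  limit space because \<open>Metric_space\<close> requires symmetry and nonnegativity on the whole type.\<close>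

definition limit_dist ::
  "('v, 'e, 'i) igs \<Rightarrow> (nat \<Rightarrow> 'e list) set \<Rightarrow> (nat \<Rightarrow> 'e list) set \<Rightarrow> real" where
  "limit_dist S x y = (if x \<in> limit_space S \<and> y \<in> limit_space S
     then THE r. \<forall>s\<in>x. \<forall>t\<in>y. (\<lambda>i. edge_dist S i (s i) (t i)) \<longlonglongrightarrow> r
     else 0)"


section \<open>Modulus\<close>

definition admissible :: "('v, 'e, 'more) mgraph_scheme \<Rightarrow> ('v list \<times> 'e list) set \<Rightarrow> ('e \<Rightarrow> real) \<Rightarrow> bool" where
  "admissible G \<Theta> \<rho> \<longleftrightarrow> \<rho> \<in> edges G \<rightarrow> {0..1} \<and> (\<forall>(vs, es)\<in>\<Theta>. sum_list (map \<rho> es) \<ge> 1)"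

definition modulus :: "real \<Rightarrow> ('v list \<times> 'e list) set \<Rightarrow> ('v, 'e, 'more) mgraph_scheme \<Rightarrow> real" where
  "modulus p \<Theta> G = Inf {\<Sum>e\<in>edges G. \<rho> e powr p | \<rho>. admissible G \<Theta> \<rho>}"


section \<open>Ahlfors regular conformal dimension\<close>

definition ediam :: "('a \<Rightarrow> 'a \<Rightarrow> real) \<Rightarrow> 'a set \<Rightarrow> ennreal" where
  "ediam d A = (SUP x\<in>A. SUP y\<in>A. ennreal (d x y))"

definition radon_measure :: "'a topology \<Rightarrow> 'a measure \<Rightarrow> bool" where
  "radon_measure T \<mu> \<longleftrightarrow>
     space \<mu> = topspace T \<and> sets \<mu> = sigma_sets (topspace T) {U. openin T U} \<and>
     (\<forall>K. compactin T K \<longrightarrow> emeasure \<mu> K < \<infinity>) \<and>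
     (\<forall>A\<in>sets \<mu>. emeasure \<mu> A = (INF U\<in>{U. openin T U \<and> A \<subseteq> U}. emeasure \<mu> U)) \<and>
     (\<forall>U. openin T U \<longrightarrow> emeasure \<mu> U = (SUP K\<in>{K. compactin T K \<and> K \<subseteq> U}. emeasure \<mu> K))"

definition ahlfors_regular :: "'a set \<Rightarrow> ('a \<Rightarrow> 'a \<Rightarrow> real) \<Rightarrow> real \<Rightarrow> bool" where
  "ahlfors_regular X d Q \<longleftrightarrow> Metric_space X d \<and> Q > 0 \<and>
     (\<exists>\<mu> C. radon_measure (Metric_space.mtopology X d) \<mu> \<and> C \<ge> 1 \<and>
       (\<forall>x\<in>X. \<forall>r. 0 < r \<and> ennreal r \<le> 2 * ediam d X \<longrightarrow>
          ennreal (inverse C * r powr Q) \<le> emeasure \<mu> (Metric_space.mball X d x r) \<and>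
          emeasure \<mu> (Metric_space.mball X d x r) \<le> ennreal (C * r powr Q)))"

definition quasisymmetric :: "'a set \<Rightarrow> ('a \<Rightarrow> 'a \<Rightarrow> real) \<Rightarrow> ('a \<Rightarrow> 'a \<Rightarrow> real) \<Rightarrow> bool" where
  "quasisymmetric X d \<delta> \<longleftrightarrow> Metric_space X d \<and> Metric_space X \<delta> \<and>
     homeomorphic_map (Metric_space.mtopology X d) (Metric_space.mtopology X \<delta>) id \<and>
     (\<exists>\<psi> :: real \<Rightarrow> real.
        homeomorphic_map (top_of_set {0..}) (top_of_set {0..}) \<psi> \<and>
        (\<forall>x\<in>X. \<forall>y\<in>X. \<forall>z\<in>X. x \<noteq> z \<longrightarrow> \<delta> x y / \<delta> x z \<le> \<psi> (d x y / d x z)))"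

text \<open>Only meaningful for \<open>s > 0\<close>, where \<open>0 powr s = 0\<close> and empty sets may pad the cover.\<close>

definition hausdorff_content ::
  "'a set \<Rightarrow> ('a \<Rightarrow> 'a \<Rightarrow> real) \<Rightarrow> real \<Rightarrow> real \<Rightarrow> ennreal" where
  "hausdorff_content X d s \<epsilon> = Inf {\<Sum>i. ennreal (enn2real (ediam d (U i)) powr s) | U :: nat \<Rightarrow> 'a set.
     (\<forall>i. U i \<subseteq> X \<and> ediam d (U i) \<le> ennreal \<epsilon>) \<and> X \<subseteq> (\<Union>i. U i)}"

definition hausdorff_meas :: "'a set \<Rightarrow> ('a \<Rightarrow> 'a \<Rightarrow> real) \<Rightarrow> real \<Rightarrow> ennreal" where
  "hausdorff_meas X d s = (SUP \<epsilon>\<in>{0<..}. hausdorff_content X d s \<epsilon>)"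

definition hausdorff_dim :: "'a set \<Rightarrow> ('a \<Rightarrow> 'a \<Rightarrow> real) \<Rightarrow> ennreal" where
  "hausdorff_dim X d = Inf {ennreal s | s. s > 0 \<and> hausdorff_meas X d s = 0}"

definition AR_gauge :: "'a set \<Rightarrow> ('a \<Rightarrow> 'a \<Rightarrow> real) \<Rightarrow> ('a \<Rightarrow> 'a \<Rightarrow> real) set" where
  "AR_gauge X d = {\<delta>. quasisymmetric X d \<delta> \<and> (\<exists>Q\<ge>1. ahlfors_regular X \<delta> Q)}"

definition AR_conformal_dim :: "'a set \<Rightarrow> ('a \<Rightarrow> 'a \<Rightarrow> real) \<Rightarrow> ennreal" where
  "AR_conformal_dim X d = Inf (hausdorff_dim X ` AR_gauge X d)"

end

theory Submission
  imports Defs "HOL-Probability.Probability"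
begin

text \<open>
  A weight \<open>\<rho>\<close> on the generator extends multiplicatively to the edges of all replacement graphs.  If it
  is admissible, and equal on the two boundary edges with a common index, the chain distance of
  \<open>\<rho>\<close> between two points is comparable to the weight of the edge at which their codes separate.
  All such metrics are therefore quasisymmetric to each other; \<open>d\<close> itself is the case of the constant
  weight \<open>1 / L\<^sub>*\<close>.  For \<open>Q > Q\<^sub>*\<close> there is such a weight with \<open>\<Sum> \<rho>\<^sup>Q = 1\<close>, and the Bernoulli measure with
  probabilities \<open>\<rho>\<^sup>Q\<close> makes its metric \<open>Q\<close>-regular.  Conversely, let \<open>\<delta>\<close> be quasisymmetric to \<open>d\<close> and \<open>Q\<close>-regular
  with \<open>Q < p < Q\<^sub>*\<close>.  Packing disjoint balls bounds the sums \<open>\<Sum> diam\<^sub>\<delta>(X\<^sub>e)\<^sup>p\<close> over the edges of \<open>G\<^sub>n\<close>,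
  while testing the \<open>n\<close>-fold product of the flow of a symmetric \<open>p\<close>-energy minimizer with the
  \<open>\<delta>\<close>-distance to one side shows that they grow like \<open>Mod\<^sub>p\<^sup>n\<close>, and \<open>Mod\<^sub>p > 1\<close>.
\<close>

section \<open>Combinatorics of the replacement graphs\<close>

text \<open>Words carry their newest letter at the head, so \<open>tl\<close> passes to the parent
  and every induction removes the finest letter. Vertices are equivalence classes and awkward to
  handle; they are accessed through darts, pairs of a side and an edge, and \<open>lb_Suc\<close>
  decides when two darts meet: inside one copy of the generator, or over a vertex one level down
  where both carry a boundary vertex of the same index. Doubling makes the edge at a boundary vertex
  unique, so a vertex lifts along a chosen index; this takes the place of lifting paths.
  Non-degeneracy, with the ban on edges inside one side, keeps every edge from having two boundary
  ends; this gives a potential with jumps at most 1/2 and an interior cell in every cell. Symmetry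
  makes gluing harmless: either of the two boundary edges with one index may be glued to either, so
  weights and absolute flows have to agree on them, and averaging a minimizer with its reflection
  achieves this. The exponent is pinned down because the modulus is continuous, at least 1 at
  exponent 1, and strictly below 1 beyond any exponent where it is at most 1.\<close>

definition words :: "'e set \<Rightarrow> nat \<Rightarrow> 'e list set" where
  "words A n = {e. length e = n \<and> set e \<subseteq> A}"

lemma words_Suc: "words A (Suc n) = {a # e | a e. a \<in> A \<and> e \<in> words A n}"
  unfolding words_def by (auto simp: length_Suc_conv)

lemma Cons_in_words [simp]: "a # e \<in> words A (Suc n) \<longleftrightarrow> a \<in> A \<and> e \<in> words A n"
  by (auto simp: words_Suc)

lemma words_1: "words A (Suc 0) = (\<lambda>a. [a]) ` A"
  unfolding words_def by (auto simp: length_Suc_conv)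

lemma finite_words: "finite A \<Longrightarrow> finite (words A n)"
  unfolding words_def using finite_lists_length_eq[of A n] by (simp add: conj_commute)

lemma drop_words: "e \<in> words A n \<Longrightarrow> drop k e \<in> words A (n - k)"
  unfolding words_def by (auto dest: in_set_dropD)

lemma edge_proj_eq_drop: "edge_proj n k e = drop (n - k) e"
proof -
  have "(tl ^^ m) e = drop m e" for m
    by (induction m) (auto simp: drop_Suc tl_drop)
  then show ?thesis by (simp add: edge_proj_def)
qed

locale laakso_igs =
  fixes S :: "('v, 'e, 'i) igs"
  assumes simple: "simple_igs S" and doubling: "doubling_igs S"
    and nondegenerate: "nondegenerate_igs S" and symmetric: "symmetric_igs S"
begin

abbreviation E\<^sub>1 where "E\<^sub>1 \<equiv> edges (gen S)"
abbreviation V\<^sub>1 where "V\<^sub>1 \<equiv> verts (gen S)"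
abbreviation I where "I \<equiv> idx S"
abbreviation l where "l \<equiv> lab (gen S)"
abbreviation \<phi> where "\<phi> \<equiv> glue S"
abbreviation W where "W \<equiv> words E\<^sub>1"
abbreviation G where "G \<equiv> replacement S"
abbreviation lb where "lb n \<equiv> lab (G n)"

section \<open>The generator: ends of edges and boundary vertices of degree one\<close>

lemma finE: "finite E\<^sub>1" and finI: "finite I" and I_ne: "I \<noteq> {}"
  using simple by (auto simp: simple_igs_def mgraph_def)

lemma ends1: "a \<in> E\<^sub>1 \<Longrightarrow> ends (gen S) a = {l Minus a, l Plus a}"
  using simple by (auto simp: simple_igs_def)

lemma l_in_V: "a \<in> E\<^sub>1 \<Longrightarrow> l s a \<in> V\<^sub>1"
proof -
  assume a: "a \<in> E\<^sub>1"
  then have "\<exists>v\<in>V\<^sub>1. \<exists>w\<in>V\<^sub>1. v \<noteq> w \<and> ends (gen S) a = {v, w}"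
    using simple unfolding simple_igs_def mgraph_def by blast
  then show ?thesis using ends1[OF a] by (cases s) (auto simp: doubleton_eq_iff)
qed

lemma l_neq: "a \<in> E\<^sub>1 \<Longrightarrow> l Minus a \<noteq> l Plus a"
proof -
  assume a: "a \<in> E\<^sub>1"
  then have "\<exists>v\<in>V\<^sub>1. \<exists>w\<in>V\<^sub>1. v \<noteq> w \<and> ends (gen S) a = {v, w}"
    using simple unfolding simple_igs_def mgraph_def by blast
  then show ?thesis using ends1[OF a] by (auto simp: doubleton_eq_iff)
qed

lemma l_inj: "a \<in> E\<^sub>1 \<Longrightarrow> l s a = l t a \<longleftrightarrow> s = t"
  using l_neq[of a] by (cases s; cases t) auto

lemma \<phi>_in_V: "i \<in> I \<Longrightarrow> \<phi> u i \<in> V\<^sub>1"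
  using simple by (auto simp: simple_igs_def)

lemma \<phi>_eq_iff: "i \<in> I \<Longrightarrow> j \<in> I \<Longrightarrow> \<phi> u i = \<phi> v j \<longleftrightarrow> u = v \<and> i = j"
proof -
  assume ij: "i \<in> I" "j \<in> I"
  have "boundary S Minus \<inter> boundary S Plus = {}" "inj_on (\<phi> s) I" for s
    using simple by (auto simp: simple_igs_def)
  with ij show ?thesis
    by (cases u; cases v) (auto simp: boundary_def inj_on_def)
qed

text \<open>Degree one leaves a single edge at the boundary vertex, and the two ends of an edge
  differ, so its side is determined too.\<close>

lemma ex1_dart: "i \<in> I \<Longrightarrow> \<exists>!x. snd x \<in> E\<^sub>1 \<and> l (fst x) (snd x) = \<phi> u i"
proof -
  assume i: "i \<in> I"
  have "\<phi> u i \<in> boundary S Minus \<union> boundary S Plus"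
    using i by (cases u) (auto simp: boundary_def)
  then have "card {e \<in> E\<^sub>1. \<phi> u i \<in> ends (gen S) e} = 1"
    using doubling by (auto simp: doubling_igs_def degree_def)
  then obtain a where a: "{e \<in> E\<^sub>1. \<phi> u i \<in> ends (gen S) e} = {a}"
    by (auto simp: card_1_singleton_iff)
  then have aE: "a \<in> E\<^sub>1" "\<phi> u i \<in> {l Minus a, l Plus a}" using ends1[of a] by auto
  then obtain s where s: "l s a = \<phi> u i" by auto
  show ?thesis
  proof (rule ex1I[of _ "(s, a)"])
    show "snd (s, a) \<in> E\<^sub>1 \<and> l (fst (s, a)) (snd (s, a)) = \<phi> u i" using aE s by auto
    fix x assume x: "snd x \<in> E\<^sub>1 \<and> l (fst x) (snd x) = \<phi> u i"
    then have "\<phi> u i \<in> ends (gen S) (snd x)" using ends1[of "snd x"]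
      by (cases "fst x") (metis insertCI)+
    then have "snd x = a" using a x by blast
    then show "x = (s, a)" using x s l_inj[of a "fst x" s] by (auto simp: prod_eq_iff)
  qed
qed

text \<open>The only edge at the degree-one vertex \<open>\<phi> u i\<close>, with the side on which it meets it.\<close>

definition dart :: "side \<Rightarrow> 'i \<Rightarrow> side \<times> 'e" where
  "dart u i = (THE x. snd x \<in> E\<^sub>1 \<and> l (fst x) (snd x) = \<phi> u i)"
abbreviation ds where "ds u i \<equiv> fst (dart u i)"
abbreviation da where "da u i \<equiv> snd (dart u i)"

lemma da_in: "i \<in> I \<Longrightarrow> da u i \<in> E\<^sub>1" and l_dart: "i \<in> I \<Longrightarrow> l (ds u i) (da u i) = \<phi> u i"
  using theI'[OF ex1_dart, of i u] unfolding dart_def by auto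

lemma dart_unique: "i \<in> I \<Longrightarrow> a \<in> E\<^sub>1 \<Longrightarrow> l s a = \<phi> u i \<Longrightarrow> s = ds u i \<and> a = da u i"
  using ex1_dart[of i u] da_in[of i u] l_dart[of i u] by (metis fst_conv snd_conv)

text \<open>Equal sides are excluded by the ban on edges inside \<open>boundary S u\<close>,
  different sides by non-degeneracy. Hence every edge has an end off the boundary.\<close>

lemma not_both_boundary:
  assumes "a \<in> E\<^sub>1" "i \<in> I" "j \<in> I" "l Minus a = \<phi> u i" "l Plus a = \<phi> v j"
  shows False
proof (cases "u = v")
  case True
  have "\<not> ends (gen S) a \<subseteq> boundary S u"
    using simple assms(1) by (auto simp: simple_igs_def)
  with assms True ends1[OF assms(1)] show False by (auto simp: boundary_def)
next
  case False
  have *: "\<not> (\<exists>v\<in>boundary S Minus. \<exists>w\<in>boundary S Plus. ends (gen S) a = {v, w})"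
    using nondegenerate assms(1) by (auto simp: nondegenerate_igs_def)
  have "\<phi> u i \<in> boundary S u" "\<phi> v j \<in> boundary S v" using assms by (auto simp: boundary_def)
  with * False ends1[OF assms(1)] assms(4,5) show False
    by (cases u; cases v) (auto simp: insert_commute)
qed

section \<open>Edges and vertices of the replacement graphs: when two darts meet\<close>

lemma G_1: "G (Suc 0) = base_graph S"
  by (simp add: replacement_def)

lemma G_Suc: "n \<ge> 1 \<Longrightarrow> G (Suc n) = replace_step S (G n)"
  by (cases n) (auto simp: replacement_def)

lemma edges_G: "n \<ge> 1 \<Longrightarrow> edges (G n) = W n"
proof (induction n rule: nat_induct_at_least)
  case base
  then show ?case by (auto simp: G_1 base_graph_def words_1)
next
  case (Suc n)
  then show ?case by (auto simp: G_Suc replace_step_def words_Suc)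
qed

lemma ends_G: "n \<ge> 1 \<Longrightarrow> e \<in> W n \<Longrightarrow> ends (G n) e = {lb n Minus e, lb n Plus e}"
proof (induction n rule: nat_induct_at_least)
  case base
  then show ?case by (auto simp: G_1 base_graph_def words_1 ends1)
next
  case (Suc n)
  then show ?case by (auto simp: G_Suc replace_step_def)
qed

lemma lb_1: "lb (Suc 0) s [a] = lb (Suc 0) t [b] \<longleftrightarrow> l s a = l t b"
  by (auto simp: G_1 base_graph_def)

text \<open>One gluing step already suffices: a middle point determines its side and index, because
  the gluing maps are injective with disjoint images, so two consecutive steps use the same index
  and compose through a common vertex of \<open>H\<close>.\<close>

lemma glue_gen_equivclp: "equivclp (glue_gen S H) x y \<longleftrightarrow> x = y \<or> glue_gen S H x y"
proof
  assume "equivclp (glue_gen S H) x y"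
  then show "x = y \<or> glue_gen S H x y"
  proof (induction rule: equivclp_induct)
    case base
    then show ?case by auto
  next
    case (step y z)
    have sym: "glue_gen S H z y \<Longrightarrow> glue_gen S H y z" unfolding glue_gen_def by metis
    with step have yz: "glue_gen S H y z" by auto
    show ?case
    proof (cases "x = y")
      case True
      with yz show ?thesis by auto
    next
      case False
      with step have "glue_gen S H x y" by auto
      then obtain s t i e f where 1: "i \<in> I" "e \<in> edges H" "f \<in> edges H" "lab H s e = lab H t f"
        "x = (\<phi> s i, e)" "y = (\<phi> t i, f)" unfolding glue_gen_def by blast
      from yz obtain s' t' i' e' f' where 2: "i' \<in> I" "e' \<in> edges H" "f' \<in> edges H"
        "lab H s' e' = lab H t' f'" "y = (\<phi> s' i', e')" "z = (\<phi> t' i', f')"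
        unfolding glue_gen_def by blast
      have "s' = t" "i' = i" "e' = f" using 1 2 \<phi>_eq_iff[of i i' t s'] by auto
      with 1 2 have "glue_gen S H x z" unfolding glue_gen_def
        by (intro exI[of _ s] exI[of _ t'] exI[of _ i] exI[of _ e] exI[of _ f']) auto
      then show ?thesis by simp
    qed
  qed
next
  assume "x = y \<or> glue_gen S H x y"
  then show "equivclp (glue_gen S H) x y" by auto
qed

lemma glue_class_eq:
  assumes "v \<in> V\<^sub>1" "w \<in> V\<^sub>1" "e \<in> edges H" "f \<in> edges H"
  shows "glue_class S H v e = glue_class S H w f \<longleftrightarrow> (v, e) = (w, f) \<or> glue_gen S H (v, e) (w, f)"
proof -
  have eq: "equiv (V\<^sub>1 \<times> edges H) (glue_rel S H)"
    unfolding equiv_def glue_rel_def refl_on_def sym_def trans_def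
    by (auto intro: equivclp_sym equivclp_trans)
  have "glue_class S H v e = glue_class S H w f \<longleftrightarrow> ((v, e), (w, f)) \<in> glue_rel S H"
    unfolding glue_class_def using eq_equiv_class_iff[OF eq, of "(v,e)" "(w,f)"] assms by auto
  also have "\<dots> \<longleftrightarrow> (v, e) = (w, f) \<or> glue_gen S H (v, e) (w, f)"
    unfolding glue_rel_def using assms by (auto simp: glue_gen_equivclp)
  finally show ?thesis .
qed

text \<open>Takes over from the quotient construction: later inductions read off equality of
  vertices from this recursion in the newest letter.\<close>

lemma lb_Suc:
  assumes n: "n \<ge> 1" and "a \<in> E\<^sub>1" "b \<in> E\<^sub>1" "e \<in> W n" "f \<in> W n"
  shows "lb (Suc n) s (a # e) = lb (Suc n) t (b # f) \<longleftrightarrow>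
    (e = f \<and> l s a = l t b) \<or>
    (\<exists>i\<in>I. \<exists>u v. l s a = \<phi> u i \<and> l t b = \<phi> v i \<and> lb n u e = lb n v f)"
proof -
  have "lb (Suc n) s (a # e) = lb (Suc n) t (b # f) \<longleftrightarrow>
    glue_class S (G n) (l s a) e = glue_class S (G n) (l t b) f"
    using n by (simp add: G_Suc replace_step_def)
  also have "\<dots> \<longleftrightarrow> (l s a, e) = (l t b, f) \<or> glue_gen S (G n) (l s a, e) (l t b, f)"
    using glue_class_eq[of "l s a" "l t b" e "G n" f] assms l_in_V edges_G[OF n] by auto
  also have "\<dots> \<longleftrightarrow> (e = f \<and> l s a = l t b) \<or>
    (\<exists>i\<in>I. \<exists>u v. l s a = \<phi> u i \<and> l t b = \<phi> v i \<and> lb n u e = lb n v f)"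
    unfolding glue_gen_def using assms edges_G[OF n] by (auto; blast)
  finally show ?thesis .
qed

text \<open>Lifting a vertex along the index \<open>i\<close>: the lift does not depend on the dart
  by which the vertex is reached.\<close>

lemma lb_cons_boundary:
  assumes "n \<ge> 1" "e \<in> W n" "f \<in> W n" "i \<in> I" "lb n u e = lb n v f"
  shows "lb (Suc n) (ds u i) (da u i # e) = lb (Suc n) (ds v i) (da v i # f)"
  using assms lb_Suc[of n "da u i" "da v i" e f "ds u i" "ds v i"] da_in[OF assms(4)] l_dart[OF assms(4)]
  by auto

subsection \<open>Touching edges\<close>

definition touch :: "nat \<Rightarrow> 'e list \<Rightarrow> 'e list \<Rightarrow> bool" where
  "touch n e f \<longleftrightarrow> ends (G n) e \<inter> ends (G n) f \<noteq> {}"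

lemma touch_iff:
  assumes "n \<ge> 1" "e \<in> W n" "f \<in> W n"
  shows "touch n e f \<longleftrightarrow> (\<exists>s t. lb n s e = lb n t f)"
proof
  assume "touch n e f"
  then show "\<exists>s t. lb n s e = lb n t f" unfolding touch_def using ends_G[OF assms(1,2)] ends_G[OF assms(1,3)]
    by auto metis+
next
  assume "\<exists>s t. lb n s e = lb n t f"
  then obtain s t where "lb n s e = lb n t f" by auto
  moreover have "lb n s e \<in> ends (G n) e"
    using ends_G[OF assms(1,2)] by (cases s) auto
  moreover have "lb n t f \<in> ends (G n) f"
    using ends_G[OF assms(1,3)] by (cases t) auto
  ultimately show "touch n e f" unfolding touch_def by auto
qed

lemma touch_refl: "n \<ge> 1 \<Longrightarrow> e \<in> W n \<Longrightarrow> touch n e e"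
  by (auto simp: touch_iff)

lemma touch_sym: "touch n e f \<Longrightarrow> touch n f e"
  by (auto simp: touch_def)

lemma touch_tl:
  assumes "n \<ge> 1" "a # e \<in> W (Suc n)" "b # f \<in> W (Suc n)" "touch (Suc n) (a # e) (b # f)"
  shows "touch n e f"
  using assms lb_Suc[OF assms(1), of a b e f] touch_refl[of n e]
  by (auto simp: touch_iff[of "Suc n"] touch_iff[of n])

text \<open>A vertex interior to \<open>e \<cdot> G\<^sub>1\<close> lies only on children of \<open>e\<close>, and the vertices over a boundary
  vertex are in bijection with the darts one level up; so degrees do not grow.\<close>

lemma finite_darts: "finite {(t, f). f \<in> W n \<and> P (t::side) f}"
proof -
  have "{(t, f). f \<in> W n \<and> P t f} \<subseteq> {Minus, Plus} \<times> W n"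
    using side.exhaust by auto
  then show ?thesis using finite_words[OF finE] finite_subset by blast
qed

lemma card_darts:
  assumes "n \<ge> 1" "e \<in> W n"
  shows "card {(t, f). f \<in> W n \<and> lb n t f = lb n s e} \<le> 2 * card E\<^sub>1"
  using assms
proof (induction n arbitrary: e s rule: nat_induct_at_least)
  case base
  have "{(t, f). f \<in> W 1 \<and> lb 1 t f = lb 1 s e} \<subseteq> {Minus, Plus} \<times> W 1"
    using side.exhaust by auto
  then have "card {(t, f). f \<in> W 1 \<and> lb 1 t f = lb 1 s e} \<le> card ({Minus, Plus} \<times> W 1)"
    using finite_words[OF finE] by (intro card_mono) auto
  also have "\<dots> = 2 * card (W 1)" by (subst card_cartesian_product) auto
  also have "card (W 1) = card E\<^sub>1" by (auto simp: words_1 card_image inj_on_def)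
  finally show ?case .
next
  case (Suc n)
  then obtain a g where e: "e = a # g" "a \<in> E\<^sub>1" "g \<in> W n" by (auto simp: words_Suc)
  show ?case
  proof (cases "\<exists>u i. i \<in> I \<and> l s a = \<phi> u i")
    case True
    then obtain u i where ui: "i \<in> I" "l s a = \<phi> u i" by auto
    let ?A = "{(t, f). f \<in> W (Suc n) \<and> lb (Suc n) t f = lb (Suc n) s e}"
    let ?B = "{(t, f). f \<in> W n \<and> lb n t f = lb n u g}"
    let ?F = "\<lambda>(v, f). (ds v i, da v i # f)"
    have "?A \<subseteq> ?F ` ?B"
    proof clarify
      fix t f assume f: "f \<in> W (Suc n)" "lb (Suc n) t f = lb (Suc n) s e"
      then obtain b h where bh: "f = b # h" "b \<in> E\<^sub>1" "h \<in> W n" by (auto simp: words_Suc)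
      have "\<exists>v. l t b = \<phi> v i \<and> lb n v h = lb n u g"
      proof -
        from f(2) consider "h = g" "l t b = l s a" |
          j p q where "j \<in> I" "l t b = \<phi> p j" "l s a = \<phi> q j" "lb n p h = lb n q g"
          using lb_Suc[of n b a h g t s] bh e Suc.hyps by auto
        then show ?thesis
        proof cases
          case 1
          then show ?thesis using ui by auto
        next
          case 2
          then show ?thesis using ui \<phi>_eq_iff[of i j u q] by auto
        qed
      qed
      then obtain v where v: "l t b = \<phi> v i" "lb n v h = lb n u g" by auto
      have "(t, f) = ?F (v, h)" using dart_unique[OF ui(1) bh(2) v(1)] bh by auto
      moreover have "(v, h) \<in> ?B" using v bh by auto
      ultimately show "(t, f) \<in> ?F ` ?B" by blast
    qed
    then have "card ?A \<le> card (?F ` ?B)" by (intro card_mono finite_imageI finite_darts)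
    also have "\<dots> \<le> card ?B" by (intro card_image_le finite_darts)
    also have "\<dots> \<le> 2 * card E\<^sub>1" using Suc.IH e by auto
    finally show ?thesis .
  next
    case False
    let ?A = "{(t, f). f \<in> W (Suc n) \<and> lb (Suc n) t f = lb (Suc n) s e}"
    have "?A \<subseteq> (\<lambda>(t, b). (t, b # g)) ` ({Minus, Plus} \<times> E\<^sub>1)"
    proof clarify
      fix t f assume f: "f \<in> W (Suc n)" "lb (Suc n) t f = lb (Suc n) s e"
      then obtain b h where bh: "f = b # h" "b \<in> E\<^sub>1" "h \<in> W n" by (auto simp: words_Suc)
      have "h = g" using lb_Suc[of n b a h g t s] bh e Suc.hyps f(2) False by auto
      then show "(t, f) \<in> (\<lambda>(t, b). (t, b # g)) ` ({Minus, Plus} \<times> E\<^sub>1)"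
        using bh by (cases t) auto
    qed
    then have "card ?A \<le> card ((\<lambda>(t, b). (t, b # g)) ` ({Minus, Plus} \<times> E\<^sub>1))"
      using finE by (intro card_mono) auto
    also have "\<dots> \<le> card ({Minus, Plus} \<times> E\<^sub>1)" using finE by (intro card_image_le) auto
    also have "\<dots> = 2 * card E\<^sub>1" by (subst card_cartesian_product) auto
    finally show ?thesis .
  qed
qed

text \<open>Each of the two ends of \<open>e\<close> carries at most
  \<open>2 * card E\<^sub>1\<close> darts.\<close>

lemma card_touch:
  assumes "n \<ge> 1" "e \<in> W n"
  shows "card {f \<in> W n. touch n e f} \<le> 4 * card E\<^sub>1"
proof -
  let ?D = "\<lambda>s. {(t, f). f \<in> W n \<and> lb n t f = lb n s e}"
  have "{f \<in> W n. touch n e f} \<subseteq> snd ` (?D Minus \<union> ?D Plus)"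
  proof clarify
    fix f assume f: "f \<in> W n" "touch n e f"
    then obtain s t where "lb n s e = lb n t f" using touch_iff assms by blast
    with f show "f \<in> snd ` (?D Minus \<union> ?D Plus)"
      by (cases s) (auto intro!: image_eqI[of _ snd "(t, f)"])
  qed
  then have "card {f \<in> W n. touch n e f} \<le> card (snd ` (?D Minus \<union> ?D Plus))"
    by (intro card_mono finite_imageI finite_UnI finite_darts)
  also have "\<dots> \<le> card (?D Minus \<union> ?D Plus)" by (intro card_image_le finite_UnI finite_darts)
  also have "\<dots> \<le> card (?D Minus) + card (?D Plus)" by (rule card_Un_le)
  also have "\<dots> \<le> 4 * card E\<^sub>1"
    using card_darts[OF assms, of Minus] card_darts[OF assms, of Plus] by linarith
  finally show ?thesis .
qed

end

section \<open>Chains\<close>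

text \<open>Only the end points and the edge set of a path matter for the metrics, so paths are
  traded for the reflexive transitive closure of this relation.\<close>

definition erel :: "('v, 'e, 'more) mgraph_scheme \<Rightarrow> 'e set \<Rightarrow> ('v \<times> 'v) set" where
  "erel H F = {(x, y). \<exists>e\<in>F. ends H e = {x, y}}"

lemma erel_mono: "F \<subseteq> F' \<Longrightarrow> (erel H F)\<^sup>* \<subseteq> (erel H F')\<^sup>*"
  by (intro rtrancl_mono) (auto simp: erel_def)

lemma sym_erel: "sym (erel H F)"
  by (auto simp: erel_def sym_def insert_commute)

lemma paths_between_imp_rtrancl:
  assumes "(vs, es) \<in> paths_between H A B"
  shows "hd vs \<in> A" "last vs \<in> B" "(hd vs, last vs) \<in> (erel H (set es))\<^sup>*"
proof -
  have len: "length vs = Suc (length es)" and e: "\<And>i. i < length es \<Longrightarrow> ends H (es ! i) = {vs ! i, vs ! Suc i}"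
    using assms by (auto simp: paths_between_def is_path_def)
  have "(vs ! 0, vs ! k) \<in> (erel H (set es))\<^sup>*" if "k \<le> length es" for k
    using that
  proof (induction k)
    case (Suc k)
    have "(vs ! k, vs ! Suc k) \<in> erel H (set es)"
      using Suc.prems e[of k] unfolding erel_def by (auto intro!: bexI[of _ "es ! k"])
    with Suc show ?case by (auto intro: rtrancl_into_rtrancl)
  qed auto
  moreover have "hd vs = vs ! 0" "last vs = vs ! length es"
    using len hd_conv_nth[of vs] last_conv_nth[of vs] by (cases "vs = []"; simp)+
  ultimately show "(hd vs, last vs) \<in> (erel H (set es))\<^sup>*" by simp
  show "hd vs \<in> A" "last vs \<in> B" using assms by (auto simp: paths_between_def)
qed

lemma rtrancl_imp_paths_between:
  assumes "(x, y) \<in> (erel H (edges H))\<^sup>*" "x \<in> verts H" "\<And>e. e \<in> edges H \<Longrightarrow> ends H e \<subseteq> verts H"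
  shows "paths_between H {x} {y} \<noteq> {}"
  using assms(1)
proof (induction rule: rtrancl_induct)
  case base
  have "([x], []) \<in> paths_between H {x} {x}"
    using assms(2) by (auto simp: paths_between_def is_path_def)
  then show ?case by blast
next
  case (step y z)
  then obtain vs es where p: "(vs, es) \<in> paths_between H {x} {y}" by auto
  from step obtain e where e: "e \<in> edges H" "ends H e = {y, z}" by (auto simp: erel_def)
  have vs: "vs \<noteq> []" "length vs = Suc (length es)" "last vs = y" "hd vs = x"
    using p by (auto simp: paths_between_def is_path_def)
  have y: "y = vs ! length es" using vs by (metis diff_Suc_1 last_conv_nth)
  have "(vs @ [z], es @ [e]) \<in> paths_between H {x} {z}"
    using p e vs y assms(3)[OF e(1)]
    by (auto simp: paths_between_def is_path_def nth_append less_Suc_eq)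
  then show ?case by blast
qed

text \<open>Distinct end points are required because the trivial chain exists everywhere, the
  trivial path only at vertices of the subgraph.\<close>

lemma paths_between_edge_subgraph:
  assumes "x \<noteq> y"
  shows "paths_between (edge_subgraph H F) {x} {y} \<noteq> {} \<longleftrightarrow> (x, y) \<in> (erel H F)\<^sup>*"
proof
  assume "paths_between (edge_subgraph H F) {x} {y} \<noteq> {}"
  then obtain vs es where p: "(vs, es) \<in> paths_between (edge_subgraph H F) {x} {y}" by auto
  then have "(x, y) \<in> (erel (edge_subgraph H F) (set es))\<^sup>*" "set es \<subseteq> F"
    using paths_between_imp_rtrancl[OF p] by (auto simp: paths_between_def is_path_def edge_subgraph_def)
  moreover have "erel (edge_subgraph H F) (set es) = erel H (set es)"
    by (auto simp: erel_def edge_subgraph_def)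
  ultimately show "(x, y) \<in> (erel H F)\<^sup>*" using erel_mono[of "set es" F H] by auto
next
  assume r: "(x, y) \<in> (erel H F)\<^sup>*"
  then obtain z where "(x, z) \<in> erel H F" using assms by (metis converse_rtranclE)
  then have "x \<in> verts (edge_subgraph H F)" by (auto simp: erel_def edge_subgraph_def)
  moreover have "erel (edge_subgraph H F) (edges (edge_subgraph H F)) = erel H F"
    by (auto simp: erel_def edge_subgraph_def)
  ultimately show "paths_between (edge_subgraph H F) {x} {y} \<noteq> {}"
    using r by (intro rtrancl_imp_paths_between) (auto simp: edge_subgraph_def)
qed

text \<open>The intervals spanned by \<open>u\<close> on the members of a chain cover the interval between its end
  values, and a chain may revisit a member without cost: compare Lebesgue measures.\<close>

lemma chain_le:
  fixes u :: "'v \<Rightarrow> real" and w :: "'g \<Rightarrow> real"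
  assumes fin: "finite \<Omega>" and r: "(x, y) \<in> (erel H (\<Union>g\<in>\<Omega>. C g))\<^sup>*" and w0: "\<And>g. g \<in> \<Omega> \<Longrightarrow> 0 \<le> w g"
    and osc: "\<And>g e f p q. g \<in> \<Omega> \<Longrightarrow> e \<in> C g \<Longrightarrow> f \<in> C g \<Longrightarrow> p \<in> ends H e \<Longrightarrow> q \<in> ends H f
      \<Longrightarrow> \<bar>u p - u q\<bar> \<le> w g"
  shows "\<bar>u x - u y\<bar> \<le> (\<Sum>g\<in>\<Omega>. w g)"
proof -
  \<comment> \<open>All values of \<open>u\<close> on one member; they oscillate by at most
    \<open>w g\<close>, so they lie in the interval of that length that starts at their
    infimum.\<close>
  define T where "T g = u ` (\<Union>e\<in>C g. ends H e)" for g
  define K where "K g = {Inf (T g)..Inf (T g) + w g}" for g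
  have K: "t \<in> K g" if g: "g \<in> \<Omega>" and t: "t \<in> T g" for g t
  proof -
    have *: "\<bar>t - s\<bar> \<le> w g" if "s \<in> T g" for s
      using osc[OF g] t that unfolding T_def by blast
    have "t - w g \<le> s" if "s \<in> T g" for s using *[OF that] by (auto simp: abs_le_iff)
    then have "t - w g \<le> Inf (T g)" "bdd_below (T g)"
      using t by (auto intro!: cInf_greatest bdd_belowI)
    then show ?thesis using cInf_lower[OF t] by (auto simp: K_def)
  qed
  \<comment> \<open>The point \<open>u x\<close> serves the trivial chain, for which the family may
    be empty.\<close>
  have cover: "{min (u x) (u y)..max (u x) (u y)} \<subseteq> {u x} \<union> (\<Union>g\<in>\<Omega>. K g)"
    using r
  proof (induction rule: rtrancl_induct)
    case (step y z)
    then obtain g e where g: "g \<in> \<Omega>" "e \<in> C g" "ends H e = {y, z}" by (auto simp: erel_def)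
    then have "u y \<in> T g" "u z \<in> T g" by (auto simp: T_def)
    then have "u y \<in> K g" "u z \<in> K g" using K g by auto
    then have "{min (u y) (u z)..max (u y) (u z)} \<subseteq> K g" by (auto simp: K_def min_def max_def)
    moreover have "{min (u x) (u z)..max (u x) (u z)} \<subseteq>
        {min (u x) (u y)..max (u x) (u y)} \<union> {min (u y) (u z)..max (u y) (u z)}"
      by (auto simp: min_def max_def)
    ultimately show ?case using step.IH g(1) by blast
  qed auto
  have "ennreal \<bar>u x - u y\<bar> = emeasure lborel {min (u x) (u y)..max (u x) (u y)}"
    by (subst emeasure_lborel_Icc) (auto simp: min_def max_def)
  also have "\<dots> \<le> emeasure lborel ({u x} \<union> (\<Union>g\<in>\<Omega>. K g))"
    using fin by (intro emeasure_mono[OF cover] sets.Un sets.finite_UN) (auto simp: K_def)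
  also have "\<dots> \<le> emeasure lborel {u x} + emeasure lborel (\<Union>g\<in>\<Omega>. K g)"
    using fin by (intro emeasure_subadditive) (auto simp: K_def)
  also have "\<dots> \<le> 0 + (\<Sum>g\<in>\<Omega>. emeasure lborel (K g))"
    using fin by (intro add_mono emeasure_subadditive_finite) (auto simp: K_def)
  also have "\<dots> = (\<Sum>g\<in>\<Omega>. ennreal (w g))"
    using w0 by (auto simp: K_def emeasure_lborel_Icc)
  also have "\<dots> = ennreal (\<Sum>g\<in>\<Omega>. w g)" using w0 by (auto simp: sum_ennreal)
  finally show ?thesis using w0 by (auto simp: sum_nonneg)
qed

lemma convex_comb_dist:
  fixes x y z m t :: real
  assumes "\<bar>x - z\<bar> \<le> m" "\<bar>y - z\<bar> \<le> m" "0 \<le> t" "t \<le> 1"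
  shows "\<bar>x + t * (y - x) - z\<bar> \<le> m"
proof -
  have "\<bar>x + t * (y - x) - z\<bar> = \<bar>(1 - t) * (x - z) + t * (y - z)\<bar>" by (simp add: algebra_simps)
  also have "\<dots> \<le> \<bar>(1 - t) * (x - z)\<bar> + \<bar>t * (y - z)\<bar>" by (rule abs_triangle_ineq)
  also have "\<dots> = (1 - t) * \<bar>x - z\<bar> + t * \<bar>y - z\<bar>"
    using assms by (simp add: abs_mult)
  also have "\<dots> \<le> (1 - t) * m + t * m" using assms by (intro add_mono mult_left_mono) auto
  finally show ?thesis by (simp add: algebra_simps)
qed

lemma convex_comb_ge:
  fixes x y m t :: real
  assumes "m \<le> x" "m \<le> y" "0 \<le> t" "t \<le> 1"
  shows "m \<le> x + t * (y - x)"
proof -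
  have "m = (1 - t) * m + t * m" by (simp add: algebra_simps)
  also have "\<dots> \<le> (1 - t) * x + t * y" using assms by (intro add_mono mult_left_mono) auto
  finally show ?thesis by (simp add: algebra_simps)
qed

lemma geometric_increments:
  fixes y :: "nat \<Rightarrow> real"
  assumes inc: "\<And>k. \<bar>y (Suc k) - y k\<bar> \<le> A * r ^ k" and r: "0 \<le> r" "r < 1"
  shows "convergent y" and "\<bar>lim y - y 0\<bar> \<le> A / (1 - r)"
proof -
  let ?d = "\<lambda>k. y (Suc k) - y k"
  have sg: "summable (\<lambda>k. A * r ^ k)" using r by (intro summable_mult summable_geometric) auto
  have sd: "summable (\<lambda>k. \<bar>?d k\<bar>)"
    by (rule summable_comparison_test'[OF sg, of 0]) (use inc in simp)
  have "(\<lambda>n. \<Sum>k<n. ?d k) \<longlonglongrightarrow> suminf ?d"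
    by (rule summable_LIMSEQ[OF summable_rabs_cancel[OF sd]])
  then have "(\<lambda>n. y 0 + (\<Sum>k<n. ?d k)) \<longlonglongrightarrow> y 0 + suminf ?d" by (intro tendsto_intros)
  then have lim: "y \<longlonglongrightarrow> y 0 + suminf ?d" by (simp add: sum_lessThan_telescope)
  then show "convergent y" by (auto simp: convergent_def)
  have "\<bar>suminf ?d\<bar> \<le> (\<Sum>k. \<bar>?d k\<bar>)" using sd by (rule summable_rabs)
  also have "\<dots> \<le> (\<Sum>k. A * r ^ k)" by (intro suminf_le inc sd sg)
  also have "\<dots> = A / (1 - r)" using r by (subst suminf_mult) (auto simp: suminf_geometric)
  finally show "\<bar>lim y - y 0\<bar> \<le> A / (1 - r)" using limI[OF lim] by simp
qed


section \<open>Connectivity of cylinders\<close>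

context laakso_igs
begin

lemma cylinder_iff: "n \<ge> 1 \<Longrightarrow> f \<in> cylinder S n g \<longleftrightarrow> f \<in> W n \<and> drop (n - length g) f = g"
  by (auto simp: cylinder_def edges_G edge_proj_eq_drop)

lemma gen_connected: "v \<in> V\<^sub>1 \<Longrightarrow> w \<in> V\<^sub>1 \<Longrightarrow> (v, w) \<in> (erel (gen S) E\<^sub>1)\<^sup>*"
proof -
  assume "v \<in> V\<^sub>1" "w \<in> V\<^sub>1"
  then have "paths_between (gen S) {v} {w} \<noteq> {}"
    using simple unfolding simple_igs_def connected_mgraph_def by blast
  then obtain vs es where p: "(vs, es) \<in> paths_between (gen S) {v} {w}" by auto
  then have "set es \<subseteq> E\<^sub>1" by (auto simp: paths_between_def is_path_def)
  then show ?thesis using paths_between_imp_rtrancl[OF p] erel_mono[of "set es" E\<^sub>1 "gen S"] by auto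
qed

text \<open>The map from \<open>v\<close> to the class of \<open>(v, e)\<close> carries chains of
  the connected generator to chains among the children of \<open>e\<close>.\<close>

lemma children_connected:
  assumes n: "n \<ge> 1" and e: "e \<in> W n" and ab: "a \<in> E\<^sub>1" "b \<in> E\<^sub>1"
  shows "(lb (Suc n) s (a # e), lb (Suc n) t (b # e)) \<in> (erel (G (Suc n)) ((\<lambda>a. a # e) ` E\<^sub>1))\<^sup>*"
proof -
  let ?c = "\<lambda>v. glue_class S (G n) v e"
  have "(?c x, ?c y) \<in> (erel (G (Suc n)) ((\<lambda>a. a # e) ` E\<^sub>1))\<^sup>*" if "(x, y) \<in> (erel (gen S) E\<^sub>1)\<^sup>*" for x y
    using that
  proof (induction rule: rtrancl_induct)
    case (step y z)
    then obtain b where b: "b \<in> E\<^sub>1" "ends (gen S) b = {y, z}" by (auto simp: erel_def)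
    then have yz: "{y, z} = {l Minus b, l Plus b}" using ends1 by auto
    then have "ends (G (Suc n)) (b # e) = {?c y, ?c z}"
      using n by (auto simp: G_Suc replace_step_def doubleton_eq_iff)
    then have "(?c y, ?c z) \<in> erel (G (Suc n)) ((\<lambda>a. a # e) ` E\<^sub>1)"
      using b by (auto simp: erel_def)
    with step show ?case by auto
  qed auto
  from this[OF gen_connected[OF l_in_V[OF ab(1)] l_in_V[OF ab(2)], of s t]]
  show ?thesis using n by (simp add: G_Suc replace_step_def)
qed

text \<open>A chain one level down is lifted along a fixed index: consecutive lifted vertices are
  joined inside the children of the edge that is crossed. The two given darts are tied to the lifts
  inside the children of their parents.\<close>

lemma cylinder_connected:
  assumes "n \<ge> 1" "k \<le> n" "g \<in> W k" "e \<in> cylinder S n g" "f \<in> cylinder S n g"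
  shows "(lb n s e, lb n t f) \<in> (erel (G n) (cylinder S n g))\<^sup>*"
  using assms
proof (induction n arbitrary: e f s t rule: nat_induct_at_least)
  case base
  have lg: "length g = k" using base by (auto simp: words_def)
  have e: "e \<in> W 1" "f \<in> W 1" using base cylinder_iff[of 1] by auto
  then obtain a b where ab: "e = [a]" "f = [b]" "a \<in> E\<^sub>1" "b \<in> E\<^sub>1" by (auto simp: words_1)
  show ?case
  proof (cases "k = 1")
    case True
    then have "e = g" "f = g" using base cylinder_iff[of 1] lg by auto
    then have "a = b" using ab by auto
    have "(lb 1 Minus e, lb 1 Plus e) \<in> erel (G 1) (cylinder S 1 g)"
         "(lb 1 Plus e, lb 1 Minus e) \<in> erel (G 1) (cylinder S 1 g)"
      using base e ends_G[of 1 e] by (auto simp: erel_def)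
    then show ?thesis using \<open>a = b\<close> ab by (cases s; cases t) auto
  next
    case False
    \<comment> \<open>The empty word has the whole graph as its cylinder, which is connected because
      the generator is.\<close>
    then have "k = 0" using base by auto
    then have c: "cylinder S 1 g = W 1" using lg cylinder_iff[of 1 _ g] by (auto simp: words_def)
    have "(Base x, Base y) \<in> (erel (G 1) (W 1))\<^sup>*" if "(x, y) \<in> (erel (gen S) E\<^sub>1)\<^sup>*" for x y
      using that
    proof (induction rule: rtrancl_induct)
      case (step y z)
      then obtain b where b: "b \<in> E\<^sub>1" "ends (gen S) b = {y, z}" by (auto simp: erel_def)
      then have "ends (G 1) [b] = {Base y, Base z}" by (auto simp: G_1 base_graph_def)
      moreover have "[b] \<in> W 1" using b by (auto simp: words_1)
      ultimately have "(Base y, Base z) \<in> erel (G 1) (W 1)"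
        unfolding erel_def by blast
      with step show ?case by auto
    qed auto
    from this[OF gen_connected[OF l_in_V[OF ab(3)] l_in_V[OF ab(4)], of s t]]
    show ?thesis using c ab by (auto simp: G_1 base_graph_def)
  qed
next
  case (Suc n)
  have lg: "length g = k" using Suc by (auto simp: words_def)
  show ?case
  proof (cases "k = Suc n")
    case True
    then have "e = g" "f = g" using Suc cylinder_iff[of "Suc n"] lg by auto
    have "(lb (Suc n) Minus g, lb (Suc n) Plus g) \<in> erel (G (Suc n)) (cylinder S (Suc n) g)"
         "(lb (Suc n) Plus g, lb (Suc n) Minus g) \<in> erel (G (Suc n)) (cylinder S (Suc n) g)"
      using Suc.prems \<open>e = g\<close> True ends_G[of "Suc n" e] by (auto simp: erel_def)
    then show ?thesis using \<open>e = g\<close> \<open>f = g\<close> by (cases s; cases t) auto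
  next
    case False
    then have k: "k \<le> n" using Suc by auto
    let ?C = "cylinder S (Suc n) g"
    have C: "a # x \<in> ?C \<longleftrightarrow> a \<in> E\<^sub>1 \<and> x \<in> cylinder S n g" for a x
      using cylinder_iff[of "Suc n" "a # x" g] cylinder_iff[of n x g] k lg Suc.hyps
      by (auto simp: Suc_diff_le)
    obtain a x where e: "e = a # x" "a \<in> E\<^sub>1" "x \<in> cylinder S n g"
      using Suc.prems C cylinder_iff[of "Suc n" e g] by (auto simp: words_Suc)
    obtain b y where f: "f = b # y" "b \<in> E\<^sub>1" "y \<in> cylinder S n g"
      using Suc.prems C cylinder_iff[of "Suc n" f g] by (auto simp: words_Suc)
    have sub: "(p, q) \<in> (erel (G (Suc n)) ?C)\<^sup>*"
      if "(p, q) \<in> (erel (G (Suc n)) ((\<lambda>a. a # z) ` E\<^sub>1))\<^sup>*" "z \<in> cylinder S n g" for p q z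
      using that erel_mono[of "(\<lambda>a. a # z) ` E\<^sub>1" ?C "G (Suc n)"] C by auto
    have W: "z \<in> W n" if "z \<in> cylinder S n g" for z using that cylinder_iff[of n] Suc.hyps by auto
    obtain i where i: "i \<in> I" using I_ne by auto
    let ?v = "\<lambda>t y. lb (Suc n) (ds t i) (da t i # y)"
    have lift: "(?v s x, ?v t y) \<in> (erel (G (Suc n)) ?C)\<^sup>*"
      if "(lb n s x, q) \<in> (erel (G n) (cylinder S n g))\<^sup>*" "q = lb n t y" "y \<in> cylinder S n g" for q t y
      using that
    proof (induction arbitrary: t y rule: rtrancl_induct)
      case base
      then have "?v s x = ?v t y"
        using lb_cons_boundary[OF Suc.hyps W[OF e(3)] W[OF base(2)] i, of s t] by auto
      then show ?case by simp
    next
      case (step p q)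
      then obtain z where z: "z \<in> cylinder S n g" "ends (G n) z = {p, q}" by (auto simp: erel_def)
      then obtain r r' where r: "p = lb n r z" "q = lb n r' z"
        using ends_G[OF Suc.hyps W[OF z(1)]] by (auto simp: doubleton_eq_iff)
      have "(?v s x, ?v r z) \<in> (erel (G (Suc n)) ?C)\<^sup>*" using step.IH[OF r(1) z(1)] .
      also have "(?v r z, ?v r' z) \<in> (erel (G (Suc n)) ?C)\<^sup>*"
        by (intro sub[OF children_connected] z W da_in i Suc.hyps)
      also have "?v r' z = ?v t y"
        using lb_cons_boundary[OF Suc.hyps W[OF z(1)] W[OF step.prems(2)] i, of r' t] r step.prems
        by auto
      finally show ?case .
    qed
    have "(lb (Suc n) s e, ?v s x) \<in> (erel (G (Suc n)) ?C)\<^sup>*"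
      unfolding e by (intro sub[OF children_connected] e W da_in i Suc.hyps)
    also have "(?v s x, ?v t y) \<in> (erel (G (Suc n)) ?C)\<^sup>*"
      using lift[OF Suc.IH[OF k Suc.prems(2) e(3) f(3), of s t] refl f(3)] .
    also have "(?v t y, lb (Suc n) t f) \<in> (erel (G (Suc n)) ?C)\<^sup>*"
      unfolding f by (intro sub[OF children_connected] f W da_in i Suc.hyps)
    finally show ?thesis .
  qed
qed

end

section \<open>Intrinsic distances of a weight function\<close>

definition weight :: "('e \<Rightarrow> real) \<Rightarrow> 'e list \<Rightarrow> real" where
  "weight \<rho> e = prod_list (map \<rho> e)"

lemma weight_Nil [simp]: "weight \<rho> [] = 1" and weight_Cons [simp]: "weight \<rho> (a # e) = \<rho> a * weight \<rho> e"
  by (auto simp: weight_def)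

lemma weight_append: "weight \<rho> (e @ f) = weight \<rho> e * weight \<rho> f"
  by (auto simp: weight_def)

definition wvert_dist :: "('v, 'e, 'i) igs \<Rightarrow> ('e \<Rightarrow> real) \<Rightarrow> nat \<Rightarrow> ('v, 'e) rvert \<Rightarrow> ('v, 'e) rvert \<Rightarrow> real" where
  "wvert_dist S \<rho> n v w = (if v = w then 0 else
     Inf {\<Sum>e\<in>\<Omega>. weight \<rho> e | \<Omega>.
       \<Omega> \<subseteq> (\<Union>i\<in>{1..n}. edges (replacement S i)) \<and>
       paths_between (edge_subgraph (replacement S n) (\<Union>e\<in>\<Omega>. cylinder S n e)) {v} {w} \<noteq> {}})"

definition wedge_dist :: "('v, 'e, 'i) igs \<Rightarrow> ('e \<Rightarrow> real) \<Rightarrow> nat \<Rightarrow> 'e list \<Rightarrow> 'e list \<Rightarrow> real" where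
  "wedge_dist S \<rho> n e f =
     Min {wvert_dist S \<rho> n v w | v w. v \<in> ends (replacement S n) e \<and> w \<in> ends (replacement S n) f}"

definition wlimit_dist ::
  "('v, 'e, 'i) igs \<Rightarrow> ('e \<Rightarrow> real) \<Rightarrow> (nat \<Rightarrow> 'e list) set \<Rightarrow> (nat \<Rightarrow> 'e list) set \<Rightarrow> real" where
  "wlimit_dist S \<rho> x y = (if x \<in> limit_space S \<and> y \<in> limit_space S
     then THE r. \<forall>s\<in>x. \<forall>t\<in>y. (\<lambda>i. wedge_dist S \<rho> i (s i) (t i)) \<longlonglongrightarrow> r
     else 0)"

lemma weight_const: "weight (\<lambda>_. c) e = c ^ length e"
  by (induction e) auto

lemma limit_dist_eq_wlimit_dist: "limit_dist S = wlimit_dist S (\<lambda>_. inverse (real (Lstar S)))"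
proof -
  have "vert_dist S = wvert_dist S (\<lambda>_. inverse (real (Lstar S)))"
    unfolding vert_dist_def[abs_def] wvert_dist_def[abs_def] weight_const ..
  then show ?thesis
    unfolding limit_dist_def[abs_def] wlimit_dist_def[abs_def] edge_dist_def[abs_def] wedge_dist_def[abs_def]
    by (simp only:)
qed

context laakso_igs
begin

lemma E1_ne: "E\<^sub>1 \<noteq> {}"
  using I_ne da_in by blast

abbreviation \<Sigma> where "\<Sigma> \<equiv> symbol_space S"

lemma symbol_in_words: "s \<in> \<Sigma> \<Longrightarrow> n \<ge> 1 \<Longrightarrow> s n \<in> W n"
  using edges_G[of n] by (auto simp: symbol_space_def PiE_iff)

lemma symbol_Suc: "s \<in> \<Sigma> \<Longrightarrow> n \<ge> 1 \<Longrightarrow> \<exists>a\<in>E\<^sub>1. s (Suc n) = a # s n"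
proof -
  assume s: "s \<in> \<Sigma>" and n: "n \<ge> 1"
  then have "tl (s (Suc n)) = s n" by (auto simp: symbol_space_def edge_proj_def)
  moreover have "s (Suc n) \<in> W (Suc n)" using symbol_in_words[OF s] by simp
  ultimately show ?thesis by (auto simp: words_Suc)
qed

lemma symbol_drop:
  assumes "s \<in> \<Sigma>" "1 \<le> n" "n \<le> m"
  shows "drop (m - n) (s m) = s n"
  using assms(3)
proof (induction m rule: dec_induct)
  case (step m)
  then obtain a where "s (Suc m) = a # s m" using symbol_Suc[of s m] assms by auto
  then show ?case using step by (simp add: Suc_diff_le)
qed auto

end

text \<open>The function \<open>h\<close> certifies admissibility of \<open>\<rho>\<close>: a
  potential between the two sides whose jump across an edge is at most the weight of that edge.
  Weights strictly between 0 and 1 make the weights of words decay geometrically at controlled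
  rates.\<close>

locale weighted_igs = laakso_igs S for S :: "('v, 'e, 'i) igs" +
  fixes \<rho> :: "'e \<Rightarrow> real" and h :: "'v \<Rightarrow> real"
  assumes \<rho>_pos: "a \<in> E\<^sub>1 \<Longrightarrow> 0 < \<rho> a" and \<rho>_less_1: "a \<in> E\<^sub>1 \<Longrightarrow> \<rho> a < 1"
    and \<rho>_sym: "a \<in> E\<^sub>1 \<Longrightarrow> b \<in> E\<^sub>1 \<Longrightarrow> i \<in> I \<Longrightarrow> l s a = \<phi> u i \<Longrightarrow> l t b = \<phi> v i \<Longrightarrow> \<rho> a = \<rho> b"
    and h_bounds: "x \<in> V\<^sub>1 \<Longrightarrow> 0 \<le> h x" "x \<in> V\<^sub>1 \<Longrightarrow> h x \<le> 1"
    and h_Minus: "i \<in> I \<Longrightarrow> h (\<phi> Minus i) = 0" and h_Plus: "i \<in> I \<Longrightarrow> h (\<phi> Plus i) = 1"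
    and h_lip: "a \<in> E\<^sub>1 \<Longrightarrow> \<bar>h (l Plus a) - h (l Minus a)\<bar> \<le> \<rho> a"
begin

abbreviation wt where "wt \<equiv> weight \<rho>"
abbreviation vd where "vd \<equiv> wvert_dist S \<rho>"
abbreviation ed where "ed \<equiv> wedge_dist S \<rho>"

definition rmin where "rmin = Min (\<rho> ` E\<^sub>1)"
definition rmax where "rmax = Max (\<rho> ` E\<^sub>1)"

lemma rmin_le: "a \<in> E\<^sub>1 \<Longrightarrow> rmin \<le> \<rho> a" and rmax_ge: "a \<in> E\<^sub>1 \<Longrightarrow> \<rho> a \<le> rmax"
  using finE by (auto simp: rmin_def rmax_def)

lemma rmin_pos: "0 < rmin"
  using \<rho>_pos finE E1_ne by (auto simp: rmin_def)

lemma rmax_less_1: "rmax < 1"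
  using \<rho>_less_1 finE E1_ne by (auto simp: rmax_def)

lemma rmin_le_rmax: "rmin \<le> rmax"
  using rmin_le rmax_ge E1_ne by (meson all_not_in_conv order_trans)

lemma rmax_pos: "0 < rmax" using rmin_pos rmin_le_rmax by linarith
lemma rmin_less_1: "rmin < 1" using rmax_less_1 rmin_le_rmax by linarith

lemma wt_pos: "e \<in> W n \<Longrightarrow> 0 < wt e"
proof (induction n arbitrary: e)
  case (Suc n)
  then show ?case using \<rho>_pos by (auto simp: words_Suc)
qed (auto simp: words_def)

lemma wt_le_rmax: "e \<in> W n \<Longrightarrow> wt e \<le> rmax ^ n"
proof (induction n arbitrary: e)
  case (Suc n)
  then obtain a f where "e = a # f" "a \<in> E\<^sub>1" "f \<in> W n" by (auto simp: words_Suc)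
  with Suc.IH[of f] show ?case
    using rmax_ge[of a] rmax_pos wt_pos[of f n] by (auto intro!: mult_mono)
qed (auto simp: words_def)

lemma wt_ge_rmin: "e \<in> W n \<Longrightarrow> rmin ^ n \<le> wt e"
proof (induction n arbitrary: e)
  case (Suc n)
  then obtain a f where "e = a # f" "a \<in> E\<^sub>1" "f \<in> W n" by (auto simp: words_Suc)
  with Suc.IH[of f] show ?case
    using rmin_le[of a] rmin_pos \<rho>_pos[of a] by (auto intro!: mult_mono)
qed (auto simp: words_def)

lemma wt_le_1: "e \<in> W n \<Longrightarrow> wt e \<le> 1"
  using wt_le_rmax[of e n] rmax_pos rmax_less_1 power_le_one[of rmax n] by linarith

text \<open>\<open>drop\<close> removes the newest letters, so it leads to an ancestor, whose weight
  has fewer factors below 1.\<close>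

lemma wt_drop_ge: "e \<in> W n \<Longrightarrow> wt e \<le> wt (drop k e)"
proof -
  assume e: "e \<in> W n"
  have "take k e \<in> W (min n k)" using e by (auto simp: words_def dest: in_set_takeD)
  then have "wt (take k e) * wt (drop k e) \<le> 1 * wt (drop k e)"
    using wt_pos[OF drop_words[OF e], of k] by (intro mult_right_mono wt_le_1) auto
  then show ?thesis by (metis append_take_drop_id mult_1 weight_append)
qed

text \<open>This is where the symmetry of the weights enters: below the level at which two touching
  edges separate, they acquire equal factors.\<close>

lemma wt_ratio:
  assumes "n \<ge> 1" "e \<in> W n" "f \<in> W n" "lb n s e = lb n t f"
  shows "rmin * wt e \<le> wt f"
  using assms
proof (induction n arbitrary: e f s t rule: nat_induct_at_least)
  case base
  then obtain a b where "e = [a]" "f = [b]" "a \<in> E\<^sub>1" "b \<in> E\<^sub>1" by (auto simp: words_1)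
  then show ?case using rmin_le[of b] rmin_pos \<rho>_less_1[of a] \<rho>_pos[of a]
    by (auto intro: order_trans[OF mult_left_le])
next
  case (Suc n)
  then obtain a b e' f' where e: "e = a # e'" "f = b # f'" "a \<in> E\<^sub>1" "b \<in> E\<^sub>1" "e' \<in> W n" "f' \<in> W n"
    by (auto simp: words_Suc)
  then consider "e' = f'" |
    i u v where "i \<in> I" "l s a = \<phi> u i" "l t b = \<phi> v i" "lb n u e' = lb n v f'"
    using lb_Suc[of n a b e' f' s t] Suc.hyps Suc.prems by auto
  then show ?case
  proof cases
    \<comment> \<open>Common parent: only the factors of the newest letters may differ, and
      \<open>rmin\<close> is spent here, once.\<close>
    case 1
    have "rmin * \<rho> a \<le> \<rho> b" using rmin_le[of b] rmin_pos \<rho>_less_1[of a] \<rho>_pos[of a] e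
      by (auto intro: order_trans[OF mult_left_le])
    then show ?thesis using 1 e wt_pos[OF e(5)] by (simp add: mult.assoc[symmetric])
  next
    case 2
    then have "\<rho> a = \<rho> b" using \<rho>_sym e by blast
    then show ?thesis using Suc.IH[OF e(5,6) 2(4)] e \<rho>_pos[of b]
      by (simp add: mult.left_commute)
  qed
qed

section \<open>Chain distances as minima over finite families of cylinders\<close>

definition Om where
  "Om n v w = {\<Omega>. \<Omega> \<subseteq> (\<Union>i\<in>{1..n}. W i) \<and> (v, w) \<in> (erel (G n) (\<Union>g\<in>\<Omega>. cylinder S n g))\<^sup>*}"

lemma finite_Om: "finite (Om n v w)"
proof -
  have "Om n v w \<subseteq> Pow (\<Union>i\<in>{1..n}. W i)" by (auto simp: Om_def)
  moreover have "finite (Pow (\<Union>i\<in>{1..n}. W i))" using finite_words[OF finE] by auto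
  ultimately show ?thesis by (rule finite_subset)
qed

lemma finite_Om_mem: "\<Omega> \<in> Om n v w \<Longrightarrow> finite \<Omega>"
  using finite_subset[of \<Omega> "\<Union>i\<in>{1..n}. W i"] finite_words[OF finE] by (auto simp: Om_def)

lemma sum_wt_nonneg: "\<Omega> \<in> Om n v w \<Longrightarrow> 0 \<le> sum wt \<Omega>"
  unfolding Om_def by (intro sum_nonneg) (use wt_pos in \<open>fastforce intro: less_imp_le\<close>)

text \<open>The separate clause for equal vertices is absorbed: the empty family joins a vertex to
  itself at cost 0.\<close>

lemma vd_eq: "vd n v w = Inf (sum wt ` Om n v w)"
proof (cases "v = w")
  case True
  then have "{} \<in> Om n v w" by (auto simp: Om_def)
  then have "Inf (sum wt ` Om n v w) = 0"
    using sum_wt_nonneg by (intro cInf_eq_minimum) (auto intro!: image_eqI[of _ _ "{}"])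
  then show ?thesis using True by (simp add: wvert_dist_def)
next
  case False
  have "(\<Union>i\<in>{1..n}. edges (G i)) = (\<Union>i\<in>{1..n}. W i)" using edges_G by auto
  then have "{\<Sum>e\<in>\<Omega>. wt e | \<Omega>. \<Omega> \<subseteq> (\<Union>i\<in>{1..n}. edges (G i)) \<and>
       paths_between (edge_subgraph (G n) (\<Union>e\<in>\<Omega>. cylinder S n e)) {v} {w} \<noteq> {}} = sum wt ` Om n v w"
    using False by (auto simp: paths_between_edge_subgraph Om_def)
  then show ?thesis using False by (simp add: wvert_dist_def)
qed

lemma vd_le: "\<Omega> \<in> Om n v w \<Longrightarrow> vd n v w \<le> sum wt \<Omega>"
  unfolding vd_eq using finite_Om by (intro cInf_lower) auto

lemma cylinder_Nil: "n \<ge> 1 \<Longrightarrow> cylinder S n [] = W n"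
  using cylinder_iff[of n _ "[]"] by (auto simp: words_def)

lemma cylinder_self: "n \<ge> 1 \<Longrightarrow> g \<in> W n \<Longrightarrow> cylinder S n g = {g}"
  using cylinder_iff[of n _ g] by (auto simp: words_def)

lemma Om_ne: "n \<ge> 1 \<Longrightarrow> e \<in> W n \<Longrightarrow> f \<in> W n \<Longrightarrow> Om n (lb n s e) (lb n t f) \<noteq> {}"
proof -
  assume a: "n \<ge> 1" "e \<in> W n" "f \<in> W n"
  have "(\<Union>g\<in>W n. cylinder S n g) = cylinder S n []"
    using a by (auto simp: cylinder_self cylinder_Nil)
  then have "W n \<in> Om n (lb n s e) (lb n t f)"
    using a cylinder_connected[of n 0 "[]" e f s t]
    by (auto simp: Om_def cylinder_Nil) (auto simp: words_def)
  then show ?thesis by blast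
qed

text \<open>Only finitely many families occur, and the family of all words of length
  \<open>n\<close> joins the two vertices, so the infimum is a minimum.\<close>

lemma vd_attained:
  assumes "n \<ge> 1" "e \<in> W n" "f \<in> W n"
  shows "\<exists>\<Omega>\<in>Om n (lb n s e) (lb n t f). vd n (lb n s e) (lb n t f) = sum wt \<Omega>"
proof -
  have "Inf (sum wt ` Om n (lb n s e) (lb n t f)) \<in> sum wt ` Om n (lb n s e) (lb n t f)"
    using finite_Om Om_ne[OF assms] by (subst cInf_eq_Min) (auto intro!: Min_in)
  then show ?thesis unfolding vd_eq by auto
qed

lemma vd_nonneg: "n \<ge> 1 \<Longrightarrow> e \<in> W n \<Longrightarrow> f \<in> W n \<Longrightarrow> 0 \<le> vd n (lb n s e) (lb n t f)"
  using vd_attained[of n e f s t] sum_wt_nonneg by fastforce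

lemma vd_self: "vd n v v = 0"
  by (simp add: wvert_dist_def)

lemma Om_sym: "\<Omega> \<in> Om n v w \<Longrightarrow> \<Omega> \<in> Om n w v"
  unfolding Om_def using symD[OF sym_rtrancl[OF sym_erel]] by auto

lemma vd_sym: "vd n v w = vd n w v"
  unfolding vd_eq using Om_sym by (metis (full_types) subsetI subset_antisym)

lemma vd_triangle:
  assumes "n \<ge> 1" "e \<in> W n" "f \<in> W n" "g \<in> W n"
  shows "vd n (lb n s e) (lb n t f) \<le> vd n (lb n s e) (lb n u g) + vd n (lb n u g) (lb n t f)"
proof -
  obtain A where A: "A \<in> Om n (lb n s e) (lb n u g)" "vd n (lb n s e) (lb n u g) = sum wt A"
    using vd_attained[of n e g s u] assms by auto
  obtain B where B: "B \<in> Om n (lb n u g) (lb n t f)" "vd n (lb n u g) (lb n t f) = sum wt B"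
    using vd_attained[of n g f u t] assms by auto
  let ?C = "\<lambda>\<Omega>. (\<Union>g\<in>\<Omega>. cylinder S n g)"
  have "(lb n s e, lb n u g) \<in> (erel (G n) (?C (A \<union> B)))\<^sup>*" "(lb n u g, lb n t f) \<in> (erel (G n) (?C (A \<union> B)))\<^sup>*"
    using A B erel_mono[of "?C A" "?C (A \<union> B)" "G n"] erel_mono[of "?C B" "?C (A \<union> B)" "G n"]
    by (auto simp: Om_def)
  then have "(lb n s e, lb n t f) \<in> (erel (G n) (?C (A \<union> B)))\<^sup>*" by (rule rtrancl_trans)
  then have "A \<union> B \<in> Om n (lb n s e) (lb n t f)" using A B by (auto simp: Om_def)
  then have "vd n (lb n s e) (lb n t f) \<le> sum wt (A \<union> B)" by (rule vd_le)
  also have "\<dots> \<le> sum wt A + sum wt B"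
  proof -
    have fin: "finite A" "finite B" using finite_Om_mem A B by auto
    have "0 \<le> sum wt (A \<inter> B)"
      using A wt_pos by (intro sum_nonneg) (fastforce simp: Om_def intro: less_imp_le)
    then show ?thesis using sum.union_inter[OF fin, of wt] by linarith
  qed
  finally show ?thesis using A B by simp
qed

text \<open>The common ancestor alone is a competing family, its cylinder being connected.\<close>

lemma vd_cylinder:
  assumes "n \<ge> 1" "j < n" "e \<in> W n" "f \<in> W n" "drop j e = drop j f"
  shows "vd n (lb n s e) (lb n t f) \<le> wt (drop j e)"
proof -
  have g: "drop j e \<in> W (n - j)" using drop_words assms by auto
  have len: "length (drop j e) = n - j" using assms by (auto simp: words_def)
  have "(lb n s e, lb n t f) \<in> (erel (G n) (cylinder S n (drop j e)))\<^sup>*"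
    using assms g len by (intro cylinder_connected[of n "n - j"]) (auto simp: cylinder_iff)
  moreover have "n - j \<in> {1..n}" using assms by auto
  ultimately have "{drop j e} \<in> Om n (lb n s e) (lb n t f)"
    using g unfolding Om_def by (auto intro!: bexI[of _ "n - j"])
  from vd_le[OF this] show ?thesis by simp
qed

lemma vd_edge: "n \<ge> 1 \<Longrightarrow> e \<in> W n \<Longrightarrow> vd n (lb n s e) (lb n t e) \<le> wt e"
  using vd_cylinder[of n 0 e e s t] by simp

subsection \<open>Lipschitz functions on the vertices\<close>

text \<open>Functions on the vertices of \<open>G\<^sub>n\<close> are represented as functions of darts.  The distances are
  dual to the functions satisfying \<open>lip\<close>, and such functions can be moved one level up (interpolating
  with \<open>h\<close>) and down; this replaces all lifting and projecting of paths.\<close>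

definition compat where
  "compat n U \<longleftrightarrow> (\<forall>e\<in>W n. \<forall>f\<in>W n. \<forall>s t. lb n s e = lb n t f \<longrightarrow> U s e = (U t f :: real))"

definition lip where
  "lip n U \<longleftrightarrow> compat n U \<and>
    (\<forall>j<n. \<forall>e\<in>W n. \<forall>f\<in>W n. drop j e = drop j f \<longrightarrow> (\<forall>s t. \<bar>U s e - U t f\<bar> \<le> wt (drop j e)))"

lemma lip_edge: "lip n U \<Longrightarrow> n \<ge> 1 \<Longrightarrow> e \<in> W n \<Longrightarrow> \<bar>U s e - U t e\<bar> \<le> wt e"
  unfolding lip_def by (auto dest!: spec[of _ 0])

text \<open>One half of the duality: on each cylinder of a competing family \<open>U\<close>
  oscillates by at most the weight of the cylinder, so \<open>chain_le\<close> bounds the difference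
  by the cost of the family.\<close>

lemma lip_le_vd:
  assumes U: "lip n U" and n: "n \<ge> 1" and e: "e \<in> W n" "f \<in> W n"
  shows "\<bar>U s e - U t f\<bar> \<le> vd n (lb n s e) (lb n t f)"
proof -
  \<comment> \<open>Descends to a function of vertices by choosing some dart at \<open>v\<close>;
    \<open>compat\<close> makes the choice irrelevant.\<close>
  define u where "u v = (let x = SOME x. snd x \<in> W n \<and> lb n (fst x) (snd x) = v in U (fst x) (snd x))" for v
  have u: "u (lb n r g) = U r g" if g: "g \<in> W n" for r g
  proof -
    let ?P = "\<lambda>x. snd x \<in> W n \<and> lb n (fst x) (snd x) = lb n r g"
    have "?P (SOME x. ?P x)" by (rule someI[of ?P "(r, g)"]) (use g in auto)
    then show ?thesis using U g unfolding u_def Let_def lip_def compat_def by blast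
  qed
  obtain \<Omega> where \<Omega>: "\<Omega> \<in> Om n (lb n s e) (lb n t f)" "vd n (lb n s e) (lb n t f) = sum wt \<Omega>"
    using vd_attained[of n e f s t] assms by auto
  have "\<bar>u (lb n s e) - u (lb n t f)\<bar> \<le> sum wt \<Omega>"
  proof (rule chain_le[where C = "cylinder S n" and w = wt and H = "G n"])
    show "finite \<Omega>" using finite_Om_mem \<Omega> by auto
    show "(lb n s e, lb n t f) \<in> (erel (G n) (\<Union>g\<in>\<Omega>. cylinder S n g))\<^sup>*" using \<Omega> by (auto simp: Om_def)
    show "0 \<le> wt g" if "g \<in> \<Omega>" for g
      using that \<Omega> wt_pos by (fastforce simp: Om_def intro: less_imp_le)
    fix g x y p q assume g: "g \<in> \<Omega>" and x: "x \<in> cylinder S n g" "y \<in> cylinder S n g"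
      "p \<in> ends (G n) x" "q \<in> ends (G n) y"
    then obtain k where k: "k \<in> {1..n}" "g \<in> W k" using \<Omega> by (auto simp: Om_def)
    have xy: "x \<in> W n" "y \<in> W n" "drop (n - k) x = g" "drop (n - k) y = g"
      using x cylinder_iff[OF n] k by (auto simp: words_def)
    obtain a b where ab: "p = lb n a x" "q = lb n b y"
      using x ends_G[OF n xy(1)] ends_G[OF n xy(2)] by auto
    have "\<bar>U a x - U b y\<bar> \<le> wt g"
    proof -
      have "n - k < n" "drop (n - k) x = drop (n - k) y" using k xy by auto
      then show ?thesis using U xy(1,2) unfolding lip_def xy(3)[symmetric] by blast
    qed
    then show "\<bar>u p - u q\<bar> \<le> wt g" using u xy ab by auto
  qed
  then show ?thesis using u e \<Omega> by auto
qed

text \<open>The other half of the duality: the distance from a fixed vertex is itself such a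
  function.\<close>

lemma lip_vd:
  assumes n: "n \<ge> 1" and g: "g \<in> W n"
  shows "lip n (\<lambda>s e. vd n (lb n r g) (lb n s e))"
  unfolding lip_def
proof (intro conjI allI impI ballI)
  show "compat n (\<lambda>s e. vd n (lb n r g) (lb n s e))" by (auto simp: compat_def)
  fix j e f s t assume a: "j < n" "e \<in> W n" "f \<in> W n" "drop j e = drop j f"
  show "\<bar>vd n (lb n r g) (lb n s e) - vd n (lb n r g) (lb n t f)\<bar> \<le> wt (drop j e)"
    using vd_triangle[OF n g a(2,3), of r s t] vd_triangle[OF n g a(3,2), of r t s]
      vd_sym[of n "lb n s e" "lb n t f"] vd_cylinder[OF n a, of s t] by linarith
qed

text \<open>Interpolates along \<open>h\<close> between the values at the two ends of the parent.
  Over \<open>\<phi> p i\<close> it returns \<open>U p\<close>, since \<open>h\<close> is 0 or 1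
  there, and this is what makes it agree at glued vertices.\<close>

definition extU :: "(side \<Rightarrow> 'e list \<Rightarrow> real) \<Rightarrow> side \<Rightarrow> 'e list \<Rightarrow> real" where
  "extU U s e = U Minus (tl e) + h (l s (hd e)) * (U Plus (tl e) - U Minus (tl e))"

lemma extU_Cons: "extU U s (a # e) = U Minus e + h (l s a) * (U Plus e - U Minus e)"
  by (simp add: extU_def)

lemma lip_extU:
  assumes n: "n \<ge> 1" and U: "lip n U"
  shows "lip (Suc n) (extU U)"
  unfolding lip_def
proof (intro conjI allI impI ballI)
  show "compat (Suc n) (extU U)"
    unfolding compat_def
  proof (intro ballI allI impI)
    fix e f s t assume a: "e \<in> W (Suc n)" "f \<in> W (Suc n)" "lb (Suc n) s e = lb (Suc n) t f"
    then obtain x y e' f' where e: "e = x # e'" "f = y # f'" "x \<in> E\<^sub>1" "y \<in> E\<^sub>1" "e' \<in> W n" "f' \<in> W n"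
      by (auto simp: words_Suc)
    then consider "e' = f'" "l s x = l t y" |
      i u v where "i \<in> I" "l s x = \<phi> u i" "l t y = \<phi> v i" "lb n u e' = lb n v f'"
      using lb_Suc[of n x y e' f' s t] n a by auto
    then show "extU U s e = extU U t f"
    proof cases
      case 1
      then show ?thesis by (simp add: e extU_Cons)
    next
      case 2
      have *: "U Minus z + h (\<phi> p i) * (U Plus z - U Minus z) = U p z" for p z
        using 2(1) h_Minus h_Plus by (cases p) auto
      have "U u e' = U v f'" using U 2 e unfolding lip_def compat_def by blast
      then show ?thesis by (simp add: e extU_Cons 2 *)
    qed
  qed
  fix j e f s t assume a: "j < Suc n" "e \<in> W (Suc n)" "f \<in> W (Suc n)" "drop j e = drop j f"
  then obtain x y e' f' where e: "e = x # e'" "f = y # f'" "x \<in> E\<^sub>1" "y \<in> E\<^sub>1" "e' \<in> W n" "f' \<in> W n"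
    by (auto simp: words_Suc)
  show "\<bar>extU U s e - extU U t f\<bar> \<le> wt (drop j e)"
  proof (cases j)
    \<comment> \<open>A single edge: the jump is the product of a jump of \<open>h\<close> and a
      jump of \<open>U\<close>, just as the weight of a word is a product.\<close>
    case 0
    then have eq: "x = y" "e' = f'" using a e by auto
    have hd: "\<bar>h (l s x) - h (l t x)\<bar> \<le> \<rho> x"
      using h_lip[OF e(3)] \<rho>_pos[OF e(3)] by (cases s; cases t) auto
    have "extU U s e - extU U t f = (h (l s x) - h (l t x)) * (U Plus e' - U Minus e')"
      using e eq by (simp add: extU_Cons algebra_simps)
    then have "\<bar>extU U s e - extU U t f\<bar> = \<bar>h (l s x) - h (l t x)\<bar> * \<bar>U Plus e' - U Minus e'\<bar>"
      by (simp add: abs_mult)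
    also have "\<dots> \<le> \<rho> x * wt e'"
      using hd lip_edge[OF U n e(5)] \<rho>_pos[OF e(3)] by (intro mult_mono) auto
    finally show ?thesis using 0 e by simp
  next
    \<comment> \<open>Proper ancestors: both values are averages of values of \<open>U\<close>
      inside the same ancestor.\<close>
    case (Suc k)
    then have "k < n" "drop k e' = drop k f'" using a e by auto
    then have *: "\<bar>U p e' - U q f'\<bar> \<le> wt (drop k e')" for p q
      using U e unfolding lip_def by blast
    have 1: "\<bar>extU U s e - U q f'\<bar> \<le> wt (drop k e')" for q
      unfolding e extU_Cons by (intro convex_comb_dist * h_bounds l_in_V e)
    then have 2: "\<bar>U q f' - extU U s e\<bar> \<le> wt (drop k e')" for q
      by (simp add: abs_minus_commute)
    have "\<bar>extU U t f - extU U s e\<bar> \<le> wt (drop k e')"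
      unfolding e(2) extU_Cons by (intro convex_comb_dist 2 h_bounds l_in_V e)
    then show ?thesis using Suc e by (simp add: abs_minus_commute)
  qed
qed

text \<open>Sampling along lifts of index \<open>i\<close>: the extra letter shifts the depth by one
  but leaves the ancestors, hence their weights, unchanged.\<close>

lemma lip_restrict:
  assumes n: "n \<ge> 1" and U: "lip (Suc n) U" and i: "i \<in> I"
  shows "lip n (\<lambda>s e. U (ds s i) (da s i # e))"
  unfolding lip_def
proof (intro conjI allI impI ballI)
  show "compat n (\<lambda>s e. U (ds s i) (da s i # e))"
    unfolding compat_def
  proof (intro ballI allI impI)
    fix e f s t assume a: "e \<in> W n" "f \<in> W n" "lb n s e = lb n t f"
    have "da p i # x \<in> W (Suc n)" if "x \<in> W n" for p x using that da_in[OF i] by simp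
    then show "U (ds s i) (da s i # e) = U (ds t i) (da t i # f)"
      using U lb_cons_boundary[OF n a(1,2) i a(3)] a unfolding lip_def compat_def by blast
  qed
  fix j e f s t assume a: "j < n" "e \<in> W n" "f \<in> W n" "drop j e = drop j f"
  have "da p i # x \<in> W (Suc n)" if "x \<in> W n" for p x using that da_in[OF i] by simp
  moreover have "drop (Suc j) (da s i # e) = drop (Suc j) (da t i # f)" "Suc j < Suc n" using a by auto
  ultimately have "\<bar>U (ds s i) (da s i # e) - U (ds t i) (da t i # f)\<bar> \<le> wt (drop (Suc j) (da s i # e))"
    using U a unfolding lip_def by blast
  then show "\<bar>U (ds s i) (da s i # e) - U (ds t i) (da t i # f)\<bar> \<le> wt (drop j e)" by simp
qed

subsection \<open>Convergence of the distances\<close>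

lemma ed_set: "n \<ge> 1 \<Longrightarrow> e \<in> W n \<Longrightarrow> f \<in> W n \<Longrightarrow>
  {vd n v w | v w. v \<in> ends (G n) e \<and> w \<in> ends (G n) f} =
  (\<lambda>(s, t). vd n (lb n s e) (lb n t f)) ` ({Minus, Plus} \<times> {Minus, Plus})"
  by (auto simp: ends_G)

lemma ed_le: "n \<ge> 1 \<Longrightarrow> e \<in> W n \<Longrightarrow> f \<in> W n \<Longrightarrow> ed n e f \<le> vd n (lb n s e) (lb n t f)"
  unfolding wedge_dist_def ed_set
  by (intro Min_le) (cases s; cases t; auto)+

lemma ed_attained: "n \<ge> 1 \<Longrightarrow> e \<in> W n \<Longrightarrow> f \<in> W n \<Longrightarrow> \<exists>s t. ed n e f = vd n (lb n s e) (lb n t f)"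
proof -
  assume a: "n \<ge> 1" "e \<in> W n" "f \<in> W n"
  let ?A = "(\<lambda>(s, t). vd n (lb n s e) (lb n t f)) ` ({Minus, Plus} \<times> {Minus, Plus})"
  have "Min ?A \<in> ?A" by (intro Min_in) auto
  then show ?thesis using ed_set[OF a] unfolding wedge_dist_def by auto
qed

lemma ed_nonneg: "n \<ge> 1 \<Longrightarrow> e \<in> W n \<Longrightarrow> f \<in> W n \<Longrightarrow> 0 \<le> ed n e f"
  using ed_attained[of n e f] vd_nonneg by force

lemma ed_sym: "n \<ge> 1 \<Longrightarrow> e \<in> W n \<Longrightarrow> f \<in> W n \<Longrightarrow> ed n e f = ed n f e"
proof -
  have "ed n e f \<le> ed n f e" if a: "n \<ge> 1" "e \<in> W n" "f \<in> W n" for e f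
    using ed_attained[OF a(1,3,2)] ed_le[OF a] vd_sym by metis
  then show "n \<ge> 1 \<Longrightarrow> e \<in> W n \<Longrightarrow> f \<in> W n \<Longrightarrow> ed n e f = ed n f e" by (auto intro: antisym)
qed

text \<open>The optimal chains may reach \<open>g\<close> at different ends; crossing
  \<open>g\<close> costs at most its weight.\<close>

lemma ed_triangle:
  assumes "n \<ge> 1" "e \<in> W n" "f \<in> W n" "g \<in> W n"
  shows "ed n e f \<le> ed n e g + ed n g f + wt g"
proof -
  obtain s p where 1: "ed n e g = vd n (lb n s e) (lb n p g)" using ed_attained assms by blast
  obtain q t where 2: "ed n g f = vd n (lb n q g) (lb n t f)" using ed_attained assms by blast
  have "ed n e f \<le> vd n (lb n s e) (lb n t f)" using ed_le assms by auto
  then show ?thesis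
    using 1 2 vd_triangle[OF assms, of s t p] vd_triangle[OF assms(1,4,3,4), of p t q]
      vd_edge[OF assms(1,4), of p q] by linarith
qed

lemma ed_touch: "n \<ge> 1 \<Longrightarrow> e \<in> W n \<Longrightarrow> f \<in> W n \<Longrightarrow> touch n e f \<Longrightarrow> ed n e f = 0"
proof -
  assume a: "n \<ge> 1" "e \<in> W n" "f \<in> W n" "touch n e f"
  then obtain s t where "lb n s e = lb n t f" using touch_iff by blast
  then show ?thesis using ed_le[OF a(1-3), of s t] ed_nonneg[OF a(1-3)] by (simp add: vd_self)
qed

text \<open>Test with the interpolation of the distance from an end of \<open>e\<close>: it is at
  most \<open>wt e\<close> on the child of \<open>e\<close> and at least \<open>ed n e f\<close> on
  the child of \<open>f\<close>.\<close>

lemma ed_Suc_ge: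
  assumes n: "n \<ge> 1" and e: "a \<in> E\<^sub>1" "b \<in> E\<^sub>1" "e \<in> W n" "f \<in> W n"
  shows "ed n e f - wt e \<le> ed (Suc n) (a # e) (b # f)"
proof -
  let ?U = "\<lambda>s x. vd n (lb n Minus e) (lb n s x)"
  have W': "a # e \<in> W (Suc n)" "b # f \<in> W (Suc n)" using e by auto
  obtain p q where pq: "ed (Suc n) (a # e) (b # f) = vd (Suc n) (lb (Suc n) p (a # e)) (lb (Suc n) q (b # f))"
    using ed_attained[of "Suc n"] W' by fastforce
  have "\<bar>extU ?U p (a # e) - extU ?U q (b # f)\<bar> \<le> ed (Suc n) (a # e) (b # f)"
    unfolding pq by (intro lip_le_vd lip_extU lip_vd n e W') simp
  moreover have "\<bar>extU ?U p (a # e) - 0\<bar> \<le> wt e"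
    unfolding extU_Cons
  proof (intro convex_comb_dist h_bounds l_in_V e)
    have "\<bar>?U s e - 0\<bar> \<le> wt e" for s
      using vd_edge[OF n e(3)] vd_nonneg[OF n e(3,3)] by simp
    then show "\<bar>?U Minus e - 0\<bar> \<le> wt e" "\<bar>?U Plus e - 0\<bar> \<le> wt e" by blast+
  qed
  moreover have "ed n e f \<le> extU ?U q (b # f)"
    unfolding extU_Cons by (intro convex_comb_ge h_bounds l_in_V e ed_le n)
  ultimately show ?thesis by linarith
qed

text \<open>Sampling the finer distance along lifts bounds the distance between two lifted vertices
  by \<open>ed n e f\<close>; moving inside the cells of \<open>e\<close> and \<open>f\<close> to
  the given children costs their weights.\<close>

lemma ed_Suc_le:
  assumes n: "n \<ge> 1" and e: "a \<in> E\<^sub>1" "b \<in> E\<^sub>1" "e \<in> W n" "f \<in> W n"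
  shows "ed (Suc n) (a # e) (b # f) \<le> ed n e f + wt e + wt f"
proof -
  obtain i where i: "i \<in> I" using I_ne by auto
  have n': "Suc n \<ge> 1" by simp
  have W': "a # e \<in> W (Suc n)" "b # f \<in> W (Suc n)" "\<And>s. da s i # e \<in> W (Suc n)" "\<And>s. da s i # f \<in> W (Suc n)"
    using e da_in[OF i] by auto
  obtain s t where st: "ed n e f = vd n (lb n s e) (lb n t f)" using ed_attained[OF n e(3,4)] by auto
  let ?x = "lb (Suc n) (ds s i) (da s i # e)" and ?y = "lb (Suc n) (ds t i) (da t i # f)"
  let ?U = "\<lambda>p z. vd (Suc n) ?x (lb (Suc n) (ds p i) (da p i # z))"
  have "lip n ?U"
    using lip_restrict[OF n lip_vd[OF n' W'(3)] i] .
  from lip_le_vd[OF this n e(3,4), of s t] have 1: "vd (Suc n) ?x ?y \<le> ed n e f"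
    using st by (simp add: vd_self)
  let ?p = "lb (Suc n) Minus (a # e)" and ?q = "lb (Suc n) Minus (b # f)"
  have 2: "vd (Suc n) ?p ?x \<le> wt e" using vd_cylinder[of "Suc n" 1 "a # e" "da s i # e"] n W' by simp
  have 3: "vd (Suc n) ?y ?q \<le> wt f" using vd_cylinder[of "Suc n" 1 "da t i # f" "b # f"] n W' by simp
  have "ed (Suc n) (a # e) (b # f) \<le> vd (Suc n) ?p ?q" by (intro ed_le W') simp
  also have "\<dots> \<le> vd (Suc n) ?p ?x + vd (Suc n) ?x ?q" by (intro vd_triangle W') simp
  also have "vd (Suc n) ?x ?q \<le> vd (Suc n) ?x ?y + vd (Suc n) ?y ?q" by (intro vd_triangle W') simp
  finally show ?thesis using 1 2 3 by linarith
qed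

lemma wt_symbol_add:
  assumes "s \<in> \<Sigma>" "n \<ge> 1"
  shows "wt (s (n + k)) \<le> wt (s n) * rmax ^ k"
proof (induction k)
  case (Suc k)
  obtain a where a: "a \<in> E\<^sub>1" "s (Suc (n + k)) = a # s (n + k)" using symbol_Suc[of s "n + k"] assms by auto
  have "wt (s (n + Suc k)) = \<rho> a * wt (s (n + k))" using a by simp
  also have "\<dots> \<le> rmax * (wt (s n) * rmax ^ k)"
    using Suc rmax_ge[OF a(1)] rmax_pos wt_pos[OF symbol_in_words[OF assms(1)], of "n + k"] assms
    by (intro mult_mono) (auto intro: less_imp_le)
  finally show ?case by (simp add: mult_ac)
qed auto

definition D where "D s t = lim (\<lambda>n. ed n (s n) (t n))"

lemma ed_increment:
  assumes "s \<in> \<Sigma>" "t \<in> \<Sigma>" "n \<ge> 1"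
  shows "\<bar>ed (Suc n) (s (Suc n)) (t (Suc n)) - ed n (s n) (t n)\<bar> \<le> wt (s n) + wt (t n)"
proof -
  obtain a where a: "a \<in> E\<^sub>1" "s (Suc n) = a # s n" using symbol_Suc assms by blast
  obtain b where b: "b \<in> E\<^sub>1" "t (Suc n) = b # t n" using symbol_Suc assms by blast
  have w: "s n \<in> W n" "t n \<in> W n" using symbol_in_words assms by auto
  show ?thesis
    using ed_Suc_ge[OF assms(3) a(1) b(1) w] ed_Suc_le[OF assms(3) a(1) b(1) w] a b
      wt_pos[OF w(1)] wt_pos[OF w(2)] by auto
qed

text \<open>Weights along a code decay at least like powers of \<open>rmax\<close>, so the
  increments are dominated by a geometric series, whence the denominator
  \<open>1 - rmax\<close>.\<close>

lemma
  assumes st: "s \<in> \<Sigma>" "t \<in> \<Sigma>"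
  shows ed_tendsto: "(\<lambda>n. ed n (s n) (t n)) \<longlonglongrightarrow> D s t"
    and D_ed: "n \<ge> 1 \<Longrightarrow> \<bar>D s t - ed n (s n) (t n)\<bar> \<le> (wt (s n) + wt (t n)) / (1 - rmax)"
proof -
  let ?y = "\<lambda>n k. ed (n + k) (s (n + k)) (t (n + k))"
  have inc: "\<bar>?y m (Suc k) - ?y m k\<bar> \<le> (wt (s m) + wt (t m)) * rmax ^ k" if "m \<ge> 1" for m k
    using ed_increment[OF st, of "m + k"] wt_symbol_add[OF st(1) that, of k]
      wt_symbol_add[OF st(2) that, of k] that by (simp add: algebra_simps)
  have "convergent (?y 1)"
    using geometric_increments(1)[OF inc[OF order_refl]] rmax_pos rmax_less_1 by simp
  then have "convergent (\<lambda>n. ed n (s n) (t n))"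
    using convergent_Suc_iff[of "\<lambda>n. ed n (s n) (t n)"] by simp
  then show conv: "(\<lambda>n. ed n (s n) (t n)) \<longlonglongrightarrow> D s t"
    by (simp add: D_def convergent_LIMSEQ_iff)
  assume n: "n \<ge> 1"
  have "?y n \<longlonglongrightarrow> D s t" using LIMSEQ_ignore_initial_segment[OF conv, of n] by (simp add: add.commute)
  then have "lim (?y n) = D s t" by (rule limI)
  then show "\<bar>D s t - ed n (s n) (t n)\<bar> \<le> (wt (s n) + wt (t n)) / (1 - rmax)"
    using geometric_increments(2)[OF inc[OF n]] rmax_pos rmax_less_1 by simp
qed

lemma wt_symbol_tendsto: "s \<in> \<Sigma> \<Longrightarrow> (\<lambda>n. wt (s n)) \<longlonglongrightarrow> 0"
proof (rule tendsto_sandwich[of "\<lambda>_. 0" _ _ "\<lambda>n. rmax ^ n"])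
  assume s: "s \<in> \<Sigma>"
  show "\<forall>\<^sub>F n in sequentially. 0 \<le> wt (s n)"
    using eventually_ge_at_top[of 1] by eventually_elim (use wt_pos symbol_in_words[OF s] in \<open>force intro: less_imp_le\<close>)
  show "\<forall>\<^sub>F n in sequentially. wt (s n) \<le> rmax ^ n"
    using eventually_ge_at_top[of 1] by eventually_elim (use wt_le_rmax symbol_in_words[OF s] in blast)
  show "(\<lambda>n. rmax ^ n) \<longlonglongrightarrow> 0" using rmax_pos rmax_less_1 by (intro LIMSEQ_power_zero) auto
qed auto

lemma D_nonneg: "s \<in> \<Sigma> \<Longrightarrow> t \<in> \<Sigma> \<Longrightarrow> 0 \<le> D s t"
  by (rule tendsto_lowerbound[OF ed_tendsto])
    (auto intro!: eventually_mono[OF eventually_ge_at_top[of 1]] ed_nonneg symbol_in_words)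

lemma D_sym: "s \<in> \<Sigma> \<Longrightarrow> t \<in> \<Sigma> \<Longrightarrow> D s t = D t s"
proof (rule tendsto_unique[OF _ ed_tendsto])
  assume st: "s \<in> \<Sigma>" "t \<in> \<Sigma>"
  have "\<forall>\<^sub>F n in sequentially. ed n (t n) (s n) = ed n (s n) (t n)"
    using eventually_ge_at_top[of 1] by eventually_elim (intro ed_sym symbol_in_words st)
  then show "(\<lambda>n. ed n (s n) (t n)) \<longlonglongrightarrow> D t s"
    using ed_tendsto[OF st(2,1)] by (simp cong: tendsto_cong)
qed auto

lemma D_triangle:
  assumes "s \<in> \<Sigma>" "t \<in> \<Sigma>" "r \<in> \<Sigma>"
  shows "D s t \<le> D s r + D r t"
proof -
  have "(\<lambda>n. ed n (s n) (r n) + ed n (r n) (t n) + wt (r n)) \<longlonglongrightarrow> D s r + D r t + 0"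
    by (intro tendsto_intros ed_tendsto wt_symbol_tendsto assms)
  then have "D s t \<le> D s r + D r t + 0"
  proof (rule tendsto_le[OF sequentially_bot _ ed_tendsto[OF assms(1,2)]])
    show "\<forall>\<^sub>F n in sequentially. ed n (s n) (t n) \<le> ed n (s n) (r n) + ed n (r n) (t n) + wt (r n)"
      using eventually_ge_at_top[of 1] by eventually_elim (intro ed_triangle symbol_in_words assms)
  qed
  then show ?thesis by simp
qed

text \<open>Touching edges have weights within a factor \<open>1 / rmin\<close>, so both weights in
  \<open>D_ed\<close> are paid for by one of them; the denominator is the geometric series
  there.\<close>

definition Cup where "Cup = (1 + inverse rmin) / (1 - rmax)"

lemma Cup_pos: "0 < Cup"
  using rmin_pos rmax_less_1 by (auto simp: Cup_def intro!: divide_pos_pos add_pos_pos)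

lemma D_touch_le:
  assumes "s \<in> \<Sigma>" "t \<in> \<Sigma>" "n \<ge> 1" "touch n (s n) (t n)"
  shows "D s t \<le> Cup * wt (s n)"
proof -
  have w: "s n \<in> W n" "t n \<in> W n" using symbol_in_words assms by auto
  obtain p q where "lb n p (s n) = lb n q (t n)" using touch_iff[OF assms(3) w] assms by auto
  then have "rmin * wt (t n) \<le> wt (s n)" using wt_ratio[OF assms(3) w(2,1)] by metis
  then have "wt (t n) \<le> inverse rmin * wt (s n)" using rmin_pos by (simp add: field_simps)
  then have "(wt (s n) + wt (t n)) / (1 - rmax) \<le> Cup * wt (s n)"
    using rmax_less_1 by (simp add: Cup_def divide_right_mono algebra_simps)
  then show ?thesis
    using D_ed[OF assms(1-3)] ed_touch[OF assms(3) w assms(4)] by auto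
qed

text \<open>Interpolating the multiple of the indicator function of the two ends of \<open>s n\<close> that is still
  Lipschitz separates the two cylinders at all later levels.\<close>

lemma D_not_touch_ge:
  assumes "s \<in> \<Sigma>" "t \<in> \<Sigma>" "n \<ge> 1" "\<not> touch n (s n) (t n)"
  shows "rmin * wt (s n) \<le> D s t"
proof -
  have w: "s n \<in> W n" "t n \<in> W n" using symbol_in_words assms by auto
  \<comment> \<open>The multiple respects \<open>lip\<close> since an edge meeting
    \<open>s n\<close> is lighter than it by at most the factor \<open>rmin\<close> of
    \<open>wt_ratio\<close>.\<close>
  define U where "U r f = (if lb n r f \<in> ends (G n) (s n) then rmin * wt (s n) else 0)" for r f
  have U0: "lip n U"
    unfolding lip_def
  proof (intro conjI allI impI ballI)
    show "compat n U" by (auto simp: compat_def U_def)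
    fix j e f p q assume a: "j < n" "e \<in> W n" "f \<in> W n" "drop j e = drop j f"
    have *: "rmin * wt (s n) \<le> wt (drop j x)" if "x \<in> W n" "lb n r x \<in> ends (G n) (s n)" for x r
    proof -
      obtain r' where "lb n r' (s n) = lb n r x" using \<open>lb n r x \<in> ends (G n) (s n)\<close> unfolding ends_G[OF assms(3) w(1)] by (metis empty_iff insert_iff)
      then have "rmin * wt (s n) \<le> wt x" using wt_ratio[OF assms(3) w(1) that(1)] by auto
      also have "\<dots> \<le> wt (drop j x)" using wt_drop_ge that by blast
      finally show ?thesis .
    qed
    have "0 < wt (drop j e)" using wt_pos[OF drop_words[OF a(2)]] .
    then show "\<bar>U p e - U q f\<bar> \<le> wt (drop j e)"
      using *[OF a(2), of p] *[OF a(3), of q] a(4) rmin_pos wt_pos[OF w(1)] by (auto simp: U_def)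
  qed
  \<comment> \<open>On descendants of \<open>s n\<close> and of \<open>t n\<close> the values at
    both ends of the parent coincide, so interpolation keeps them constant.\<close>
  define V where "V k = (extU ^^ k) U" for k
  have V: "lip (n + k) (V k) \<and> (\<forall>r. V k r (s (n + k)) = rmin * wt (s n) \<and> V k r (t (n + k)) = 0)" for k
  proof (induction k)
    case 0
    have "lb n r (s n) \<in> ends (G n) (s n)" for r using ends_G[OF assms(3) w(1)] by (cases r) auto
    moreover have "lb n r (t n) \<notin> ends (G n) (s n)" for r
      using ends_G[OF assms(3) w(2)] assms(4) by (cases r) (auto simp: touch_def)
    ultimately have "U r (s n) = rmin * wt (s n)" "U r (t n) = 0" for r by (simp_all add: U_def)
    then show ?case using U0 by (simp add: V_def)
  next
    case (Suc k)
    obtain a where a: "a \<in> E\<^sub>1" "s (Suc (n + k)) = a # s (n + k)" using symbol_Suc[of s "n + k"] assms by auto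
    obtain b where b: "b \<in> E\<^sub>1" "t (Suc (n + k)) = b # t (n + k)" using symbol_Suc[of t "n + k"] assms by auto
    have V': "V (Suc k) = extU (V k)" by (simp add: V_def)
    show ?case using Suc lip_extU[of "n + k" "V k"] assms(3) by (auto simp: V' a b extU_Cons)
  qed
  have "rmin * wt (s n) \<le> ed (n + k) (s (n + k)) (t (n + k))" for k
  proof -
    have nk: "n + k \<ge> 1" using assms by simp
    have w': "s (n + k) \<in> W (n + k)" "t (n + k) \<in> W (n + k)" using symbol_in_words assms nk by auto
    obtain p q where pq: "ed (n + k) (s (n + k)) (t (n + k)) = vd (n + k) (lb (n + k) p (s (n + k))) (lb (n + k) q (t (n + k)))"
      using ed_attained[OF nk w'] by auto
    show ?thesis using lip_le_vd[OF conjunct1[OF V[of k]] nk w', of p q] V[of k] pq by auto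
  qed
  then have "\<forall>\<^sub>F m in sequentially. rmin * wt (s n) \<le> ed m (s m) (t m)"
    unfolding eventually_sequentially by (metis le_iff_add)
  then show ?thesis by (intro tendsto_lowerbound[OF ed_tendsto[OF assms(1,2)]]) auto
qed

end

section \<open>The limit space\<close>

context laakso_igs
begin

text \<open>Letters are indexed by the level at which they are added, so words are read backwards;
  \<open>restrict\<close> matches the extensional functions in \<open>symbol_space\<close>.\<close>

definition symbol_of :: "(nat \<Rightarrow> 'e) \<Rightarrow> nat \<Rightarrow> 'e list" where
  "symbol_of \<omega> = restrict (\<lambda>n. rev (map \<omega> [0..<n])) {1..}"

lemma symbol_of_in: "(\<And>i. \<omega> i \<in> E\<^sub>1) \<Longrightarrow> symbol_of \<omega> \<in> \<Sigma>"
  by (auto simp: symbol_space_def symbol_of_def edges_G words_def edge_proj_def)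

lemma symbol_of_nth: "n \<ge> 1 \<Longrightarrow> symbol_of \<omega> n = rev (map \<omega> [0..<n])"
  by (simp add: symbol_of_def)

lemma symbol_extend:
  assumes "e \<in> W n" "n \<ge> 1"
  shows "\<exists>s\<in>\<Sigma>. s n = e"
proof -
  obtain a where a: "a \<in> E\<^sub>1" using E1_ne by auto
  define \<omega> where "\<omega> i = (if i < n then rev e ! i else a)" for i
  have len: "length e = n" and sub: "set e \<subseteq> E\<^sub>1" using assms by (auto simp: words_def)
  have "\<omega> i \<in> E\<^sub>1" for i
    using a len sub nth_mem[of i "rev e"] by (auto simp: \<omega>_def)
  moreover have "map \<omega> [0..<n] = rev e"
    using len by (intro nth_equalityI) (auto simp: \<omega>_def)
  ultimately show ?thesis using symbol_of_in[of \<omega>] symbol_of_nth[of n \<omega>] assms by (metis rev_rev_ident)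
qed

abbreviation X where "X \<equiv> limit_space S"
abbreviation cls where "cls s \<equiv> limit_rel S `` {s}"

lemma limit_rel_iff: "(s, t) \<in> limit_rel S \<longleftrightarrow> s \<in> \<Sigma> \<and> t \<in> \<Sigma> \<and> (\<forall>n\<ge>1. touch n (s n) (t n))"
  by (auto simp: limit_rel_def touch_def)

text \<open>Depends on the codes alone, so it serves every weight at once. For equivalent codes the
  value carries no information.\<close>

definition sep :: "(nat \<Rightarrow> 'e list) \<Rightarrow> (nat \<Rightarrow> 'e list) \<Rightarrow> nat" where
  "sep s t = (LEAST n. n \<ge> 1 \<and> \<not> touch n (s n) (t n))"

lemma sep:
  assumes "s \<in> \<Sigma>" "t \<in> \<Sigma>" "(s, t) \<notin> limit_rel S"
  shows "sep s t \<ge> 1" "\<not> touch (sep s t) (s (sep s t)) (t (sep s t))"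
    "1 \<le> m \<Longrightarrow> m < sep s t \<Longrightarrow> touch m (s m) (t m)"
proof -
  have ex: "\<exists>n. n \<ge> 1 \<and> \<not> touch n (s n) (t n)" using assms by (auto simp: limit_rel_iff)
  show "sep s t \<ge> 1" "\<not> touch (sep s t) (s (sep s t)) (t (sep s t))"
    using LeastI_ex[OF ex] by (auto simp: sep_def)
  show "1 \<le> m \<Longrightarrow> m < sep s t \<Longrightarrow> touch m (s m) (t m)"
    unfolding sep_def using not_less_Least by blast
qed

end

context weighted_igs
begin

lemma D_eq_0_iff: "s \<in> \<Sigma> \<Longrightarrow> t \<in> \<Sigma> \<Longrightarrow> D s t = 0 \<longleftrightarrow> (s, t) \<in> limit_rel S"
proof
  assume st: "s \<in> \<Sigma>" "t \<in> \<Sigma>" and D: "D s t = 0"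
  show "(s, t) \<in> limit_rel S"
  proof (rule ccontr)
    assume n: "(s, t) \<notin> limit_rel S"
    have "0 < rmin * wt (s (sep s t))"
      using rmin_pos wt_pos symbol_in_words[OF st(1) sep(1)[OF st n]] by auto
    then show False using D_not_touch_ge[OF st sep(1,2)[OF st n]] D by simp
  qed
next
  assume st: "s \<in> \<Sigma>" "t \<in> \<Sigma>" and r: "(s, t) \<in> limit_rel S"
  have "(\<lambda>n. Cup * wt (s n)) \<longlonglongrightarrow> Cup * 0" by (intro tendsto_intros wt_symbol_tendsto st)
  moreover have "\<forall>\<^sub>F n in sequentially. D s t \<le> Cup * wt (s n)"
    using eventually_ge_at_top[of 1]
    by eventually_elim (use r in \<open>auto intro!: D_touch_le simp: limit_rel_iff\<close>)
  ultimately have "D s t \<le> Cup * 0" by (intro tendsto_lowerbound) auto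
  then show "D s t = 0" using D_nonneg[OF st] by simp
qed

lemma D_self: "s \<in> \<Sigma> \<Longrightarrow> D s s = 0"
  using D_eq_0_iff[of s s] touch_refl symbol_in_words by (auto simp: limit_rel_iff)

text \<open>Touching on a single level need not be transitive; transitivity of the limit relation
  comes from the triangle inequality for \<open>D\<close>, by \<open>D_eq_0_iff\<close>.\<close>

lemma equiv_limit_rel: "equiv \<Sigma> (limit_rel S)"
proof (rule equivI)
  show "limit_rel S \<subseteq> \<Sigma> \<times> \<Sigma>" by (auto simp: limit_rel_iff)
  show "refl_on \<Sigma> (limit_rel S)" using D_eq_0_iff D_self by (auto simp: refl_on_def)
  show "sym (limit_rel S)" by (auto simp: sym_def limit_rel_iff touch_sym)
  show "trans (limit_rel S)"
  proof (rule transI)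
    fix s t r assume a: "(s, t) \<in> limit_rel S" "(t, r) \<in> limit_rel S"
    then have m: "s \<in> \<Sigma>" "t \<in> \<Sigma>" "r \<in> \<Sigma>" by (auto simp: limit_rel_iff)
    then have "D s t = 0" "D t r = 0" using a D_eq_0_iff by auto
    then have "D s r = 0" using D_triangle[of s r t] D_nonneg[of s r] m by simp
    then show "(s, r) \<in> limit_rel S" using D_eq_0_iff m by auto
  qed
qed

lemma X_cases: "x \<in> X \<Longrightarrow> \<exists>s\<in>\<Sigma>. x = cls s"
  by (auto simp: limit_space_def quotient_def)

lemma cls_in_X: "s \<in> \<Sigma> \<Longrightarrow> cls s \<in> X"
  by (auto simp: limit_space_def quotient_def)

lemma cls_eq_iff: "s \<in> \<Sigma> \<Longrightarrow> t \<in> \<Sigma> \<Longrightarrow> cls s = cls t \<longleftrightarrow> (s, t) \<in> limit_rel S"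
  using eq_equiv_class_iff[OF equiv_limit_rel] by auto

abbreviation dX where "dX \<equiv> wlimit_dist S \<rho>"

text \<open>The limit over representatives is well defined because equivalent codes have
  \<open>D\<close>-distance 0.\<close>

lemma dX_cls:
  assumes "s \<in> \<Sigma>" "t \<in> \<Sigma>"
  shows "dX (cls s) (cls t) = D s t"
proof -
  have eq: "D s' t' = D s t" if "s' \<in> cls s" "t' \<in> cls t" for s' t'
  proof -
    have m: "s' \<in> \<Sigma>" "t' \<in> \<Sigma>" "D s s' = 0" "D t t' = 0"
      using that D_eq_0_iff assms by (auto simp: limit_rel_iff)
    then show ?thesis
      using D_triangle[of s t s'] D_triangle[of s' t t'] D_triangle[of s' t' s] D_triangle[of s t' t] assms
        D_sym[of s s'] D_sym[of t t'] by fastforce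
  qed
  have lim: "(\<lambda>i. ed i (s' i) (t' i)) \<longlonglongrightarrow> D s t" if "s' \<in> cls s" "t' \<in> cls t" for s' t'
    using ed_tendsto[of s' t'] that eq[OF that] by (auto simp: limit_rel_iff)
  have self: "s \<in> cls s" "t \<in> cls t" using equiv_class_self[OF equiv_limit_rel] assms by auto
  have "(THE r. \<forall>s'\<in>cls s. \<forall>t'\<in>cls t. (\<lambda>i. ed i (s' i) (t' i)) \<longlonglongrightarrow> r) = D s t"
  proof (rule the_equality)
    show "\<forall>s'\<in>cls s. \<forall>t'\<in>cls t. (\<lambda>i. ed i (s' i) (t' i)) \<longlonglongrightarrow> D s t" using lim by blast
    fix r assume "\<forall>s'\<in>cls s. \<forall>t'\<in>cls t. (\<lambda>i. ed i (s' i) (t' i)) \<longlonglongrightarrow> r"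
    then have "(\<lambda>i. ed i (s i) (t i)) \<longlonglongrightarrow> r" using self by blast
    then show "r = D s t" using lim[OF self] LIMSEQ_unique by blast
  qed
  then show ?thesis using cls_in_X assms by (simp add: wlimit_dist_def)
qed

sublocale Metric_space X dX
proof
  fix x y
  show "0 \<le> dX x y"
  proof (cases "x \<in> X \<and> y \<in> X")
    case True
    then show ?thesis using X_cases[of x] X_cases[of y] dX_cls D_nonneg by auto
  qed (auto simp: wlimit_dist_def)
  show "dX x y = dX y x"
  proof (cases "x \<in> X \<and> y \<in> X")
    case True
    then show ?thesis using X_cases[of x] X_cases[of y] dX_cls D_sym by auto
  qed (auto simp: wlimit_dist_def)
  show "x \<in> X \<Longrightarrow> y \<in> X \<Longrightarrow> dX x y = 0 \<longleftrightarrow> x = y"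
    using X_cases[of x] X_cases[of y] dX_cls D_eq_0_iff cls_eq_iff by metis
  fix z show "x \<in> X \<Longrightarrow> y \<in> X \<Longrightarrow> z \<in> X \<Longrightarrow> dX x z \<le> dX x y + dX y z"
    using X_cases[of x] X_cases[of y] X_cases[of z] dX_cls D_triangle by auto
qed

text \<open>On level 1 all edges together cost at most \<open>card E\<^sub>1\<close>; the other term
  bounds the change from level 1 to the limit.\<close>

definition Dmax where "Dmax = real (card E\<^sub>1) + 2 / (1 - rmax)"
text \<open>The division by \<open>rmin\<close> pays for one letter: from the level before
  separation to the separation level, or for the first letter when there is no earlier
  level.\<close>

definition Csep where "Csep = (Dmax + Cup) / rmin"

lemma Dmax_pos: "0 < Dmax"
  using rmax_less_1 by (auto simp: Dmax_def intro!: add_nonneg_pos)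

lemma Csep_pos: "0 < Csep"
  using Dmax_pos Cup_pos rmin_pos by (simp add: Csep_def)

lemma D_le_Dmax: "s \<in> \<Sigma> \<Longrightarrow> t \<in> \<Sigma> \<Longrightarrow> D s t \<le> Dmax"
proof -
  assume st: "s \<in> \<Sigma>" "t \<in> \<Sigma>"
  have w: "s 1 \<in> W 1" "t 1 \<in> W 1" using symbol_in_words st by auto
  obtain \<Omega> where \<Omega>: "\<Omega> \<in> Om 1 (lb 1 Minus (s 1)) (lb 1 Minus (t 1))"
    "vd 1 (lb 1 Minus (s 1)) (lb 1 Minus (t 1)) = sum wt \<Omega>"
    using vd_attained[OF order_refl w] by blast
  have sub: "\<Omega> \<subseteq> W 1" using \<Omega> by (auto simp: Om_def)
  have "sum wt \<Omega> \<le> sum wt (W 1)"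
    using sub finite_words[OF finE] wt_pos by (intro sum_mono2) (auto intro: less_imp_le)
  also have "\<dots> \<le> (\<Sum>e\<in>W 1. 1)" using wt_le_1 by (intro sum_mono) auto
  also have "\<dots> = card E\<^sub>1" by (auto simp: words_1 card_image inj_on_def)
  finally have "ed 1 (s 1) (t 1) \<le> card E\<^sub>1" using ed_le[OF order_refl w, of Minus Minus] \<Omega> by simp
  moreover have "(wt (s 1) + wt (t 1)) / (1 - rmax) \<le> 2 / (1 - rmax)"
    using wt_le_1[OF w(1)] wt_le_1[OF w(2)] rmax_less_1 by (intro divide_right_mono) auto
  ultimately show ?thesis using D_ed[OF st order_refl] by (auto simp: Dmax_def)
qed

text \<open>At the separation level the cells are apart, which bounds the distance from below; one
  level earlier they still touch, which bounds it from above at the cost of one letter.\<close>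

lemma D_sep:
  assumes st: "s \<in> \<Sigma>" "t \<in> \<Sigma>" "(s, t) \<notin> limit_rel S"
  shows "rmin * wt (s (sep s t)) \<le> D s t" "D s t \<le> Csep * wt (s (sep s t))"
proof -
  show "rmin * wt (s (sep s t)) \<le> D s t" using D_not_touch_ge sep[OF st] st by auto
  have w: "0 < wt (s (sep s t))" using wt_pos symbol_in_words[OF st(1)] sep(1)[OF st] by blast
  show "D s t \<le> Csep * wt (s (sep s t))"
  proof (cases "sep s t = 1")
    case True
    have "rmin \<le> wt (s (sep s t))" using wt_ge_rmin[of "s 1" 1] symbol_in_words[OF st(1)] True by simp
    then have "Csep * rmin \<le> Csep * wt (s (sep s t))" using Csep_pos by simp
    moreover have "Dmax \<le> Csep * rmin" using Cup_pos rmin_pos by (simp add: Csep_def)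
    ultimately show ?thesis using D_le_Dmax[OF st(1,2)] by simp
  next
    case False
    then obtain m where m: "sep s t = Suc m" "m \<ge> 1" using sep(1)[OF st] by (cases "sep s t") auto
    obtain a where a: "a \<in> E\<^sub>1" "s (Suc m) = a # s m" using symbol_Suc st m by blast
    have wm: "0 < wt (s m)" using wt_pos symbol_in_words[OF st(1) m(2)] by blast
    have "D s t \<le> Cup * wt (s m)" using D_touch_le[OF st(1,2) m(2)] sep(3)[OF st, of m] m by auto
    also have "\<dots> \<le> (Csep * rmin) * wt (s m)"
      using Dmax_pos rmin_pos wm by (intro mult_right_mono) (auto simp: Csep_def)
    also have "\<dots> = Csep * (rmin * wt (s m))" by simp
    also have "\<dots> \<le> Csep * wt (s (Suc m))" using a rmin_le[OF a(1)] Csep_pos wm by simp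
    finally show ?thesis using m by simp
  qed
qed

end

section \<open>Quasisymmetry of the intrinsic metrics\<close>

lemma weight_mono_powr:
  assumes "set e \<subseteq> A" "\<And>a. a \<in> A \<Longrightarrow> 0 \<le> \<rho> a" "\<And>a. a \<in> A \<Longrightarrow> 0 \<le> \<sigma> a" "\<And>a. a \<in> A \<Longrightarrow> \<rho> a \<le> \<sigma> a powr \<alpha>"
  shows "0 \<le> weight \<rho> e \<and> 0 \<le> weight \<sigma> e \<and> weight \<rho> e \<le> weight \<sigma> e powr \<alpha>"
  using assms(1)
proof (induction e)
  case (Cons a e)
  then show ?case using assms(2-4)[of a] by (auto simp: powr_mult intro!: mult_mono)
qed auto

text \<open>The inverse of a maximum of two increasing homeomorphisms is the minimum of their
  inverses.\<close>

lemma homeomorphic_map_max_powr: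
  assumes "0 < C" "0 < \<alpha>" "0 < \<beta>"
  shows "homeomorphic_map (top_of_set {0..}) (top_of_set {0..}) (\<lambda>t::real. C * max (t powr \<alpha>) (t powr \<beta>))"
proof -
  let ?f = "\<lambda>t::real. C * max (t powr \<alpha>) (t powr \<beta>)"
  let ?g = "\<lambda>s::real. min ((s / C) powr (1 / \<alpha>)) ((s / C) powr (1 / \<beta>))"
  have "homeomorphic_maps (top_of_set {0..}) (top_of_set {0..}) ?f ?g"
    unfolding homeomorphic_maps_def
  proof (intro conjI ballI)
    show "continuous_map (top_of_set {0..}) (top_of_set {0..}) ?f"
      using assms by (auto intro!: continuous_intros continuous_on_powr' mult_nonneg_nonneg simp: le_max_iff_disj)
    show "continuous_map (top_of_set {0..}) (top_of_set {0..}) ?g"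
      using assms by (auto intro!: continuous_intros continuous_on_powr')
    have mono: "x powr p \<le> y powr p" if "x \<le> y" "0 \<le> x" "0 < p" for x y p :: real
      using that by (intro powr_mono2) auto
    have inv: "(x powr p) powr (1 / p) = x" "(x powr (1 / p)) powr p = x" if "0 \<le> x" "0 < p" for x p :: real
      using that by (auto simp: powr_powr)
    fix t :: real assume "t \<in> topspace (top_of_set {0..})"
    then have t: "0 \<le> t" by simp
    have d: "C * a / C = a" for a :: real using assms by simp
    have m: "?f t = C * t powr \<alpha> \<and> t powr \<beta> \<le> t powr \<alpha> \<or> ?f t = C * t powr \<beta> \<and> t powr \<alpha> \<le> t powr \<beta>"
      by (auto simp: max_def)
    then show "?g (?f t) = t"
    proof (elim disjE conjE)
      assume e: "?f t = C * t powr \<alpha>" "t powr \<beta> \<le> t powr \<alpha>"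
      have "t \<le> (t powr \<alpha>) powr (1 / \<beta>)"
        using mono[OF e(2), of "1 / \<beta>"] inv(1)[OF t assms(3)] assms by simp
      then show ?thesis unfolding e d using inv(1)[OF t assms(2)] by simp
    next
      assume e: "?f t = C * t powr \<beta>" "t powr \<alpha> \<le> t powr \<beta>"
      have "t \<le> (t powr \<beta>) powr (1 / \<alpha>)"
        using mono[OF e(2), of "1 / \<alpha>"] inv(1)[OF t assms(2)] assms by simp
      then show ?thesis unfolding e d using inv(1)[OF t assms(3)] by simp
    qed
  next
    have mono: "x powr p \<le> y powr p" if "x \<le> y" "0 \<le> x" "0 < p" for x y p :: real
      using that by (intro powr_mono2) auto
    have inv: "(x powr (1 / p)) powr p = x" if "0 \<le> x" "0 < p" for x p :: real
      using that by (auto simp: powr_powr)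
    fix s :: real assume "s \<in> topspace (top_of_set {0..})"
    then have s: "0 \<le> s / C" using assms by simp
    have m: "?g s = (s / C) powr (1 / \<alpha>) \<and> (s / C) powr (1 / \<alpha>) \<le> (s / C) powr (1 / \<beta>) \<or>
      ?g s = (s / C) powr (1 / \<beta>) \<and> (s / C) powr (1 / \<beta>) \<le> (s / C) powr (1 / \<alpha>)"
      by (auto simp: min_def)
    then show "?f (?g s) = s"
    proof (elim disjE conjE)
      assume e: "?g s = (s / C) powr (1 / \<alpha>)" "(s / C) powr (1 / \<alpha>) \<le> (s / C) powr (1 / \<beta>)"
      have "((s / C) powr (1 / \<alpha>)) powr \<beta> \<le> s / C"
        using mono[OF e(2), of \<beta>] inv[OF s assms(3)] assms by simp
      then show ?thesis unfolding e using inv[OF s assms(2)] assms by simp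
    next
      assume e: "?g s = (s / C) powr (1 / \<beta>)" "(s / C) powr (1 / \<beta>) \<le> (s / C) powr (1 / \<alpha>)"
      have "((s / C) powr (1 / \<beta>)) powr \<alpha> \<le> s / C"
        using mono[OF e(2), of \<alpha>] inv[OF s assms(2)] assms by simp
      then show ?thesis unfolding e using inv[OF s assms(3)] assms by simp
    qed
  qed
  then show ?thesis using homeomorphic_map_maps by blast
qed

lemma mtopology_le:
  assumes "Metric_space M d" "Metric_space M d'"
    and cmp: "\<And>e. 0 < e \<Longrightarrow> \<exists>r>0. \<forall>x\<in>M. \<forall>y\<in>M. d' x y < r \<longrightarrow> d x y < e"
    and U: "openin (Metric_space.mtopology M d) U"
  shows "openin (Metric_space.mtopology M d') U"
proof -
  interpret A: Metric_space M d by fact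
  interpret B: Metric_space M d' by fact
  have "\<exists>r>0. B.mball x r \<subseteq> U" if x: "x \<in> U" for x
  proof -
    obtain e where e: "e > 0" "A.mball x e \<subseteq> U" using U x unfolding A.openin_mtopology by blast
    obtain r where r: "r > 0" "\<forall>x\<in>M. \<forall>y\<in>M. d' x y < r \<longrightarrow> d x y < e" using cmp[OF e(1)] by auto
    have "B.mball x r \<subseteq> A.mball x e" using r by (auto simp: A.in_mball B.in_mball)
    then show ?thesis using r e by blast
  qed
  then show ?thesis using U unfolding A.openin_mtopology B.openin_mtopology by blast
qed

lemma weighted_dist_le_powr:
  assumes A: "weighted_igs S \<rho> h" and B: "weighted_igs S \<sigma> k"
  shows "\<exists>C \<alpha>. 0 < C \<and> 0 < \<alpha> \<and>
    (\<forall>x\<in>limit_space S. \<forall>y\<in>limit_space S. wlimit_dist S \<rho> x y \<le> C * wlimit_dist S \<sigma> x y powr \<alpha>)"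
proof -
  interpret A: weighted_igs S \<rho> h by fact
  interpret B: weighted_igs S \<sigma> k by fact
  \<comment> \<open>Solves \<open>B.rmin powr \<alpha> = A.rmax\<close>, so that the lightest letter
    for \<sigma> still dominates the heaviest for \<rho>; products of letters inherit the
    comparison.\<close>
  define \<alpha> where "\<alpha> = ln A.rmax / ln B.rmin"
  have \<alpha>: "0 < \<alpha>" using A.rmax_pos A.rmax_less_1 B.rmin_pos B.rmin_less_1
    by (auto simp: \<alpha>_def intro!: divide_neg_neg)
  have letter: "\<rho> a \<le> \<sigma> a powr \<alpha>" if "a \<in> A.E\<^sub>1" for a
  proof -
    have "\<rho> a \<le> A.rmax" using A.rmax_ge that .
    also have "\<dots> = B.rmin powr \<alpha>"
      using A.rmax_pos B.rmin_pos B.rmin_less_1 by (simp add: \<alpha>_def powr_def)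
    also have "\<dots> \<le> \<sigma> a powr \<alpha>" using \<alpha> B.rmin_pos B.rmin_le[OF that] by (intro powr_mono2) auto
    finally show ?thesis .
  qed
  have wt: "A.wt e \<le> B.wt e powr \<alpha>" if "e \<in> A.W n" for e n
    using weight_mono_powr[of e A.E\<^sub>1 \<rho> \<sigma> \<alpha>] A.\<rho>_pos B.\<rho>_pos letter that
    by (auto simp: words_def intro: less_imp_le)
  let ?C = "A.Csep * (1 / B.rmin) powr \<alpha>"
  have "A.dX x y \<le> ?C * B.dX x y powr \<alpha>" if xy: "x \<in> A.X" "y \<in> A.X" for x y
  proof -
    obtain s t where st: "s \<in> A.\<Sigma>" "t \<in> A.\<Sigma>" "x = A.cls s" "y = A.cls t"
      using A.X_cases xy by blast
    show ?thesis
    proof (cases "(s, t) \<in> limit_rel S")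
      case True
      then have "A.dX x y = 0" using st A.dX_cls A.D_eq_0_iff by simp
      then show ?thesis using A.Csep_pos by simp
    next
      case False
      \<comment> \<open>The separation level does not involve the weight, so one and the same word
        measures both distances.\<close>
      let ?n = "A.sep s t"
      have w: "s ?n \<in> A.W ?n" using A.symbol_in_words st A.sep(1)[OF st(1,2) False] by auto
      have "A.D s t \<le> A.Csep * A.wt (s ?n)" using A.D_sep(2) st False by auto
      also have "\<dots> \<le> A.Csep * B.wt (s ?n) powr \<alpha>" using wt[OF w] A.Csep_pos by simp
      also have "\<dots> \<le> A.Csep * ((1 / B.rmin) * B.D s t) powr \<alpha>"
      proof (intro mult_left_mono powr_mono2)
        show "B.wt (s ?n) \<le> 1 / B.rmin * B.D s t"
          using B.D_sep(1)[OF st(1,2) False] B.rmin_pos by (simp add: field_simps)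
      qed (use \<alpha> A.Csep_pos B.wt_pos[OF w] in auto)
      also have "\<dots> = ?C * B.D s t powr \<alpha>"
        using B.rmin_pos B.D_nonneg[OF st(1,2)] powr_mult[of "1 / B.rmin" "B.D s t" \<alpha>] by simp
      finally show ?thesis using st A.dX_cls B.dX_cls by simp
    qed
  qed
  moreover have "0 < ?C" using A.Csep_pos B.rmin_pos by simp
  ultimately show ?thesis using \<alpha> by blast
qed

lemma weighted_mtopology_le:
  assumes A: "weighted_igs S \<rho> h" and B: "weighted_igs S \<sigma> k"
    and U: "openin (Metric_space.mtopology (limit_space S) (wlimit_dist S \<rho>)) U"
  shows "openin (Metric_space.mtopology (limit_space S) (wlimit_dist S \<sigma>)) U"
proof (rule mtopology_le[OF _ _ _ U])
  interpret A: weighted_igs S \<rho> h by fact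
  interpret B: weighted_igs S \<sigma> k by fact
  show "Metric_space A.X A.dX" "Metric_space A.X B.dX" by unfold_locales
  obtain C \<alpha> where C: "0 < C" "0 < \<alpha>" "\<And>x y. x \<in> A.X \<Longrightarrow> y \<in> A.X \<Longrightarrow> A.dX x y \<le> C * B.dX x y powr \<alpha>"
    using weighted_dist_le_powr[OF A B] by blast
  fix e :: real assume e: "0 < e"
  let ?r = "(e / C) powr (1 / \<alpha>)"
  have "A.dX x y < e" if "x \<in> A.X" "y \<in> A.X" "B.dX x y < ?r" for x y
  proof -
    have "B.dX x y powr \<alpha> < ?r powr \<alpha>" using that C by (intro powr_less_mono2) auto
    also have "\<dots> = e / C" using e C by (simp add: powr_powr)
    finally have "C * B.dX x y powr \<alpha> < e" using C by (simp add: field_simps)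
    then show ?thesis using C(3)[OF that(1,2)] by simp
  qed
  moreover have "0 < ?r" using e C by simp
  ultimately show "\<exists>r>0. \<forall>x\<in>A.X. \<forall>y\<in>A.X. B.dX x y < r \<longrightarrow> A.dX x y < e" by blast
qed

text \<open>Both distances from a common point are comparable to weights of two words on the same
  code, and the quotient of these is the weight of the letters in between, or its inverse. The
  exponent \<alpha> controls quotients of the first kind and \<beta> those of the second, hence the
  maximum in the gauge.\<close>

lemma weighted_quasisymmetric:
  assumes A: "weighted_igs S \<rho> h" and B: "weighted_igs S \<sigma> k"
  shows "quasisymmetric (limit_space S) (wlimit_dist S \<sigma>) (wlimit_dist S \<rho>)"
proof -
  interpret A: weighted_igs S \<rho> h by fact
  interpret B: weighted_igs S \<sigma> k by fact
  define \<alpha> where "\<alpha> = ln A.rmax / ln B.rmin"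
  \<comment> \<open>Solves \<open>B.rmax powr \<beta> = A.rmin\<close>, which bounds \<sigma> by the
    power 1/\<beta> of \<rho>; this is the comparison that survives taking inverses.\<close>
  define \<beta> where "\<beta> = ln A.rmin / ln B.rmax"
  have \<alpha>: "0 < \<alpha>" using A.rmax_pos A.rmax_less_1 B.rmin_pos B.rmin_less_1
    by (auto simp: \<alpha>_def intro!: divide_neg_neg)
  have \<beta>: "0 < \<beta>" using A.rmin_pos A.rmin_less_1 B.rmax_pos B.rmax_less_1
    by (auto simp: \<beta>_def intro!: divide_neg_neg)
  have letter: "\<rho> a \<le> \<sigma> a powr \<alpha>" "\<sigma> a \<le> \<rho> a powr (1 / \<beta>)" if "a \<in> A.E\<^sub>1" for a
  proof -
    have "\<rho> a \<le> A.rmax" using A.rmax_ge that .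
    also have "\<dots> = B.rmin powr \<alpha>"
      using A.rmax_pos B.rmin_pos B.rmin_less_1 by (simp add: \<alpha>_def powr_def)
    also have "\<dots> \<le> \<sigma> a powr \<alpha>" using \<alpha> B.rmin_pos B.rmin_le[OF that] by (intro powr_mono2) auto
    finally show "\<rho> a \<le> \<sigma> a powr \<alpha>" .
    have "\<sigma> a \<le> B.rmax" using B.rmax_ge that .
    also have "\<dots> = A.rmin powr (1 / \<beta>)"
      using B.rmax_pos A.rmin_pos A.rmin_less_1 by (simp add: \<beta>_def powr_def)
    also have "\<dots> \<le> \<rho> a powr (1 / \<beta>)" using \<beta> A.rmin_pos A.rmin_le[OF that] by (intro powr_mono2) auto
    finally show "\<sigma> a \<le> \<rho> a powr (1 / \<beta>)" .
  qed
  have wt: "A.wt e \<le> B.wt e powr \<alpha>" "B.wt e \<le> A.wt e powr (1 / \<beta>)" "0 < A.wt e" "0 < B.wt e"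
    if "set e \<subseteq> A.E\<^sub>1" for e
    using weight_mono_powr[of e A.E\<^sub>1 \<rho> \<sigma> \<alpha>] weight_mono_powr[of e A.E\<^sub>1 \<sigma> \<rho> "1 / \<beta>"]
      A.\<rho>_pos B.\<rho>_pos letter that A.wt_pos[of e "length e"] B.wt_pos[of e "length e"]
    by (auto simp: words_def intro: less_imp_le)
  have split: "s m = take (m - n) (s m) @ s n" "set (take (m - n) (s m)) \<subseteq> A.E\<^sub>1"
    if "s \<in> A.\<Sigma>" "1 \<le> n" "n \<le> m" for s m n
  proof -
    show "s m = take (m - n) (s m) @ s n"
      using A.symbol_drop[OF that] append_take_drop_id[of "m - n" "s m"] by simp
    show "set (take (m - n) (s m)) \<subseteq> A.E\<^sub>1"
      using A.symbol_in_words[of s m] that by (auto simp: words_def dest: in_set_takeD)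
  qed
  have ratio: "A.wt (s m) / A.wt (s n) \<le> max ((B.wt (s m) / B.wt (s n)) powr \<alpha>) ((B.wt (s m) / B.wt (s n)) powr \<beta>)"
    if s: "s \<in> A.\<Sigma>" "1 \<le> n" "1 \<le> m" for s m n
  proof -
    have pos: "0 < A.wt (s i)" "0 < B.wt (s i)" if "1 \<le> i" for i
      using A.wt_pos B.wt_pos A.symbol_in_words[OF s(1) that] by blast+
    show ?thesis
    proof (cases "n \<le> m")
      case True
      let ?e = "take (m - n) (s m)"
      have "A.wt (s m) / A.wt (s n) = A.wt ?e" "B.wt (s m) / B.wt (s n) = B.wt ?e"
        using split(1)[OF s(1,2) True] pos[OF s(2)] by (metis less_irrefl nonzero_mult_div_cancel_right weight_append)+
      then show ?thesis using wt(1)[OF split(2)[OF s(1,2) True]] by simp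
    next
      case False
      then have nm: "m \<le> n" by simp
      let ?e = "take (n - m) (s n)"
      have *: "A.wt (s n) / A.wt (s m) = A.wt ?e" "B.wt (s n) / B.wt (s m) = B.wt ?e"
        using split(1)[OF s(1,3) nm] pos[OF s(3)] by (metis less_irrefl nonzero_mult_div_cancel_right weight_append)+
      have e: "B.wt ?e \<le> A.wt ?e powr (1 / \<beta>)" "0 < A.wt ?e" "0 < B.wt ?e" using wt split(2)[OF s(1,3) nm] by auto
      have "B.wt ?e powr \<beta> \<le> (A.wt ?e powr (1 / \<beta>)) powr \<beta>" using e \<beta> by (intro powr_mono2) auto
      also have "\<dots> = A.wt ?e" using e \<beta> by (simp add: powr_powr)
      finally have "1 / A.wt ?e \<le> 1 / (B.wt ?e powr \<beta>)" using e by (intro divide_left_mono) auto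
      also have "\<dots> = (1 / B.wt ?e) powr \<beta>" using e by (simp add: powr_divide)
      finally have "A.wt (s m) / A.wt (s n) \<le> (B.wt (s m) / B.wt (s n)) powr \<beta>"
        unfolding *[symmetric] by simp
      then show ?thesis by simp
    qed
  qed
  \<comment> \<open>\<open>K\<close> and \<open>L\<close> are the losses of the two-sided estimate
    \<open>D_sep\<close> in the two metrics.\<close>
  define K where "K = A.Csep / A.rmin"
  define L where "L = B.Csep / B.rmin"
  have KL: "0 < K" "0 < L" using A.Csep_pos A.rmin_pos B.Csep_pos B.rmin_pos by (auto simp: K_def L_def)
  define C where "C = K * max (L powr \<alpha>) (L powr \<beta>)"
  have C: "0 < C" using KL by (auto simp: C_def less_max_iff_disj)
  have main: "A.dX x y / A.dX x z \<le> C * max ((B.dX x y / B.dX x z) powr \<alpha>) ((B.dX x y / B.dX x z) powr \<beta>)"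
    if xyz: "x \<in> A.X" "y \<in> A.X" "z \<in> A.X" "x \<noteq> z" for x y z
  proof -
    obtain s t r where st: "s \<in> A.\<Sigma>" "t \<in> A.\<Sigma>" "r \<in> A.\<Sigma>" "x = A.cls s" "y = A.cls t" "z = A.cls r"
      using A.X_cases xyz by meson
    have sr: "(s, r) \<notin> limit_rel S" using st xyz A.cls_eq_iff by auto
    have eq: "A.dX x y = A.D s t" "A.dX x z = A.D s r" "B.dX x y = B.D s t" "B.dX x z = B.D s r"
      using st A.dX_cls B.dX_cls by auto
    show ?thesis
    proof (cases "(s, t) \<in> limit_rel S")
      case True
      then have "A.dX x y = 0" using eq A.D_eq_0_iff st by simp
      then show ?thesis using C by (auto simp: le_max_iff_disj intro!: mult_nonneg_nonneg)
    next
      case False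
      let ?m = "A.sep s t" and ?n = "A.sep s r"
      have mn: "1 \<le> ?m" "1 \<le> ?n" using A.sep(1) st False sr by auto
      have pos: "0 < A.wt (s i)" "0 < B.wt (s i)" if "1 \<le> i" for i
        using A.wt_pos B.wt_pos A.symbol_in_words[OF st(1) that] by blast+
      note a = A.D_sep[OF st(1,2) False] A.D_sep[OF st(1,3) sr]
      note b = B.D_sep[OF st(1,2) False] B.D_sep[OF st(1,3) sr]
      have "A.D s t / A.D s r \<le> (A.Csep * A.wt (s ?m)) / (A.rmin * A.wt (s ?n))"
        using a pos(1)[OF mn(1)] pos(1)[OF mn(2)] A.rmin_pos A.Csep_pos
        by (intro frac_le mult_nonneg_nonneg mult_pos_pos) auto
      also have "\<dots> = K * (A.wt (s ?m) / A.wt (s ?n))" by (simp add: K_def)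
      finally have 1: "A.D s t / A.D s r \<le> K * (A.wt (s ?m) / A.wt (s ?n))" .
      have bp: "0 < B.D s r" using b(3) pos mn B.rmin_pos by (smt (verit) mult_pos_pos)
      let ?q = "B.D s t / B.D s r"
      have q0: "0 \<le> ?q" using bp B.D_nonneg st by auto
      have "B.wt (s ?m) / B.wt (s ?n) \<le> (B.D s t / B.rmin) / (B.D s r / B.Csep)"
        using b pos mn B.rmin_pos B.Csep_pos bp B.D_nonneg st by (intro frac_le) (auto simp: field_simps)
      also have "\<dots> = L * ?q" by (simp add: L_def)
      finally have 2: "B.wt (s ?m) / B.wt (s ?n) \<le> L * ?q" .
      have 0: "0 \<le> B.wt (s ?m) / B.wt (s ?n)" using pos mn by (simp add: less_imp_le)
      have p: "(B.wt (s ?m) / B.wt (s ?n)) powr \<gamma> \<le> max (L powr \<alpha>) (L powr \<beta>) * max (?q powr \<alpha>) (?q powr \<beta>)"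
        if "\<gamma> = \<alpha> \<or> \<gamma> = \<beta>" for \<gamma>
      proof -
        have "(B.wt (s ?m) / B.wt (s ?n)) powr \<gamma> \<le> (L * ?q) powr \<gamma>"
          using 0 2 that \<alpha> \<beta> by (intro powr_mono2) auto
        also have "\<dots> = L powr \<gamma> * ?q powr \<gamma>" by (rule powr_mult)
        also have "\<dots> \<le> max (L powr \<alpha>) (L powr \<beta>) * max (?q powr \<alpha>) (?q powr \<beta>)"
          using that by (intro mult_mono) (auto simp: le_max_iff_disj)
        finally show ?thesis .
      qed
      have "A.D s t / A.D s r \<le> K * (max (L powr \<alpha>) (L powr \<beta>) * max (?q powr \<alpha>) (?q powr \<beta>))"
        using 1 ratio[OF st(1) mn(2,1)] p[of \<alpha>] p[of \<beta>] KL(1)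
        by (meson order_trans mult_left_mono less_imp_le max.boundedI)
      then show ?thesis unfolding eq C_def by (simp add: mult.assoc)
    qed
  qed
  have "A.mtopology = B.mtopology"
    unfolding topology_eq
    by (intro allI iffI) (erule weighted_mtopology_le[OF A B], erule weighted_mtopology_le[OF B A])
  then have "homeomorphic_map B.mtopology A.mtopology id" unfolding homeomorphic_map_id .
  then show ?thesis
    unfolding quasisymmetric_def
    using A.Metric_space_axioms B.Metric_space_axioms homeomorphic_map_max_powr[OF C \<alpha> \<beta>] main
    by blast
qed

section \<open>Modulus and potentials\<close>

lemma sum_set_le_sum_list:
  fixes f :: "'a \<Rightarrow> real"
  assumes "\<And>x. x \<in> set xs \<Longrightarrow> 0 \<le> f x"
  shows "sum f (set xs) \<le> sum_list (map f xs)"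
  using assms
proof (induction xs)
  case (Cons x xs)
  then show ?case by (cases "x \<in> set xs") (auto simp: insert_absorb intro: add_increasing)
qed auto

lemma paths_between_snoc:
  assumes p: "(vs, es) \<in> paths_between H A {y}" and e: "e \<in> edges H" "ends H e = {y, z}" "z \<in> verts H"
  shows "(vs @ [z], es @ [e]) \<in> paths_between H A {z}"
proof -
  have vs: "vs \<noteq> []" "length vs = Suc (length es)" "last vs = y"
    using p by (auto simp: paths_between_def is_path_def)
  have y: "y = vs ! length es" using vs by (metis diff_Suc_1 last_conv_nth)
  show ?thesis
    using p e vs y by (auto simp: paths_between_def is_path_def nth_append less_Suc_eq)
qed

text \<open>The bound is uniform in \<open>x\<close>, which makes the modulus Lipschitz in the
  exponent. It rests on \<open>- ln x\<close> times \<open>x\<close> being at most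
  \<open>1 - x\<close>.\<close>

lemma powr_diff_le:
  fixes x p q :: real
  assumes x: "0 \<le> x" "x \<le> 1" and pq: "1 \<le> p" "p \<le> q"
  shows "x powr p - x powr q \<le> q - p"
proof (cases "x = 0")
  case False
  then have x0: "0 < x" using x by simp
  have "x powr p - x powr q = x powr p * (1 - x powr (q - p))"
    by (simp add: algebra_simps powr_add[symmetric])
  also have "\<dots> \<le> x powr p * ((q - p) * (- ln x))"
  proof (rule mult_left_mono)
    show "1 - x powr (q - p) \<le> (q - p) * (- ln x)"
    proof -
      have "x powr (q - p) = exp ((q - p) * ln x)" using x0 by (simp add: powr_def)
      then show ?thesis using exp_ge_add_one_self[of "(q - p) * ln x"] by (simp only:)
    qed
  qed simp
  also have "\<dots> \<le> x * ((q - p) * (- ln x))"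
    using powr_le_one_le[OF x0 x(2) pq(1)] pq x x0
    by (intro mult_right_mono mult_nonneg_nonneg) (auto simp: ln_le_zero_iff)
  also have "\<dots> = (q - p) * (x * (- ln x))" by simp
  also have "\<dots> \<le> (q - p) * 1"
  proof (intro mult_left_mono)
    have "- ln x \<le> 1 / x - 1" using ln_le_minus_one[of "1 / x"] x0 by (simp add: ln_div)
    then have "x * (- ln x) \<le> x * (1 / x - 1)" using x0 by (intro mult_left_mono) auto
    also have "\<dots> = 1 - x" using x0 by (simp add: algebra_simps)
    finally show "x * (- ln x) \<le> 1" using x0 by simp
  qed (use pq in simp)
  finally show ?thesis by simp
qed (use pq in auto)

lemma powr_midpoint:
  fixes x y p :: real
  assumes xy: "0 \<le> x" "0 \<le> y" and p: "1 \<le> p"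
  shows "((x + y) / 2) powr p \<le> (x powr p + y powr p) / 2"
proof -
  have half: "(z / 2) powr p \<le> z powr p / 2" if "0 \<le> z" for z
  proof -
    have "(1 / 2 :: real) powr p \<le> (1 / 2) powr 1" using p by (intro powr_mono') auto
    then have "z powr p * (1 / 2) powr p \<le> z powr p * (1 / 2)" by (intro mult_left_mono) auto
    then show ?thesis using that powr_mult[of z "1 / 2" p] by simp
  qed
  consider "x = 0" | "y = 0" | "0 < x" "0 < y" using xy by linarith
  then show ?thesis
  proof cases
    case 3
    then have "((1 - 1 / 2) *\<^sub>R x + (1 / 2) *\<^sub>R y) powr p \<le> (1 - 1 / 2) * x powr p + (1 / 2) * y powr p"
      by (intro convex_onD[OF powr_convex[OF p]]) auto
    moreover have "(1 - 1 / 2) *\<^sub>R x + (1 / 2) *\<^sub>R y = (x + y) / 2" by simp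
    ultimately show ?thesis by (simp only:) (simp add: field_simps)
  qed (use half xy in auto)
qed

context laakso_igs
begin

definition dif :: "('v \<Rightarrow> real) \<Rightarrow> 'e \<Rightarrow> real" where
  "dif g a = g (l Plus a) - g (l Minus a)"

text \<open>A product of points and intervals, hence compact; values off the vertex set are pinned
  to 0 for this reason.\<close>

definition pots :: "('v \<Rightarrow> real) set" where
  "pots = (\<Pi>\<^sub>E v\<in>UNIV. if v \<in> boundary S Plus then {1}
     else if v \<in> boundary S Minus \<or> v \<notin> V\<^sub>1 then {0} else {0..1})"

definition energy :: "real \<Rightarrow> ('v \<Rightarrow> real) \<Rightarrow> real" where
  "energy p g = (\<Sum>a\<in>E\<^sub>1. \<bar>dif g a\<bar> powr p)"

abbreviation Md where "Md p \<equiv> modulus p (Theta1 S) (gen S)"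

lemma boundary_disj: "boundary S Minus \<inter> boundary S Plus = {}"
  using simple by (simp add: simple_igs_def)

lemma boundary_sub: "boundary S s \<subseteq> V\<^sub>1"
  using \<phi>_in_V by (auto simp: boundary_def)

lemma boundary_ne: "boundary S s \<noteq> {}"
  using I_ne by (auto simp: boundary_def)

lemma pots_iff: "g \<in> pots \<longleftrightarrow> (\<forall>v\<in>V\<^sub>1. 0 \<le> g v \<and> g v \<le> 1) \<and> (\<forall>v\<in>boundary S Minus. g v = 0) \<and>
    (\<forall>v\<in>boundary S Plus. g v = 1) \<and> (\<forall>v. v \<notin> V\<^sub>1 \<longrightarrow> g v = 0)"
proof
  assume g: "g \<in> pots"
  have *: "g v \<in> (if v \<in> boundary S Plus then {1}
     else if v \<in> boundary S Minus \<or> v \<notin> V\<^sub>1 then {0} else {0..1})" for v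
    using PiE_mem[OF g[unfolded pots_def] UNIV_I] .
  show "(\<forall>v\<in>V\<^sub>1. 0 \<le> g v \<and> g v \<le> 1) \<and> (\<forall>v\<in>boundary S Minus. g v = 0) \<and>
    (\<forall>v\<in>boundary S Plus. g v = 1) \<and> (\<forall>v. v \<notin> V\<^sub>1 \<longrightarrow> g v = 0)"
  proof (intro conjI ballI allI impI)
    fix v
    show "v \<in> V\<^sub>1 \<Longrightarrow> 0 \<le> g v" "v \<in> V\<^sub>1 \<Longrightarrow> g v \<le> 1" using *[of v] by (auto split: if_splits)
    show "v \<in> boundary S Minus \<Longrightarrow> g v = 0" "v \<in> boundary S Plus \<Longrightarrow> g v = 1" "v \<notin> V\<^sub>1 \<Longrightarrow> g v = 0"
      using *[of v] boundary_disj boundary_sub[of Plus] by (auto split: if_splits)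
  qed
next
  assume "(\<forall>v\<in>V\<^sub>1. 0 \<le> g v \<and> g v \<le> 1) \<and> (\<forall>v\<in>boundary S Minus. g v = 0) \<and>
    (\<forall>v\<in>boundary S Plus. g v = 1) \<and> (\<forall>v. v \<notin> V\<^sub>1 \<longrightarrow> g v = 0)"
  then show "g \<in> pots" by (auto simp: pots_def)
qed

lemma pots_\<phi>: "g \<in> pots \<Longrightarrow> i \<in> I \<Longrightarrow> g (\<phi> Minus i) = 0" "g \<in> pots \<Longrightarrow> i \<in> I \<Longrightarrow> g (\<phi> Plus i) = 1"
  by (auto simp: pots_iff boundary_def)

lemma abs_dif_le_1: "g \<in> pots \<Longrightarrow> a \<in> E\<^sub>1 \<Longrightarrow> \<bar>dif g a\<bar> \<le> 1"
proof -
  assume g: "g \<in> pots" and a: "a \<in> E\<^sub>1"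
  have "0 \<le> g (l s a) \<and> g (l s a) \<le> 1" for s using g l_in_V[OF a] by (simp add: pots_iff)
  from this[of Plus] this[of Minus] show ?thesis unfolding dif_def by linarith
qed

lemma compact_pots: "compact pots"
proof -
  have "compactin (product_topology (\<lambda>_. euclidean) UNIV) pots"
    unfolding pots_def by (subst compactin_PiE) auto
  then show ?thesis by (simp add: euclidean_product_topology)
qed

definition half_pot where
  "half_pot v = (if v \<in> boundary S Plus then 1 else if v \<in> boundary S Minus \<or> v \<notin> V\<^sub>1 then 0 else 1 / 2 :: real)"

lemma half_pot_in: "half_pot \<in> pots"
  by (auto simp: pots_def half_pot_def)

text \<open>A larger jump would be a unit jump, on an edge joining the two sides.\<close>

lemma half_pot_dif: "a \<in> E\<^sub>1 \<Longrightarrow> \<bar>dif half_pot a\<bar> \<le> 1 / 2"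
proof -
  assume a: "a \<in> E\<^sub>1"
  have "\<not> (l s a \<in> boundary S Minus \<and> l t a \<in> boundary S Plus)" for s t
  proof
    assume *: "l s a \<in> boundary S Minus \<and> l t a \<in> boundary S Plus"
    then obtain i j where ij: "i \<in> I" "j \<in> I" "l s a = \<phi> Minus i" "l t a = \<phi> Plus j" by (auto simp: boundary_def)
    then have "s \<noteq> t" using \<phi>_eq_iff[of i j Minus Plus] by auto
    then show False using not_both_boundary[OF a ij(1,2), of Minus Plus]
        not_both_boundary[OF a ij(2,1), of Plus Minus] ij by (cases s; cases t) auto
  qed
  then show ?thesis using l_in_V[OF a] by (auto simp: dif_def half_pot_def)
qed

lemma energy_attained:
  assumes "0 < p"
  shows "\<exists>g\<in>pots. \<forall>g'\<in>pots. energy p g \<le> energy p g'"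
proof (rule continuous_attains_inf[OF compact_pots])
  show "pots \<noteq> {}" using half_pot_in by blast
  have "continuous_on pots (\<lambda>g :: 'v \<Rightarrow> real. g v)" for v
    by (rule continuous_on_subset[OF continuous_on_product_coordinates]) auto
  then show "continuous_on pots (energy p)"
    unfolding energy_def[abs_def] dif_def using assms
    by (intro continuous_intros continuous_on_powr') auto
qed

lemma pot_chain:
  assumes "F \<subseteq> E\<^sub>1" "(x, y) \<in> (erel (gen S) F)\<^sup>*"
  shows "\<bar>g x - g y\<bar> \<le> (\<Sum>a\<in>F. \<bar>dif g a\<bar>)"
proof (rule chain_le[where C = "\<lambda>a. {a}" and H = "gen S" and w = "\<lambda>a. \<bar>dif g a\<bar>"])
  show "finite F" using finE assms finite_subset by auto
  show "(x, y) \<in> (erel (gen S) (\<Union>a\<in>F. {a}))\<^sup>*" using assms by simp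
  fix a e f p q assume "a \<in> F" "e \<in> {a}" "f \<in> {a}" "p \<in> ends (gen S) e" "q \<in> ends (gen S) f"
  then have "p \<in> {l Minus a, l Plus a}" "q \<in> {l Minus a, l Plus a}" using ends1[of a] assms by auto
  then show "\<bar>g p - g q\<bar> \<le> \<bar>dif g a\<bar>" by (auto simp: dif_def)
qed auto

lemma admissible_dif:
  assumes g: "g \<in> pots"
  shows "admissible (gen S) (Theta1 S) (\<lambda>a. \<bar>dif g a\<bar>)"
  unfolding admissible_def
proof (intro conjI ballI)
  show "(\<lambda>a. \<bar>dif g a\<bar>) \<in> E\<^sub>1 \<rightarrow> {0..1}" using abs_dif_le_1[OF g] by auto
  fix p assume "p \<in> Theta1 S"
  then obtain vs es where p: "p = (vs, es)" "(vs, es) \<in> paths_between (gen S) (boundary S Minus) (boundary S Plus)"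
    by (cases p) (auto simp: Theta1_def)
  have es: "set es \<subseteq> E\<^sub>1" using p by (auto simp: paths_between_def is_path_def)
  note q = paths_between_imp_rtrancl[OF p(2)]
  have "1 = \<bar>g (hd vs) - g (last vs)\<bar>" using g q(1,2) by (auto simp: pots_iff)
  also have "\<dots> \<le> (\<Sum>a\<in>set es. \<bar>dif g a\<bar>)" by (rule pot_chain[OF es q(3)])
  also have "\<dots> \<le> sum_list (map (\<lambda>a. \<bar>dif g a\<bar>) es)" by (intro sum_set_le_sum_list) auto
  finally show "case p of (vs, es) \<Rightarrow> 1 \<le> sum_list (map (\<lambda>a. \<bar>dif g a\<bar>) es)" using p by simp
qed

text \<open>The potential is the distance from \<open>boundary S Minus\<close> in \<rho>-length, cut
  off at 1; admissibility says that it reaches 1 on the other side.\<close>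

lemma admissible_potential:
  assumes adm: "admissible (gen S) (Theta1 S) \<rho>"
  shows "\<exists>g\<in>pots. \<forall>a\<in>E\<^sub>1. \<bar>dif g a\<bar> \<le> \<rho> a"
proof -
  define P where "P v = paths_between (gen S) (boundary S Minus) {v}" for v
  define f where "f v = (INF p\<in>P v. sum_list (map \<rho> (snd p)))" for v
  define g where "g v = (if v \<in> V\<^sub>1 then min 1 (f v) else 0)" for v
  have \<rho>0: "0 \<le> \<rho> a" if "a \<in> E\<^sub>1" for a using adm that by (auto simp: admissible_def)
  have len0: "0 \<le> sum_list (map \<rho> (snd p))" if "p \<in> P v" for p v
    using that \<rho>0 by (intro sum_list_nonneg) (auto simp: P_def paths_between_def is_path_def)
  have bdd: "bdd_below ((\<lambda>p. sum_list (map \<rho> (snd p))) ` P v)" for v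
    using len0 by (intro bdd_belowI[of _ 0]) auto
  have ne: "P v \<noteq> {}" if v: "v \<in> V\<^sub>1" for v
  proof -
    obtain u where u: "u \<in> boundary S Minus" using boundary_ne by blast
    then have "u \<in> V\<^sub>1" using boundary_sub by blast
    then have "paths_between (gen S) {u} {v} \<noteq> {}"
      using simple v unfolding simple_igs_def connected_mgraph_def by blast
    then show ?thesis using u by (auto simp: P_def paths_between_def)
  qed
  have f0: "0 \<le> f v" if "v \<in> V\<^sub>1" for v
    unfolding f_def using ne[OF that] len0 by (intro cINF_greatest) auto
  have fstep: "f z \<le> f y + \<rho> a" if a: "a \<in> E\<^sub>1" "ends (gen S) a = {y, z}" "y \<in> V\<^sub>1" "z \<in> V\<^sub>1" for a y z
  proof -
    have "f z - \<rho> a \<le> sum_list (map \<rho> (snd p))" if p: "p \<in> P y" for p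
    proof -
      have "(fst p @ [z], snd p @ [a]) \<in> P z"
        using p a unfolding P_def by (intro paths_between_snoc) auto
      then have "f z \<le> sum_list (map \<rho> (snd (fst p @ [z], snd p @ [a])))"
        unfolding f_def by (intro cINF_lower[OF bdd])
      then show ?thesis by simp
    qed
    then have "f z - \<rho> a \<le> f y" unfolding f_def using ne[OF a(3)] by (intro cINF_greatest) auto
    then show ?thesis by simp
  qed
  have "g \<in> pots"
    unfolding pots_iff
  proof (intro conjI ballI allI impI)
    fix v
    show "v \<in> V\<^sub>1 \<Longrightarrow> 0 \<le> g v" "v \<in> V\<^sub>1 \<Longrightarrow> g v \<le> 1" "v \<notin> V\<^sub>1 \<Longrightarrow> g v = 0"
      using f0[of v] by (auto simp: g_def)
    show "g v = 0" if v: "v \<in> boundary S Minus"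
    proof -
      have vV: "v \<in> V\<^sub>1" using v boundary_sub by blast
      have "([v], []) \<in> P v" using v vV by (auto simp: P_def paths_between_def is_path_def)
      then have "f v \<le> sum_list (map \<rho> (snd ([v], [])))" unfolding f_def by (intro cINF_lower[OF bdd])
      then show ?thesis using f0[OF vV] vV by (auto simp: g_def)
    qed
    show "g v = 1" if v: "v \<in> boundary S Plus"
    proof -
      have vV: "v \<in> V\<^sub>1" using v boundary_sub by blast
      have "1 \<le> sum_list (map \<rho> (snd p))" if "p \<in> P v" for p
      proof -
        have "p \<in> Theta1 S" using that v by (auto simp: P_def Theta1_def paths_between_def)
        then show ?thesis using adm by (auto simp: admissible_def)
      qed
      then have "1 \<le> f v" unfolding f_def using ne[OF vV] by (intro cINF_greatest) auto
      then show ?thesis using vV by (auto simp: g_def)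
    qed
  qed
  moreover have "\<bar>dif g a\<bar> \<le> \<rho> a" if a: "a \<in> E\<^sub>1" for a
    using fstep[OF a, of "l Minus a" "l Plus a"] fstep[OF a, of "l Plus a" "l Minus a"]
      ends1[OF a] l_in_V[OF a] \<rho>0[OF a] by (auto simp: dif_def g_def insert_commute min_def)
  ultimately show ?thesis by blast
qed

text \<open>Jumps of potentials are admissible and every admissible density dominates such jumps, so
  the modulus is the least energy, attained by compactness.\<close>

lemma modulus_potential:
  assumes p: "0 < p"
  shows "\<exists>g\<in>pots. energy p g = Md p \<and> (\<forall>g'\<in>pots. energy p g \<le> energy p g')"
proof -
  obtain g where g: "g \<in> pots" "\<And>g'. g' \<in> pots \<Longrightarrow> energy p g \<le> energy p g'"
    using energy_attained[OF p] by blast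
  have "Md p = energy p g"
    unfolding modulus_def
  proof (rule cInf_eq_minimum)
    show "energy p g \<in> {\<Sum>e\<in>E\<^sub>1. \<rho> e powr p |\<rho>. admissible (gen S) (Theta1 S) \<rho>}"
      using admissible_dif[OF g(1)] by (auto simp: energy_def)
    fix x assume "x \<in> {\<Sum>e\<in>E\<^sub>1. \<rho> e powr p |\<rho>. admissible (gen S) (Theta1 S) \<rho>}"
    then obtain \<rho> where \<rho>: "admissible (gen S) (Theta1 S) \<rho>" "x = (\<Sum>e\<in>E\<^sub>1. \<rho> e powr p)" by auto
    obtain g' where g': "g' \<in> pots" "\<forall>a\<in>E\<^sub>1. \<bar>dif g' a\<bar> \<le> \<rho> a" using admissible_potential[OF \<rho>(1)] by blast
    have "energy p g \<le> energy p g'" using g g' by auto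
    also have "\<dots> \<le> x" unfolding \<rho> energy_def using g' p by (intro sum_mono powr_mono2) auto
    finally show "energy p g \<le> x" .
  qed
  then show ?thesis using g by metis
qed

lemma Md_le_energy: "0 < p \<Longrightarrow> g \<in> pots \<Longrightarrow> Md p \<le> energy p g"
  using modulus_potential[of p] by auto

section \<open>The modulus as a function of the exponent\<close>

lemma energy_1_ge: "g \<in> pots \<Longrightarrow> 1 \<le> energy 1 g"
proof -
  assume g: "g \<in> pots"
  obtain u v where uv: "u \<in> boundary S Minus" "v \<in> boundary S Plus" using boundary_ne by blast
  then have "(u, v) \<in> (erel (gen S) E\<^sub>1)\<^sup>*" using gen_connected boundary_sub by blast
  from pot_chain[OF order_refl this, of g] show ?thesis using g uv by (auto simp: pots_iff energy_def)
qed

lemma energy_antimono: "g \<in> pots \<Longrightarrow> 0 \<le> p \<Longrightarrow> p \<le> q \<Longrightarrow> energy q g \<le> energy p g"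
  unfolding energy_def by (intro sum_mono powr_mono') (auto intro: abs_dif_le_1)

text \<open>Each bound inserts the minimizer for one exponent into the energy for the other.\<close>

lemma Md_lipschitz:
  fixes p q :: real
  assumes "1 \<le> p" "p \<le> q"
  shows "Md q \<le> Md p" "Md p \<le> Md q + card E\<^sub>1 * (q - p)"
proof -
  obtain g where g: "g \<in> pots" "energy p g = Md p" using modulus_potential[of p] assms by auto
  show "Md q \<le> Md p" using Md_le_energy[of q g] energy_antimono[OF g(1), of p q] g assms by simp
  obtain f where f: "f \<in> pots" "energy q f = Md q" using modulus_potential[of q] assms by auto
  have "energy p f - energy q f = (\<Sum>a\<in>E\<^sub>1. \<bar>dif f a\<bar> powr p - \<bar>dif f a\<bar> powr q)"
    by (simp add: energy_def sum_subtractf)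
  also have "\<dots> \<le> (\<Sum>a\<in>E\<^sub>1. q - p)"
    using abs_dif_le_1[OF f(1)] assms by (intro sum_mono powr_diff_le) auto
  finally show "Md p \<le> Md q + card E\<^sub>1 * (q - p)" using Md_le_energy[of p f] f assms by simp
qed

text \<open>Strict decrease can only fail if the minimizer takes the differences \<open>0\<close> and \<open>1\<close>; then it is
  the indicator of a cut edge, which is improved by mixing in a potential without unit jumps.\<close>

lemma Md_less_1:
  assumes p: "1 \<le> p" "p < q" "Md p \<le> 1"
  shows "Md q < 1"
proof -
  obtain g where g: "g \<in> pots" "energy p g = Md p" using modulus_potential[of p] p by auto
  have d: "0 \<le> \<bar>dif g a\<bar>" "\<bar>dif g a\<bar> \<le> 1" if "a \<in> E\<^sub>1" for a using abs_dif_le_1[OF g(1) that] by auto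
  have le: "\<bar>dif g a\<bar> powr q \<le> \<bar>dif g a\<bar> powr p" if "a \<in> E\<^sub>1" for a
    using d[OF that] p by (intro powr_mono') auto
  show ?thesis
  proof (cases "\<exists>a\<in>E\<^sub>1. 0 < \<bar>dif g a\<bar> \<and> \<bar>dif g a\<bar> < 1")
    case True
    then obtain b where b: "b \<in> E\<^sub>1" "0 < \<bar>dif g b\<bar>" "\<bar>dif g b\<bar> < 1" by blast
    have "\<bar>dif g b\<bar> powr q < \<bar>dif g b\<bar> powr p" by (rule powr_less_mono'[OF b(2,3) p(2)])
    then have "energy q g < energy p g"
      unfolding energy_def using finE le b(1) by (intro sum_strict_mono_ex1) auto
    then show ?thesis using Md_le_energy[of q g] g p by simp
  next
    case False
    then have d01: "\<bar>dif g a\<bar> = 0 \<or> \<bar>dif g a\<bar> = 1" if "a \<in> E\<^sub>1" for a using d[OF that] that by force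
    \<comment> \<open>Jumps of size 0 and 1 do not see the exponent, and the 1-energy of a potential
      is at least 1; so exactly one edge carries a unit jump and all others carry none.\<close>
    have "energy p g = energy 1 g"
      unfolding energy_def using d01 by (intro sum.cong refl) (metis powr_one_eq_one powr_0)
    then have e1: "(\<Sum>a\<in>E\<^sub>1. \<bar>dif g a\<bar>) = 1"
      using energy_1_ge[OF g(1)] g p by (simp add: energy_def)
    then obtain b where b: "b \<in> E\<^sub>1" "\<bar>dif g b\<bar> = 1" using d01 by (metis sum.neutral zero_neq_one)
    have "(\<Sum>a\<in>E\<^sub>1 - {b}. \<bar>dif g a\<bar>) = 0" using sum.remove[OF finE b(1), of "\<lambda>a. \<bar>dif g a\<bar>"] e1 b by simp
    then have z: "\<bar>dif g a\<bar> = 0" if "a \<in> E\<^sub>1" "a \<noteq> b" for a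
      using that finE by (subst (asm) sum_nonneg_eq_0_iff) auto
    define N where "N = real (card E\<^sub>1)"
    have N: "1 \<le> N" unfolding N_def using b finE by (metis One_nat_def Suc_leI card_gt_0_iff empty_iff of_nat_1 of_nat_mono)
    \<comment> \<open>Small enough for \<open>N * \<tau> powr q < \<tau>\<close>, which is possible
      because q > 1: the cut edge gains \<tau>, while every other edge pays at most
      \<open>\<tau> powr q\<close>.\<close>
    define \<tau> where "\<tau> = min (1 / 2) ((1 / (2 * N)) powr (1 / (q - 1)))"
    have \<tau>: "0 < \<tau>" "\<tau> \<le> 1 / 2" using N by (auto simp: \<tau>_def)
    have "\<tau> powr (q - 1) \<le> ((1 / (2 * N)) powr (1 / (q - 1))) powr (q - 1)"
      using \<tau> p by (intro powr_mono2) (auto simp: \<tau>_def)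
    also have "\<dots> = 1 / (2 * N)" using N p by (simp add: powr_powr)
    finally have "N * \<tau> powr (q - 1) \<le> 1 / 2" using N by (simp add: field_simps)
    then have "\<tau> * (N * \<tau> powr (q - 1)) \<le> \<tau> * (1 / 2)" using \<tau> by (intro mult_left_mono) auto
    moreover have "\<tau> * \<tau> powr (q - 1) = \<tau> powr q" using \<tau> by (simp add: powr_mult_base)
    ultimately have N\<tau>: "N * \<tau> powr q < \<tau>" using \<tau> by (simp add: mult.left_commute)
    \<comment> \<open>The coefficient \<open>2 * \<tau>\<close> turns the jumps of
      \<open>half_pot\<close>, at most 1/2, into at most \<tau>.\<close>
    define f where "f v = (1 - 2 * \<tau>) * g v + 2 * \<tau> * half_pot v" for v
    have f: "f \<in> pots"
      unfolding pots_iff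
    proof (intro conjI ballI allI impI)
      have 1: "0 \<le> 1 - 2 * \<tau>" "0 \<le> 2 * \<tau>" using \<tau> by auto
      fix v
      show "0 \<le> f v" if "v \<in> V\<^sub>1"
        using that g(1) half_pot_in 1 by (auto simp: f_def pots_iff)
      show "f v \<le> 1" if "v \<in> V\<^sub>1"
      proof -
        have "f v \<le> (1 - 2 * \<tau>) * 1 + 2 * \<tau> * 1"
          unfolding f_def using that g(1) half_pot_in 1 by (intro add_mono mult_left_mono) (auto simp: pots_iff)
        then show ?thesis by simp
      qed
      show "v \<in> boundary S Minus \<Longrightarrow> f v = 0" "v \<in> boundary S Plus \<Longrightarrow> f v = 1" "v \<notin> V\<^sub>1 \<Longrightarrow> f v = 0"
        using g(1) half_pot_in by (auto simp: f_def pots_iff)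
    qed
    have df: "\<bar>dif f a\<bar> \<le> (1 - 2 * \<tau>) * \<bar>dif g a\<bar> + \<tau>" if a: "a \<in> E\<^sub>1" for a
    proof -
      have "dif f a = (1 - 2 * \<tau>) * dif g a + 2 * \<tau> * dif half_pot a" by (simp add: dif_def f_def algebra_simps)
      then have "\<bar>dif f a\<bar> \<le> \<bar>(1 - 2 * \<tau>) * dif g a\<bar> + \<bar>2 * \<tau> * dif half_pot a\<bar>" by linarith
      also have "\<dots> = (1 - 2 * \<tau>) * \<bar>dif g a\<bar> + 2 * \<tau> * \<bar>dif half_pot a\<bar>" using \<tau> by (simp add: abs_mult)
      also have "2 * \<tau> * \<bar>dif half_pot a\<bar> \<le> 2 * \<tau> * (1 / 2)"
        using half_pot_dif[OF a] \<tau> by (intro mult_left_mono) auto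
      finally show ?thesis by simp
    qed
    have "energy q f = \<bar>dif f b\<bar> powr q + (\<Sum>a\<in>E\<^sub>1 - {b}. \<bar>dif f a\<bar> powr q)"
      unfolding energy_def by (rule sum.remove[OF finE b(1)])
    also have "\<dots> \<le> (1 - \<tau>) + (\<Sum>a\<in>E\<^sub>1 - {b}. \<tau> powr q)"
    proof (intro add_mono sum_mono)
      have "\<bar>dif f b\<bar> powr q \<le> (1 - \<tau>) powr q" using df[OF b(1)] b p by (intro powr_mono2) auto
      also have "\<dots> \<le> 1 - \<tau>" using \<tau> p by (intro powr_le_one_le) auto
      finally show "\<bar>dif f b\<bar> powr q \<le> 1 - \<tau>" .
      fix a assume "a \<in> E\<^sub>1 - {b}"
      then show "\<bar>dif f a\<bar> powr q \<le> \<tau> powr q" using df[of a] z[of a] p by (intro powr_mono2) auto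
    qed
    also have "(\<Sum>a\<in>E\<^sub>1 - {b}. \<tau> powr q) \<le> N * \<tau> powr q"
      using finE b by (auto simp: N_def intro!: mult_right_mono)
    also have "(1 - \<tau>) + N * \<tau> powr q < 1" using N\<tau> by simp
    finally show ?thesis using Md_le_energy[OF _ f, of q] p by simp
  qed
qed

lemma ex1_Md_eq_1: "\<exists>!Q. Q \<ge> 1 \<and> Md Q = 1"
proof -
  have c: "continuous_on {1..P} Md" for P
  proof (rule lipschitz_on_continuous_on)
    show "(real (card E\<^sub>1))-lipschitz_on {1..P} Md"
    proof (rule lipschitz_onI)
      have *: "\<bar>Md p - Md q\<bar> \<le> card E\<^sub>1 * \<bar>p - q\<bar>" if "1 \<le> p" "p \<le> q" for p q :: real
        using Md_lipschitz[OF that] that by simp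
      fix p q assume "p \<in> {1..P}" "q \<in> {1..P}"
      then show "dist (Md p) (Md q) \<le> card E\<^sub>1 * dist p q"
        using *[of p q] *[of q p] by (cases "p \<le> q") (auto simp: dist_real_def abs_minus_commute)
    qed simp
  qed
  have M1: "1 \<le> Md 1" using modulus_potential[of 1] energy_1_ge by force
  define N where "N = real (card E\<^sub>1)"
  have N: "1 \<le> N" unfolding N_def using E1_ne finE
    by (metis One_nat_def Suc_leI card_gt_0_iff of_nat_1 of_nat_mono)
  \<comment> \<open>Then \<open>N * (1 / 2) powr P\<close> equals 1/2, which brings the energy of
    \<open>half_pot\<close> below 1.\<close>
  define P where "P = 1 + log 2 N"
  have P: "1 \<le> P" using N by (simp add: P_def)
  have "Md P \<le> energy P half_pot" using Md_le_energy[OF _ half_pot_in, of P] P by simp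
  also have "\<dots> \<le> (\<Sum>a\<in>E\<^sub>1. (1 / 2) powr P)"
    unfolding energy_def using half_pot_dif P by (intro sum_mono powr_mono2) auto
  also have "\<dots> = N * (1 / 2) powr P" by (simp add: N_def)
  also have "(1 / 2 :: real) powr P = 1 / (2 * N)" using N by (simp add: P_def powr_divide powr_add)
  also have "N * \<dots> \<le> 1" using N by simp
  finally have MP: "Md P \<le> 1" .
  obtain Q where Q: "1 \<le> Q" "Md Q = 1" using IVT2'[of Md P 1 1] MP M1 P c by auto
  show ?thesis
  proof (rule ex1I[of _ Q])
    fix R assume R: "R \<ge> 1 \<and> Md R = 1"
    show "R = Q" using Md_less_1[of Q R] Md_less_1[of R Q] Q R by (cases R Q rule: linorder_cases) auto
  qed (use Q in auto)
qed

subsection \<open>Symmetric minimizers\<close>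

definition sympot where
  "sympot g \<longleftrightarrow> g \<in> pots \<and> (\<forall>i\<in>I. \<forall>u v. \<bar>dif g (da u i)\<bar> = \<bar>dif g (da v i)\<bar>)"

text \<open>Averaging a minimizer with its reflection \<open>1 - g (\<eta> v)\<close> keeps it
  minimal by convexity. The isomorphism exchanges the two boundary edges of an index, and on them
  the average has equal jumps up to sign.\<close>

lemma symmetric_minimizer:
  assumes p: "1 \<le> p"
  shows "\<exists>g. sympot g \<and> energy p g = Md p"
proof -
  obtain \<eta> \<epsilon> where \<eta>: "bij_betw \<eta> V\<^sub>1 V\<^sub>1" and \<epsilon>: "bij_betw \<epsilon> E\<^sub>1 E\<^sub>1"
    and ee: "\<And>a. a \<in> E\<^sub>1 \<Longrightarrow> ends (gen S) (\<epsilon> a) = \<eta> ` ends (gen S) a"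
    and \<eta>\<phi>: "\<And>i. i \<in> I \<Longrightarrow> \<eta> (\<phi> Minus i) = \<phi> Plus i \<and> \<eta> (\<phi> Plus i) = \<phi> Minus i"
    using symmetric unfolding symmetric_igs_def mgraph_iso_def by blast
  have \<eta>V: "\<eta> v \<in> V\<^sub>1" if "v \<in> V\<^sub>1" for v using \<eta> that by (auto simp: bij_betw_def)
  have \<epsilon>E: "\<epsilon> a \<in> E\<^sub>1" if "a \<in> E\<^sub>1" for a using \<epsilon> that by (auto simp: bij_betw_def)
  obtain g where g: "g \<in> pots" "energy p g = Md p" using modulus_potential[of p] p by auto
  define f where "f v = (if v \<in> V\<^sub>1 then (g v + 1 - g (\<eta> v)) / 2 else 0)" for v
  have f: "f \<in> pots"
    unfolding pots_iff
  proof (intro conjI ballI allI impI)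
    fix v
    have g01: "0 \<le> g w" "g w \<le> 1" if "w \<in> V\<^sub>1" for w using g(1) that by (auto simp: pots_iff)
    show "v \<in> V\<^sub>1 \<Longrightarrow> 0 \<le> f v" "v \<in> V\<^sub>1 \<Longrightarrow> f v \<le> 1" "v \<notin> V\<^sub>1 \<Longrightarrow> f v = 0"
      using g01[of v] g01[of "\<eta> v"] \<eta>V[of v] by (auto simp: f_def)
    show "f v = 0" if "v \<in> boundary S Minus"
      using that boundary_sub[of Minus] \<eta>\<phi> pots_\<phi>[OF g(1)] by (auto simp: f_def boundary_def)
    show "f v = 1" if "v \<in> boundary S Plus"
      using that boundary_sub[of Plus] \<eta>\<phi> pots_\<phi>[OF g(1)] by (auto simp: f_def boundary_def)
  qed
  have end_eq: "{l Minus (\<epsilon> a), l Plus (\<epsilon> a)} = {\<eta> (l Minus a), \<eta> (l Plus a)}" if "a \<in> E\<^sub>1" for a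
    using ee[OF that] ends1[OF that] ends1[OF \<epsilon>E[OF that]] by simp
  \<comment> \<open>An isomorphism may exchange the labels of an edge, so jumps are transported only
    up to sign.\<close>
  have absd: "\<bar>dif k (\<epsilon> a)\<bar> = \<bar>k (\<eta> (l Plus a)) - k (\<eta> (l Minus a))\<bar>" if "a \<in> E\<^sub>1" for k a
    using end_eq[OF that] by (auto simp: dif_def doubleton_eq_iff)
  have "energy p f \<le> (\<Sum>a\<in>E\<^sub>1. (\<bar>dif g a\<bar> powr p + \<bar>dif g (\<epsilon> a)\<bar> powr p) / 2)"
    unfolding energy_def
  proof (rule sum_mono)
    fix a assume a: "a \<in> E\<^sub>1"
    have "\<bar>dif f a\<bar> \<le> (\<bar>dif g a\<bar> + \<bar>dif g (\<epsilon> a)\<bar>) / 2"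
    proof -
      have "dif f a = (dif g a - (g (\<eta> (l Plus a)) - g (\<eta> (l Minus a)))) / 2"
        using l_in_V[OF a] by (simp add: dif_def f_def field_simps)
      then have "\<bar>dif f a\<bar> = \<bar>dif g a - (g (\<eta> (l Plus a)) - g (\<eta> (l Minus a)))\<bar> / 2" by simp
      then show ?thesis unfolding absd[OF a]
        using abs_triangle_ineq4[of "dif g a" "g (\<eta> (l Plus a)) - g (\<eta> (l Minus a))"] by simp
    qed
    then have "\<bar>dif f a\<bar> powr p \<le> ((\<bar>dif g a\<bar> + \<bar>dif g (\<epsilon> a)\<bar>) / 2) powr p" using p by (intro powr_mono2) auto
    also have "\<dots> \<le> (\<bar>dif g a\<bar> powr p + \<bar>dif g (\<epsilon> a)\<bar> powr p) / 2" using p by (intro powr_midpoint) auto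
    finally show "\<bar>dif f a\<bar> powr p \<le> (\<bar>dif g a\<bar> powr p + \<bar>dif g (\<epsilon> a)\<bar> powr p) / 2" .
  qed
  also have "\<dots> = (energy p g + (\<Sum>a\<in>E\<^sub>1. \<bar>dif g (\<epsilon> a)\<bar> powr p)) / 2"
    by (simp add: energy_def sum.distrib sum_divide_distrib[symmetric])
  also have "(\<Sum>a\<in>E\<^sub>1. \<bar>dif g (\<epsilon> a)\<bar> powr p) = energy p g"
    unfolding energy_def by (rule sum.reindex_bij_betw[OF \<epsilon>])
  finally have "energy p f = Md p" using Md_le_energy[OF _ f, of p] g p by simp
  moreover have "\<bar>dif f (da Minus i)\<bar> = \<bar>dif f (da Plus i)\<bar>" if i: "i \<in> I" for i
  proof -
    let ?a = "da Minus i" and ?b = "da Plus i"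
    have aE: "?a \<in> E\<^sub>1" "?b \<in> E\<^sub>1" using da_in[OF i] by auto
    have flip: "\<exists>t. \<epsilon> a \<in> E\<^sub>1 \<and> l t (\<epsilon> a) = \<eta> (l s a)" if "a \<in> E\<^sub>1" for s a
    proof -
      have "\<eta> (l s a) \<in> {\<eta> (l Minus a), \<eta> (l Plus a)}" by (cases s) auto
      then have "\<eta> (l s a) \<in> {l Minus (\<epsilon> a), l Plus (\<epsilon> a)}" using end_eq[OF that] by simp
      then show ?thesis using \<epsilon>E[OF that] by (metis empty_iff insert_iff)
    qed
    have \<epsilon>ab: "\<epsilon> ?a = ?b"
    proof -
      obtain t where "l t (\<epsilon> ?a) = \<eta> (l (ds Minus i) ?a)" using flip[OF aE(1)] by blast
      then show ?thesis using dart_unique[OF i, of "\<epsilon> ?a" t Plus] \<epsilon>E[OF aE(1)] l_dart[OF i] \<eta>\<phi>[OF i] by auto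
    qed
    have \<epsilon>ba: "\<epsilon> ?b = ?a"
    proof -
      obtain t where "l t (\<epsilon> ?b) = \<eta> (l (ds Plus i) ?b)" using flip[OF aE(2)] by blast
      then show ?thesis using dart_unique[OF i, of "\<epsilon> ?b" t Minus] \<epsilon>E[OF aE(2)] l_dart[OF i] \<eta>\<phi>[OF i] by auto
    qed
    text \<open>The map \<open>\<eta>\<close> need not be an involution, but its square fixes both ends of these edges.\<close>
    have inv: "\<eta> (\<eta> (l s ?a)) = l s ?a" for s
    proof -
      let ?\<eta>2 = "\<lambda>v. \<eta> (\<eta> v)"
      have "?\<eta>2 ` {l Minus ?a, l Plus ?a} = {l Minus ?a, l Plus ?a}"
        using end_eq[OF aE(1)] end_eq[OF aE(2)] \<epsilon>ab \<epsilon>ba by (metis (no_types) image_empty image_insert)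
      moreover have "?\<eta>2 (l (ds Minus i) ?a) = l (ds Minus i) ?a" using l_dart[OF i] \<eta>\<phi>[OF i] by simp
      ultimately show ?thesis
        using l_neq[OF aE(1)] by (cases s; cases "ds Minus i") (auto simp: doubleton_eq_iff)
    qed
    have "\<bar>dif f ?b\<bar> = \<bar>f (\<eta> (l Plus ?a)) - f (\<eta> (l Minus ?a))\<bar>" using absd[OF aE(1), of f] \<epsilon>ab by simp
    also have "\<dots> = \<bar>dif f ?a\<bar>"
      using inv l_in_V[OF aE(1)] \<eta>V by (simp add: f_def dif_def) (simp add: abs_minus_commute field_simps)
    finally show ?thesis by simp
  qed
  then have "\<bar>dif f (da u i)\<bar> = \<bar>dif f (da v i)\<bar>" if "i \<in> I" for u v i
    using that by (cases u; cases v) auto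
  ultimately show ?thesis using f by (auto simp: sympot_def)
qed

subsection \<open>Weights from potentials\<close>

text \<open>Supplies a second edge, which later keeps each normalized weight strictly below
  1.\<close>

lemma E1_two: "i \<in> I \<Longrightarrow> da Minus i \<noteq> da Plus i"
proof
  assume i: "i \<in> I" and eq: "da Minus i = da Plus i"
  have a: "da Minus i \<in> E\<^sub>1" using da_in[OF i] .
  have "l (ds Minus i) (da Minus i) = \<phi> Minus i" "l (ds Plus i) (da Minus i) = \<phi> Plus i"
    using l_dart[OF i, of Minus] l_dart[OF i, of Plus] eq by auto
  then show False
    using not_both_boundary[OF a i i, of Minus Plus] not_both_boundary[OF a i i, of Plus Minus] \<phi>_eq_iff[OF i i, of Minus Plus]
    by (cases "ds Minus i"; cases "ds Plus i") auto
qed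

lemma weighted_igs_of_potential:
  assumes "g \<in> pots" "\<And>a. a \<in> E\<^sub>1 \<Longrightarrow> 0 < \<rho> a" "\<And>a. a \<in> E\<^sub>1 \<Longrightarrow> \<rho> a < 1"
    "\<And>a. a \<in> E\<^sub>1 \<Longrightarrow> \<bar>dif g a\<bar> \<le> \<rho> a" "\<And>i u v. i \<in> I \<Longrightarrow> \<rho> (da u i) = \<rho> (da v i)"
  shows "weighted_igs S \<rho> g"
proof
  fix a b i s t u v
  assume *: "a \<in> E\<^sub>1" "b \<in> E\<^sub>1" "i \<in> I" "l s a = \<phi> u i" "l t b = \<phi> v i"
  then have "a = da u i" "b = da v i" using dart_unique by auto
  then show "\<rho> a = \<rho> b" using assms(5) *(3) by auto
qed (use assms pots_\<phi> in \<open>auto simp: pots_iff dif_def\<close>)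

text \<open>A small shift \<delta> makes all weights positive while the sum of powers stays below 1;
  normalizing then scales by a factor at least 1, so the weights still dominate the jumps of
  \<open>g\<close>.\<close>

lemma weighted_igs_above_Q:
  assumes Q: "1 \<le> Q" "Md Q < 1"
  shows "\<exists>\<rho> g. weighted_igs S \<rho> g \<and> (\<Sum>a\<in>E\<^sub>1. \<rho> a powr Q) = 1"
proof -
  obtain g where g: "sympot g" "energy Q g = Md Q" using symmetric_minimizer[OF Q(1)] by blast
  let ?F = "\<lambda>\<delta>. \<Sum>a\<in>E\<^sub>1. (\<bar>dif g a\<bar> + \<delta>) powr Q"
  have "(?F \<longlongrightarrow> (\<Sum>a\<in>E\<^sub>1. (\<bar>dif g a\<bar> + 0) powr Q)) (at_right 0)"
  proof (rule tendsto_sum)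
    fix a assume "a \<in> E\<^sub>1"
    have "\<forall>\<^sub>F \<delta> in at_right 0. 0 \<le> \<bar>dif g a\<bar> + \<delta>"
      by (rule eventually_mono[OF eventually_at_right_less[of 0]]) auto
    then show "((\<lambda>\<delta>. (\<bar>dif g a\<bar> + \<delta>) powr Q) \<longlongrightarrow> (\<bar>dif g a\<bar> + 0) powr Q) (at_right 0)"
      using Q by (intro tendsto_powr' tendsto_intros) auto
  qed
  then have "(?F \<longlongrightarrow> Md Q) (at_right 0)" using g(2) by (simp add: energy_def)
  then have "\<forall>\<^sub>F \<delta> in at_right 0. ?F \<delta> < 1" using Q(2) by (rule order_tendstoD)
  then have "\<forall>\<^sub>F \<delta> in at_right 0. ?F \<delta> < 1 \<and> 0 < \<delta>"
    using eventually_at_right_less[of "0::real"] by (rule eventually_conj)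
  then obtain \<delta> where \<delta>: "?F \<delta> < 1" "0 < \<delta>"
    using eventually_happens'[OF trivial_limit_at_right_real] by blast
  have Fpos: "0 < ?F \<delta>" using E1_ne finE \<delta> by (intro sum_pos) (auto simp: add_nonneg_pos)
  define c where "c = (?F \<delta>) powr (- 1 / Q)"
  have c: "1 \<le> c"
  proof -
    have "(1::real) powr (- 1 / Q) \<le> c" unfolding c_def using Q \<delta> Fpos by (intro powr_mono2') auto
    then show ?thesis by simp
  qed
  define \<rho> where "\<rho> a = c * (\<bar>dif g a\<bar> + \<delta>)" for a
  have pos: "0 < \<rho> a" for a using c \<delta> by (auto simp: \<rho>_def intro!: mult_pos_pos add_nonneg_pos)
  have "(\<Sum>a\<in>E\<^sub>1. \<rho> a powr Q) = c powr Q * ?F \<delta>"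
    using c \<delta> by (simp add: \<rho>_def powr_mult sum_distrib_left)
  also have "c powr Q = 1 / ?F \<delta>" using Q Fpos by (simp add: c_def powr_powr powr_neg_one del: powr_minus_divide)
  finally have sum1: "(\<Sum>a\<in>E\<^sub>1. \<rho> a powr Q) = 1" using Fpos by simp
  have "\<rho> a < 1" if a: "a \<in> E\<^sub>1" for a
  proof -
    obtain i where i: "i \<in> I" using I_ne by auto
    then have "da Minus i \<in> E\<^sub>1" "da Plus i \<in> E\<^sub>1" "da Minus i \<noteq> da Plus i" using da_in E1_two by auto
    then obtain b where b: "b \<in> E\<^sub>1" "b \<noteq> a" by metis
    have "\<rho> b powr Q \<le> (\<Sum>a\<in>E\<^sub>1 - {a}. \<rho> a powr Q)"
      using b finE by (intro member_le_sum) auto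
    moreover have "0 < \<rho> b powr Q" using pos[of b] by simp
    ultimately have "\<rho> a powr Q < 1" using sum.remove[OF finE a, of "\<lambda>a. \<rho> a powr Q"] sum1 by linarith
    then show ?thesis using Q powr_mono2[of Q 1 "\<rho> a"] by force
  qed
  moreover have "\<bar>dif g a\<bar> \<le> \<rho> a" for a
  proof -
    have "1 * (\<bar>dif g a\<bar> + \<delta>) \<le> \<rho> a" unfolding \<rho>_def using c \<delta> by (intro mult_right_mono) auto
    then show ?thesis using \<delta> by simp
  qed
  moreover have "\<rho> (da u i) = \<rho> (da v i)" if "i \<in> I" for u v i
  proof -
    have "\<bar>dif g (da u i)\<bar> = \<bar>dif g (da v i)\<bar>" using g(1) that unfolding sympot_def by blast
    then show ?thesis by (simp add: \<rho>_def)
  qed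
  ultimately have "weighted_igs S \<rho> g"
    using g pos by (intro weighted_igs_of_potential) (auto simp: sympot_def)
  then show ?thesis using sum1 by blast
qed

text \<open>A crossing has at least two edges by non-degeneracy, so the constant is below 1; it is
  admissible because every crossing has at least \<open>Lstar S\<close> edges.\<close>

lemma weighted_igs_Lstar: "\<exists>g. weighted_igs S (\<lambda>_. inverse (real (Lstar S))) g"
proof -
  let ?D = "{path_dist (gen S) v w | v w. v \<in> boundary S Minus \<and> w \<in> boundary S Plus}"
  have fin: "finite ?D"
  proof -
    have "?D = (\<lambda>(v, w). path_dist (gen S) v w) ` (boundary S Minus \<times> boundary S Plus)" by auto
    then show ?thesis using finI by (simp add: boundary_def)
  qed
  have ne: "?D \<noteq> {}" using boundary_ne[of Minus] boundary_ne[of Plus] by blast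
  have pd: "path_dist (gen S) v w \<ge> 2" if vw: "v \<in> boundary S Minus" "w \<in> boundary S Plus" for v w
  proof -
    have "v \<in> V\<^sub>1" "w \<in> V\<^sub>1" using vw boundary_sub by auto
    then have "paths_between (gen S) {v} {w} \<noteq> {}"
      using simple unfolding simple_igs_def connected_mgraph_def by blast
    then have "\<exists>k. \<exists>(vs, es)\<in>paths_between (gen S) {v} {w}. length es = k" by auto
    from LeastI_ex[OF this] obtain vs es where p: "(vs, es) \<in> paths_between (gen S) {v} {w}"
      "length es = path_dist (gen S) v w" unfolding path_dist_def[symmetric] by auto
    have len: "length vs = Suc (length es)" "hd vs = v" "last vs = w"
      using p by (auto simp: paths_between_def is_path_def)
    consider "length es = 0" | "length es = 1" | "length es \<ge> 2" by linarith
    then show ?thesis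
    proof cases
      case 1
      then have "v = w" using len by (cases vs) auto
      then show ?thesis using vw boundary_disj by blast
    next
      case 2
      then obtain a x y where "es = [a]" "vs = [x, y]"
        using len(1) by (auto simp: length_Suc_conv numeral_2_eq_2)
      then have "a \<in> E\<^sub>1" "ends (gen S) a = {v, w}" using p len by (auto simp: paths_between_def is_path_def)
      then show ?thesis using nondegenerate vw unfolding nondegenerate_igs_def by blast
    next
      case 3
      then show ?thesis using p by simp
    qed
  qed
  have L2: "Lstar S \<ge> 2" unfolding Lstar_def using fin ne pd by (subst Min_ge_iff) auto
  define c where "c = inverse (real (Lstar S))"
  have c: "0 < c" "c < 1" using L2 by (auto simp: c_def field_simps)
  have "admissible (gen S) (Theta1 S) (\<lambda>_. c)"
    unfolding admissible_def
  proof (intro conjI ballI)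
    show "(\<lambda>_. c) \<in> E\<^sub>1 \<rightarrow> {0..1}" using c by auto
    fix p assume "p \<in> Theta1 S"
    then obtain vs es where p: "p = (vs, es)" "(vs, es) \<in> paths_between (gen S) (boundary S Minus) (boundary S Plus)"
      by (cases p) (auto simp: Theta1_def)
    then have "(vs, es) \<in> paths_between (gen S) {hd vs} {last vs}" "hd vs \<in> boundary S Minus" "last vs \<in> boundary S Plus"
      by (auto simp: paths_between_def)
    then have "path_dist (gen S) (hd vs) (last vs) \<le> length es"
      unfolding path_dist_def by (intro Least_le) auto
    moreover have "Lstar S \<le> path_dist (gen S) (hd vs) (last vs)"
      unfolding Lstar_def using fin \<open>hd vs \<in> boundary S Minus\<close> \<open>last vs \<in> boundary S Plus\<close>
      by (intro Min_le) auto
    ultimately have "real (Lstar S) * c \<le> length es * c" using c by (intro mult_right_mono) auto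
    moreover have "real (Lstar S) * c = 1" using L2 by (simp add: c_def)
    ultimately show "case p of (vs, es) \<Rightarrow> 1 \<le> sum_list (map (\<lambda>_. c) es)"
      using p by (simp add: map_replicate_const sum_list_replicate)
  qed
  then obtain g where "g \<in> pots" "\<forall>a\<in>E\<^sub>1. \<bar>dif g a\<bar> \<le> c" using admissible_potential by blast
  then show ?thesis unfolding c_def[symmetric] using c by (intro exI[of _ g] weighted_igs_of_potential) auto
qed

end

section \<open>Finite Borel measures on compact metric spaces\<close>

text \<open>The sets that can be squeezed between closed and open sets up to small measure form a
  \<sigma>-algebra, and open sets qualify because in a metrizable space they are increasing unions
  of closed sets.\<close>

lemma finite_borel_regular:
  assumes met: "metrizable_space T" and fin: "finite_measure \<mu>" and sp: "space \<mu> = topspace T"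
    and se: "sets \<mu> = sigma_sets (topspace T) {U. openin T U}"
    and A: "A \<in> sets \<mu>" and e: "0 < e"
  shows "\<exists>C U. closedin T C \<and> openin T U \<and> C \<subseteq> A \<and> A \<subseteq> U \<and> measure \<mu> (U - C) < e"
proof -
  interpret finite_measure \<mu> by fact
  have op: "U \<in> sets \<mu>" if "openin T U" for U using that se by auto
  have cl: "C \<in> sets \<mu>" if "closedin T C" for C
  proof -
    have "topspace T - C \<in> sets \<mu>" using that by (intro op) (auto simp: closedin_def)
    then have "space \<mu> - (topspace T - C) \<in> sets \<mu>" by auto
    moreover have "space \<mu> - (topspace T - C) = C" using closedin_subset[OF that] sp by auto
    ultimately show ?thesis by simp
  qed
  have "A \<in> sigma_sets (topspace T) {U. openin T U}" using A se by simp
  then show ?thesis using e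
  proof (induction arbitrary: e rule: sigma_sets.induct)
    case (Basic A)
    then have A: "openin T A" by simp
    obtain C where C: "\<And>n::nat. closedin T (C n)" "\<And>n. C n \<subseteq> C (Suc n)" "\<Union>(range C) = A"
      using open_imp_fsigma_in[OF met A] unfolding fsigma_in_ascending by blast
    have "(\<lambda>i. measure \<mu> (C i)) \<longlonglongrightarrow> measure \<mu> (\<Union>i. C i)"
      using C cl by (intro finite_Lim_measure_incseq) (auto intro: incseq_SucI)
    then have "\<forall>\<^sub>F i in sequentially. measure \<mu> A - e < measure \<mu> (C i)"
      using C(3) Basic.prems by (intro order_tendstoD(1)) auto
    then obtain i where i: "measure \<mu> A - e < measure \<mu> (C i)" by (auto dest: eventually_happens)
    have sub: "C i \<subseteq> A" using C(3) by auto
    have "measure \<mu> (A - C i) = measure \<mu> A - measure \<mu> (C i)"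
      using sub by (intro finite_measure_Diff op cl A C)
    then have "measure \<mu> (A - C i) < e" using i by simp
    then show ?case using A C(1)[of i] sub by blast
  next
    case Empty
    show ?case by (rule exI[of _ "{}"], rule exI[of _ "{}"]) (use Empty in simp)
  next
    case (Compl A)
    obtain C U where CU: "closedin T C" "openin T U" "C \<subseteq> A" "A \<subseteq> U" "measure \<mu> (U - C) < e"
      using Compl.IH[OF Compl.prems] by blast
    have "(topspace T - C) - (topspace T - U) = U - C" using openin_subset[OF CU(2)] by auto
    then have "measure \<mu> ((topspace T - C) - (topspace T - U)) < e" using CU(5) by simp
    moreover have "closedin T (topspace T - U)" "openin T (topspace T - C)" using CU by auto
    moreover have "topspace T - U \<subseteq> topspace T - A" "topspace T - A \<subseteq> topspace T - C" using CU by auto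
    ultimately show ?case by blast
  next
    case (Union A)
    \<comment> \<open>Half of the error is shared out geometrically among the sets; the other half
      pays for replacing the infinite union of closed sets, which need not be closed, by a finite
      one.\<close>
    have "\<exists>C U. closedin T C \<and> openin T U \<and> C \<subseteq> A i \<and> A i \<subseteq> U \<and> measure \<mu> (U - C) < e / 2 * (1 / 2) ^ Suc i" for i
      using Union.IH[of "e / 2 * (1 / 2) ^ Suc i" i] Union.prems by simp
    then obtain C U where CU: "\<And>i. closedin T (C i)" "\<And>i. openin T (U i)" "\<And>i. C i \<subseteq> A i" "\<And>i. A i \<subseteq> U i"
      "\<And>i. measure \<mu> (U i - C i) < e / 2 * (1 / 2) ^ Suc i" by metis
    let ?C = "\<lambda>n. \<Union>i<n. C i" and ?U = "\<Union>i. U i"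
    have Cs: "?C n \<in> sets \<mu>" for n using CU cl by auto
    have Us: "?U \<in> sets \<mu>" using CU op by auto
    have sums: "(\<lambda>i. e / 2 * (1 / 2 :: real) ^ Suc i) sums (e / 2)"
      using sums_mult[OF power_half_series, of "e / 2"] by simp
    have sm: "summable (\<lambda>i. measure \<mu> (U i - C i))"
      by (rule summable_comparison_test'[OF sums_summable[OF sums], of 0]) (use CU(5) in \<open>auto intro: less_imp_le\<close>)
    have "measure \<mu> (?U - (\<Union>i. C i)) \<le> measure \<mu> (\<Union>i. U i - C i)"
      using CU op cl by (intro finite_measure_mono) auto
    also have "\<dots> \<le> (\<Sum>i. measure \<mu> (U i - C i))"
      using CU op cl sm by (intro finite_measure_subadditive_countably) auto
    also have "\<dots> \<le> (\<Sum>i. e / 2 * (1 / 2) ^ Suc i)"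
      using CU(5) by (intro suminf_le sm sums_summable[OF sums]) (auto intro: less_imp_le)
    also have "\<dots> = e / 2" using sums by (rule sums_unique[symmetric])
    finally have 1: "measure \<mu> (?U - (\<Union>i. C i)) \<le> e / 2" .
    have "(\<lambda>n. measure \<mu> (?C n)) \<longlonglongrightarrow> measure \<mu> (\<Union>n. ?C n)"
      using Cs by (intro finite_Lim_measure_incseq) (auto simp: incseq_def intro!: bexI)
    moreover have Un: "(\<Union>n. ?C n) = (\<Union>i. C i)" by auto
    ultimately have "\<forall>\<^sub>F n in sequentially. measure \<mu> (\<Union>i. C i) - e / 2 < measure \<mu> (?C n)"
      using Union.prems by (intro order_tendstoD(1)) auto
    then obtain n where n: "measure \<mu> (\<Union>i. C i) - e / 2 < measure \<mu> (?C n)" by (auto dest: eventually_happens)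
    have Call: "(\<Union>i. C i) \<in> sets \<mu>" using CU(1) cl by auto
    have CU': "C i \<subseteq> U i" for i using CU(3,4)[of i] by (rule order_trans)
    have Csub: "(\<Union>i. C i) \<subseteq> ?U" using CU' by (intro UN_mono) auto
    have Cnsub: "?C n \<subseteq> ?U" using CU' by (intro UN_mono) auto
    have "measure \<mu> (?U - ?C n) = measure \<mu> ?U - measure \<mu> (?C n)"
      by (intro finite_measure_Diff Us Cs Cnsub)
    moreover have "measure \<mu> (?U - (\<Union>i. C i)) = measure \<mu> ?U - measure \<mu> (\<Union>i. C i)"
      by (intro finite_measure_Diff Us Call Csub)
    ultimately have "measure \<mu> (?U - ?C n) < e" using 1 n by linarith
    moreover have "closedin T (?C n)" using CU by (intro closedin_Union) auto
    moreover have "openin T ?U" using CU by (intro openin_Union) auto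
    moreover have "?C n \<subseteq> (\<Union>i. A i)" using CU(3) by (intro UN_mono) auto
    moreover have "(\<Union>i. A i) \<subseteq> ?U" using CU(4) by (intro UN_mono) auto
    ultimately show ?case by (intro exI[of _ "?C n"] exI[of _ ?U] conjI)
  qed
qed

text \<open>Closed sets are compact here, so approximation by closed sets from inside is already
  inner regularity.\<close>

lemma radon_measure_compact_metrizable:
  assumes met: "metrizable_space T" and cpt: "compact_space T"
    and fin: "finite_measure \<mu>" and sp: "space \<mu> = topspace T"
    and se: "sets \<mu> = sigma_sets (topspace T) {U. openin T U}"
  shows "radon_measure T \<mu>"
proof -
  interpret finite_measure \<mu> by fact
  have op: "U \<in> sets \<mu>" if "openin T U" for U using that se by auto
  have cl: "C \<in> sets \<mu>" if "closedin T C" for C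
  proof -
    have "topspace T - C \<in> sets \<mu>" using that by (intro op) (auto simp: closedin_def)
    then have "space \<mu> - (topspace T - C) \<in> sets \<mu>" by auto
    moreover have "space \<mu> - (topspace T - C) = C" using closedin_subset[OF that] sp by auto
    ultimately show ?thesis by simp
  qed
  have approx: "\<exists>C U. closedin T C \<and> openin T U \<and> C \<subseteq> A \<and> A \<subseteq> U \<and> emeasure \<mu> U \<le> emeasure \<mu> C + ennreal e"
    if A: "A \<in> sets \<mu>" and e: "0 < e" for A e
  proof -
    obtain C U where CU: "closedin T C" "openin T U" "C \<subseteq> A" "A \<subseteq> U" "measure \<mu> (U - C) < e"
      using finite_borel_regular[OF met fin sp se A e] by blast
    have "measure \<mu> (U - C) = measure \<mu> U - measure \<mu> C"
      using CU by (intro finite_measure_Diff op cl) auto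
    then have "measure \<mu> U \<le> measure \<mu> C + e" using CU(5) by simp
    then have "emeasure \<mu> U \<le> emeasure \<mu> C + ennreal e"
      using e by (simp add: emeasure_eq_measure ennreal_plus[symmetric] del: ennreal_plus)
    then show ?thesis using CU by blast
  qed
  show ?thesis
    unfolding radon_measure_def
  proof (intro conjI allI impI ballI sp se)
    show "emeasure \<mu> K < \<infinity>" for K using emeasure_finite[of K] by (simp add: less_top[symmetric])
  next
    fix A assume A: "A \<in> sets \<mu>"
    show "emeasure \<mu> A = (INF U\<in>{U. openin T U \<and> A \<subseteq> U}. emeasure \<mu> U)"
    proof (rule antisym)
      show "emeasure \<mu> A \<le> (INF U\<in>{U. openin T U \<and> A \<subseteq> U}. emeasure \<mu> U)"
        using op by (intro INF_greatest emeasure_mono) auto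
      show "(INF U\<in>{U. openin T U \<and> A \<subseteq> U}. emeasure \<mu> U) \<le> emeasure \<mu> A"
      proof (rule ennreal_le_epsilon)
        fix e :: real assume e: "0 < e"
        obtain C U where CU: "openin T U" "C \<subseteq> A" "A \<subseteq> U" "emeasure \<mu> U \<le> emeasure \<mu> C + ennreal e"
          using approx[OF A e] by auto
        have "(INF U\<in>{U. openin T U \<and> A \<subseteq> U}. emeasure \<mu> U) \<le> emeasure \<mu> U"
          using CU by (intro INF_lower) auto
        also have "\<dots> \<le> emeasure \<mu> C + ennreal e" using CU by simp
        also have "\<dots> \<le> emeasure \<mu> A + ennreal e" using CU A by (intro add_mono emeasure_mono) auto
        finally show "(INF U\<in>{U. openin T U \<and> A \<subseteq> U}. emeasure \<mu> U) \<le> emeasure \<mu> A + ennreal e" .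
      qed
    qed
  next
    fix U assume U: "openin T U"
    show "emeasure \<mu> U = (SUP K\<in>{K. compactin T K \<and> K \<subseteq> U}. emeasure \<mu> K)"
    proof (rule antisym)
      show "(SUP K\<in>{K. compactin T K \<and> K \<subseteq> U}. emeasure \<mu> K) \<le> emeasure \<mu> U"
        using op[OF U] by (intro SUP_least emeasure_mono) auto
      show "emeasure \<mu> U \<le> (SUP K\<in>{K. compactin T K \<and> K \<subseteq> U}. emeasure \<mu> K)"
      proof (rule ennreal_le_epsilon)
        fix e :: real assume e: "0 < e"
        obtain C V where CU: "closedin T C" "C \<subseteq> U" "U \<subseteq> V" "openin T V" "emeasure \<mu> V \<le> emeasure \<mu> C + ennreal e"
          using approx[OF op[OF U] e] by auto
        have "compactin T C" using closedin_compact_space[OF cpt CU(1)] .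
        then have "emeasure \<mu> C \<le> (SUP K\<in>{K. compactin T K \<and> K \<subseteq> U}. emeasure \<mu> K)"
          using CU by (intro SUP_upper) auto
        moreover have "emeasure \<mu> U \<le> emeasure \<mu> V" using CU op by (intro emeasure_mono) auto
        ultimately show "emeasure \<mu> U \<le> (SUP K\<in>{K. compactin T K \<and> K \<subseteq> U}. emeasure \<mu> K) + ennreal e"
          using CU(5) by (meson add_right_mono order_trans)
      qed
    qed
  qed
qed

section \<open>Ahlfors regularity and Hausdorff dimension\<close>

lemma sum_weight_powr:
  assumes "finite A"
  shows "(\<Sum>e\<in>words A n. weight \<rho> e powr s) = (\<Sum>a\<in>A. \<rho> a powr s) ^ n"
proof (induction n)
  case 0
  have "words A 0 = {[]}" by (auto simp: words_def)
  then show ?case by simp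
next
  case (Suc n)
  have W: "words A (Suc n) = (\<lambda>(a, e). a # e) ` (A \<times> words A n)" by (auto simp: words_Suc)
  have "(\<Sum>e\<in>words A (Suc n). weight \<rho> e powr s) = (\<Sum>(a, e)\<in>A \<times> words A n. weight \<rho> (a # e) powr s)"
    unfolding W by (subst sum.reindex) (auto simp: inj_on_def intro!: sum.cong)
  also have "\<dots> = (\<Sum>a\<in>A. \<Sum>e\<in>words A n. \<rho> a powr s * weight \<rho> e powr s)"
    unfolding sum.cartesian_product[symmetric] by (simp add: powr_mult)
  also have "\<dots> = (\<Sum>a\<in>A. \<rho> a powr s) ^ Suc n"
    by (simp add: sum_product[symmetric] Suc sum_distrib_right[symmetric] sum_distrib_left[symmetric])
  finally show ?case .
qed

context laakso_igs
begin

lemma symbol_of_hd: "s \<in> \<Sigma> \<Longrightarrow> symbol_of (\<lambda>i. hd (s (Suc i))) = s"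
proof
  fix n assume s: "s \<in> \<Sigma>"
  have "rev (map (\<lambda>i. hd (s (Suc i))) [0..<n]) = s n" if "n \<ge> 1" for n
    using that
  proof (induction n rule: nat_induct_at_least)
    case base
    have "s 1 \<in> W 1" using symbol_in_words[OF s] by simp
    then show ?case by (auto simp: words_1)
  next
    case (Suc n)
    then obtain a where "s (Suc n) = a # s n" using symbol_Suc s by blast
    then show ?case using Suc by simp
  qed
  moreover have "s 0 = undefined" using s by (auto simp: symbol_space_def PiE_def extensional_def)
  ultimately show "symbol_of (\<lambda>i. hd (s (Suc i))) n = s n"
    by (cases n) (auto simp: symbol_of_def simp del: upt_Suc)
qed

lemma hd_symbol_in: "s \<in> \<Sigma> \<Longrightarrow> hd (s (Suc i)) \<in> E\<^sub>1"
  using symbol_in_words[of s "Suc i"] by (auto simp: words_Suc)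

definition cell where "cell n e = (\<lambda>s. limit_rel S `` {s}) ` {s \<in> \<Sigma>. s n = e}"

end

context weighted_igs
begin

lemma cell_sub: "cell n e \<subseteq> X"
  unfolding cell_def using cls_in_X by auto

lemma cell_dist: "n \<ge> 1 \<Longrightarrow> x \<in> cell n e \<Longrightarrow> y \<in> cell n e \<Longrightarrow> dX x y \<le> Cup * wt e"
  unfolding cell_def using D_touch_le touch_refl symbol_in_words dX_cls by fastforce

lemma ediam_cell: "n \<ge> 1 \<Longrightarrow> ediam dX (cell n e) \<le> ennreal (Cup * wt e)"
  unfolding ediam_def using cell_dist by (intro SUP_least ennreal_leI)

lemma dX_le_Dmax: "x \<in> X \<Longrightarrow> y \<in> X \<Longrightarrow> dX x y \<le> Dmax"
  using X_cases[of x] X_cases[of y] dX_cls D_le_Dmax by auto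

lemma ediam_X: "ediam dX X \<le> ennreal Dmax"
  unfolding ediam_def using dX_le_Dmax by (intro SUP_least ennreal_leI)

lemma X_cells: "n \<ge> 1 \<Longrightarrow> X = (\<Union>e\<in>W n. cell n e)"
  using X_cases cell_sub symbol_in_words by (fastforce simp: cell_def)

lemma hausdorff_content_le:
  assumes n: "n \<ge> 1" and s: "0 < s" and eps: "Cup * rmax ^ n \<le> \<epsilon>"
  shows "hausdorff_content X dX s \<epsilon> \<le> ennreal (Cup powr s * (\<Sum>a\<in>E\<^sub>1. \<rho> a powr s) ^ n)"
proof -
  have fin: "finite (W n)" using finite_words[OF finE] .
  obtain f where f: "bij_betw f {0..<card (W n)} (W n)" using ex_bij_betw_nat_finite[OF fin] by blast
  \<comment> \<open>The cells of level \<open>n\<close>, padded to a sequence by empty sets, which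
    contribute 0 because \<open>s > 0\<close>.\<close>
  define U where "U i = (if i < card (W n) then cell n (f i) else {})" for i
  have fi: "f i \<in> W n" if "i < card (W n)" for i using f that by (auto simp: bij_betw_def)
  have d: "ediam dX (U i) \<le> ennreal (Cup * wt (f i))" if "i < card (W n)" for i
    using ediam_cell[OF n] that by (simp add: U_def)
  have e0: "ediam dX {} = 0" by (simp add: ediam_def bot_ennreal)
  have "(\<Sum>i. ennreal (enn2real (ediam dX (U i)) powr s)) =
      (\<Sum>i<card (W n). ennreal (enn2real (ediam dX (U i)) powr s))"
    using s by (intro suminf_finite) (auto simp: U_def e0)
  also have "\<dots> \<le> (\<Sum>i<card (W n). ennreal ((Cup * wt (f i)) powr s))"
  proof (intro sum_mono ennreal_leI powr_mono2)
    fix i assume i: "i \<in> {..<card (W n)}"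
    have "enn2real (ediam dX (U i)) \<le> enn2real (ennreal (Cup * wt (f i)))"
      using d[of i] i by (intro enn2real_mono) auto
    then show "enn2real (ediam dX (U i)) \<le> Cup * wt (f i)"
      using Cup_pos wt_pos[OF fi] i by (simp add: less_imp_le)
  qed (use s in auto)
  also have "\<dots> = ennreal (\<Sum>i<card (W n). (Cup * wt (f i)) powr s)" by (rule sum_ennreal) simp
  also have "(\<Sum>i<card (W n). (Cup * wt (f i)) powr s) = (\<Sum>e\<in>W n. (Cup * wt e) powr s)"
    using f by (subst sum.reindex_bij_betw[symmetric, of f "{..<card (W n)}" "W n"]) (auto simp: lessThan_atLeast0)
  also have "\<dots> = Cup powr s * (\<Sum>e\<in>W n. wt e powr s)"
    unfolding sum_distrib_left using Cup_pos wt_pos by (intro sum.cong refl powr_mult)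
  also have "(\<Sum>e\<in>W n. wt e powr s) = (\<Sum>a\<in>E\<^sub>1. \<rho> a powr s) ^ n"
    using sum_weight_powr[OF finE] by simp
  finally have le: "(\<Sum>i. ennreal (enn2real (ediam dX (U i)) powr s)) \<le> ennreal (Cup powr s * (\<Sum>a\<in>E\<^sub>1. \<rho> a powr s) ^ n)" .
  have small: "ediam dX (U i) \<le> ennreal \<epsilon>" for i
  proof (cases "i < card (W n)")
    case True
    have "Cup * wt (f i) \<le> \<epsilon>"
      using wt_le_rmax[OF fi[OF True]] Cup_pos eps by (meson mult_left_mono less_imp_le order_trans)
    then show ?thesis using d[OF True] by (meson ennreal_leI order_trans)
  qed (auto simp: U_def e0)
  have cov: "X \<subseteq> (\<Union>i. U i)"
  proof
    fix x assume "x \<in> X"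
    then obtain e where "e \<in> W n" "x \<in> cell n e" using X_cells[OF n] by auto
    moreover from this(1) have "e \<in> f ` {0..<card (W n)}" using f by (simp add: bij_betw_def)
    then obtain i where "i < card (W n)" "f i = e" by auto
    ultimately show "x \<in> (\<Union>i. U i)" by (auto simp: U_def)
  qed
  have "hausdorff_content X dX s \<epsilon> \<le> (\<Sum>i. ennreal (enn2real (ediam dX (U i)) powr s))"
    unfolding hausdorff_content_def
  proof (intro Inf_lower CollectI exI[of _ U] conjI refl allI small cov)
    show "U i \<subseteq> X" for i using cell_sub by (auto simp: U_def)
  qed
  then show ?thesis using le by (rule order_trans)
qed

text \<open>Any exponent above \<open>Q\<close> makes the sum of powers drop below 1, and the covers
  by cells then have sums tending to 0.\<close>

lemma hausdorff_dim_le: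
  assumes Q: "0 < Q" "(\<Sum>a\<in>E\<^sub>1. \<rho> a powr Q) = 1"
  shows "hausdorff_dim X dX \<le> ennreal Q"
proof (rule ennreal_le_epsilon)
  fix e :: real assume e: "0 < e"
  let ?s = "Q + e"
  let ?L = "\<Sum>a\<in>E\<^sub>1. \<rho> a powr ?s"
  have "?L < (\<Sum>a\<in>E\<^sub>1. \<rho> a powr Q)"
    using E1_ne finE e \<rho>_pos \<rho>_less_1 by (intro sum_strict_mono powr_less_mono') auto
  then have L: "0 \<le> ?L" "?L < 1" using Q by (auto intro: sum_nonneg)
  have "hausdorff_content X dX ?s \<epsilon> \<le> 0" if \<epsilon>: "0 < \<epsilon>" for \<epsilon>
  proof (rule tendsto_lowerbound)
    have "(\<lambda>n. Cup powr ?s * ?L ^ n) \<longlonglongrightarrow> Cup powr ?s * 0"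
      using L by (intro tendsto_intros LIMSEQ_power_zero) auto
    then show "(\<lambda>n. ennreal (Cup powr ?s * ?L ^ n)) \<longlonglongrightarrow> 0"
      using tendsto_ennrealI by fastforce
    have "(\<lambda>n. Cup * rmax ^ n) \<longlonglongrightarrow> Cup * 0"
      using rmax_pos rmax_less_1 by (intro tendsto_intros LIMSEQ_power_zero) auto
    then have "\<forall>\<^sub>F n in sequentially. Cup * rmax ^ n < \<epsilon>" using \<epsilon> by (intro order_tendstoD(2)) auto
    then show "\<forall>\<^sub>F n in sequentially. hausdorff_content X dX ?s \<epsilon> \<le> ennreal (Cup powr ?s * ?L ^ n)"
      using eventually_ge_at_top[of 1]
      by eventually_elim (use Q e in \<open>auto intro!: hausdorff_content_le\<close>)
  qed auto
  then have "hausdorff_meas X dX ?s = 0"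
    unfolding hausdorff_meas_def by (auto intro!: antisym SUP_least)
  then have "hausdorff_dim X dX \<le> ennreal ?s"
    unfolding hausdorff_dim_def using Q e by (intro Inf_lower) (auto simp del: ennreal_plus)
  then show "hausdorff_dim X dX \<le> ennreal Q + ennreal e" using Q e by (simp add: ennreal_plus)
qed

section \<open>Compactness of the limit space as an image of the shift space, and its self-similar
  measure\<close>

definition shift_top where "shift_top = product_topology (\<lambda>_::nat. discrete_topology E\<^sub>1) UNIV"

lemma cell_small:
  assumes U: "openin mtopology U" and s: "s \<in> \<Sigma>" "cls s \<in> U"
  shows "\<exists>n\<ge>1. cell n (s n) \<subseteq> U"
proof -
  obtain r where r: "r > 0" "mball (cls s) r \<subseteq> U" using U s unfolding openin_mtopology by blast
  have "(\<lambda>n. Cup * wt (s n)) \<longlonglongrightarrow> Cup * 0" by (intro tendsto_intros wt_symbol_tendsto s)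
  then have "\<forall>\<^sub>F n in sequentially. Cup * wt (s n) < r" using r by (intro order_tendstoD(2)) auto
  then have "\<forall>\<^sub>F n in sequentially. Cup * wt (s n) < r \<and> n \<ge> 1"
    using eventually_ge_at_top[of 1] by (rule eventually_conj)
  then obtain n where n: "Cup * wt (s n) < r" "n \<ge> 1" by (auto dest: eventually_happens)
  have "cell n (s n) \<subseteq> mball (cls s) r"
  proof
    fix y assume y: "y \<in> cell n (s n)"
    have "cls s \<in> cell n (s n)" using s by (auto simp: cell_def)
    then have "dX (cls s) y \<le> Cup * wt (s n)" using cell_dist n y by blast
    then show "y \<in> mball (cls s) r" using n y cell_sub cls_in_X s by (auto simp: in_mball)
  qed
  then show ?thesis using r n by blast
qed

lemma continuous_cls: "continuous_map shift_top mtopology (\<lambda>\<omega>. cls (symbol_of \<omega>))"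
proof -
  have top: "topspace shift_top = (\<Pi>\<^sub>E i\<in>UNIV. E\<^sub>1)" by (simp add: shift_top_def)
  have sym: "symbol_of \<omega> \<in> \<Sigma>" if "\<omega> \<in> topspace shift_top" for \<omega>
    using that top by (intro symbol_of_in) auto
  show ?thesis
    unfolding continuous_map_def
  proof (intro conjI allI impI)
    show "(\<lambda>\<omega>. cls (symbol_of \<omega>)) \<in> topspace shift_top \<rightarrow> topspace mtopology"
      using sym cls_in_X by auto
    fix U assume U: "openin mtopology U"
    show "openin shift_top {\<omega> \<in> topspace shift_top. cls (symbol_of \<omega>) \<in> U}"
    proof (subst openin_subopen, intro ballI)
      fix \<omega> assume w: "\<omega> \<in> {\<omega> \<in> topspace shift_top. cls (symbol_of \<omega>) \<in> U}"
      then obtain n where n: "n \<ge> 1" "cell n (symbol_of \<omega> n) \<subseteq> U" using cell_small[OF U sym] by auto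
      let ?S = "\<lambda>i. if i < n then {\<omega> i} else E\<^sub>1"
      let ?N = "\<Pi>\<^sub>E i\<in>UNIV. ?S i"
      have \<omega>: "\<omega> i \<in> E\<^sub>1" for i using w top by auto
      have "finite {i. ?S i \<noteq> topspace (discrete_topology E\<^sub>1)}"
        by (rule finite_subset[of _ "{..<n}"]) auto
      then have "openin shift_top ?N"
        unfolding shift_top_def openin_PiE_gen using \<omega> by auto
      moreover have "\<omega> \<in> ?N" using \<omega> by auto
      moreover have "?N \<subseteq> {\<omega> \<in> topspace shift_top. cls (symbol_of \<omega>) \<in> U}"
      proof
        fix \<omega>' assume w': "\<omega>' \<in> ?N"
        then have m: "\<omega>' i \<in> ?S i" for i by (rule PiE_mem) simp
        then have E: "\<omega>' i \<in> E\<^sub>1" for i using \<omega> by (metis singletonD)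
        have "\<omega>' i = \<omega> i" if "i < n" for i using m[of i] that by auto
        then have "symbol_of \<omega>' n = symbol_of \<omega> n" using n by (simp add: symbol_of_nth)
        then have "cls (symbol_of \<omega>') \<in> cell n (symbol_of \<omega> n)"
          using symbol_of_in[of \<omega>'] E by (auto simp: cell_def)
        then show "\<omega>' \<in> {\<omega> \<in> topspace shift_top. cls (symbol_of \<omega>) \<in> U}" using n E top by auto
      qed
      ultimately show "\<exists>N. openin shift_top N \<and> \<omega> \<in> N \<and> N \<subseteq> {\<omega> \<in> topspace shift_top. cls (symbol_of \<omega>) \<in> U}"
        by blast
    qed
  qed
qed

lemma compact_space_X: "compact_space mtopology"
proof -
  have top: "topspace shift_top = (\<Pi>\<^sub>E i\<in>UNIV. E\<^sub>1)" by (simp add: shift_top_def)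
  have "compact_space shift_top"
    unfolding shift_top_def compact_space_product_topology using finE by (auto simp: compact_space_discrete_topology)
  then have "compactin mtopology ((\<lambda>\<omega>. cls (symbol_of \<omega>)) ` topspace shift_top)"
    using image_compactin[OF _ continuous_cls] by (auto simp: compact_space_def)
  moreover have "(\<lambda>\<omega>. cls (symbol_of \<omega>)) ` topspace shift_top = X"
  proof
    show "(\<lambda>\<omega>. cls (symbol_of \<omega>)) ` topspace shift_top \<subseteq> X"
      using top cls_in_X symbol_of_in by fastforce
    show "X \<subseteq> (\<lambda>\<omega>. cls (symbol_of \<omega>)) ` topspace shift_top"
    proof
      fix x assume "x \<in> X"
      then obtain s where s: "s \<in> \<Sigma>" "x = cls s" using X_cases by blast
      have "(\<lambda>i. hd (s (Suc i))) \<in> topspace shift_top" using top hd_symbol_in s by auto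
      then show "x \<in> (\<lambda>\<omega>. cls (symbol_of \<omega>)) ` topspace shift_top"
        using symbol_of_hd[OF s(1)] s by (intro image_eqI[of _ _ "\<lambda>i. hd (s (Suc i))"]) auto
    qed
  qed
  ultimately show ?thesis by (simp add: compact_space_def)
qed

lemma ahlfors_regular_dX:
  assumes Q: "0 < Q" "(\<Sum>a\<in>E\<^sub>1. \<rho> a powr Q) = 1"
  shows "ahlfors_regular X dX Q"
proof -
  define M where "M = point_measure E\<^sub>1 (\<lambda>a. ennreal (\<rho> a powr Q))"
  have M: "prob_space M"
    unfolding M_def using finE Q by (intro prob_space_point_measure) (auto simp: sum_ennreal)
  have Msp: "space M = E\<^sub>1" "sets M = Pow E\<^sub>1" by (auto simp: M_def space_point_measure sets_point_measure)
  define P where "P = PiM (UNIV :: nat set) (\<lambda>_. M)"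
  interpret prod: product_prob_space "\<lambda>_. M" "UNIV :: nat set"
    using M by (intro product_prob_spaceI) auto
  interpret P: prob_space P unfolding P_def by (rule prod.prob_space_axioms)
  have Psp: "space P = (\<Pi>\<^sub>E i\<in>UNIV. E\<^sub>1)" by (simp add: P_def space_PiM Msp)
  define q where "q \<omega> = cls (symbol_of \<omega>)" for \<omega>
  define Z where "Z n e = {\<omega> \<in> space P. symbol_of \<omega> n = e}" for n e
  have Pin: "\<omega> i \<in> E\<^sub>1" if "\<omega> \<in> space P" for \<omega> i using that Psp by auto
  have symin: "symbol_of \<omega> \<in> \<Sigma>" if "\<omega> \<in> space P" for \<omega> using Pin[OF that] by (rule symbol_of_in)
  have Z: "Z n e \<in> sets P \<and> emeasure P (Z n e) = ennreal (wt e powr Q)" if n: "n \<ge> 1" and e: "e \<in> W n" for n e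
  proof -
    have len: "length e = n" and se: "set e \<subseteq> E\<^sub>1" using e by (auto simp: words_def)
    have re: "rev e ! i \<in> E\<^sub>1" if "i < n" for i using se len that nth_mem[of i "rev e"] by auto
    have eq: "Z n e = prod_emb UNIV (\<lambda>_. M) {..<n} (\<Pi>\<^sub>E i\<in>{..<n}. {rev e ! i})"
    proof -
      have "symbol_of \<omega> n = e \<longleftrightarrow> (\<forall>i<n. \<omega> i = rev e ! i)" for \<omega> :: "nat \<Rightarrow> 'e"
      proof -
        have "symbol_of \<omega> n = e \<longleftrightarrow> map \<omega> [0..<n] = rev e" using n by (auto simp: symbol_of_nth rev_swap)
        also have "\<dots> \<longleftrightarrow> (\<forall>i<n. \<omega> i = rev e ! i)" using len by (auto simp: list_eq_iff_nth_eq)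
        finally show ?thesis .
      qed
      then show ?thesis by (auto simp: Z_def prod_emb_def Psp Msp PiE_iff)
    qed
    have "emeasure P (Z n e) = (\<Prod>i<n. emeasure M {rev e ! i})"
      unfolding eq P_def using re by (intro prod.emeasure_PiM_emb) (auto simp: Msp)
    also have "\<dots> = (\<Prod>i<n. ennreal (\<rho> (rev e ! i) powr Q))"
      using re finE by (intro prod.cong refl) (auto simp: M_def emeasure_point_measure_finite)
    also have "\<dots> = ennreal (\<Prod>i<n. \<rho> (rev e ! i) powr Q)" by (rule prod_ennreal) simp
    also have "(\<Prod>i<n. \<rho> (rev e ! i) powr Q) = prod_list (map (\<lambda>a. \<rho> a powr Q) (rev e))"
      using len by (subst prod.list_conv_set_nth) (auto simp: lessThan_atLeast0 intro!: prod.cong)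
    also have "\<dots> = prod_list (map (\<lambda>a. \<rho> a powr Q) e)" by (simp add: rev_map[symmetric] prod_list.rev)
    also have "\<dots> = wt e powr Q"
      using se
    proof (induction e)
      case (Cons a e)
      then show ?case using \<rho>_pos[of a] wt_pos[of e "length e"] by (simp add: powr_mult words_def)
    qed simp
    finally have "emeasure P (Z n e) = ennreal (wt e powr Q)" .
    moreover have "Z n e \<in> sets P"
      unfolding eq P_def using re by (intro sets_PiM_I) (auto simp: Msp)
    ultimately show ?thesis by blast
  qed
  define B where "B = sigma X {U. openin mtopology U}"
  have sub: "{U. openin mtopology U} \<subseteq> Pow X" using openin_subset by fastforce
  have B: "space B = X" "sets B = sigma_sets X {U. openin mtopology U}"
    using sub by (auto simp: B_def)
  \<comment> \<open>Each point of an open set has a whole cell of its code inside the set, so the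
    preimage is a countable union of cylinders.\<close>
  have qpre: "q -` U \<inter> space P = (\<Union>n\<in>{1..}. \<Union>e\<in>{e \<in> W n. cell n e \<subseteq> U}. Z n e)" if U: "openin mtopology U" for U
  proof (intro equalityI subsetI)
    fix \<omega> assume w: "\<omega> \<in> q -` U \<inter> space P"
    then obtain n where "n \<ge> 1" "cell n (symbol_of \<omega> n) \<subseteq> U"
      using cell_small[OF U symin] by (auto simp: q_def)
    then show "\<omega> \<in> (\<Union>n\<in>{1..}. \<Union>e\<in>{e \<in> W n. cell n e \<subseteq> U}. Z n e)"
      using w symbol_in_words[OF symin] by (auto simp: Z_def)
  next
    fix \<omega> assume "\<omega> \<in> (\<Union>n\<in>{1..}. \<Union>e\<in>{e \<in> W n. cell n e \<subseteq> U}. Z n e)"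
    then obtain n where n: "\<omega> \<in> space P" "cell n (symbol_of \<omega> n) \<subseteq> U" by (auto simp: Z_def)
    then have "q \<omega> \<in> cell n (symbol_of \<omega> n)" using symin by (auto simp: cell_def q_def)
    then show "\<omega> \<in> q -` U \<inter> space P" using n by auto
  qed
  have qm: "q \<in> measurable P B"
    unfolding B_def
  proof (rule measurable_measure_of[OF sub])
    show "q \<in> space P \<rightarrow> X" using symin cls_in_X by (auto simp: q_def)
    fix U assume "U \<in> {U. openin mtopology U}"
    then have "q -` U \<inter> space P = (\<Union>n\<in>{1..}. \<Union>e\<in>{e \<in> W n. cell n e \<subseteq> U}. Z n e)" using qpre by auto
    also have "\<dots> \<in> sets P"
      using Z finite_words[OF finE] by (intro sets.countable_UN' sets.finite_UN) auto
    finally show "q -` U \<inter> space P \<in> sets P" .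
  qed
  define \<mu> where "\<mu> = distr P B q"
  have \<mu>: "space \<mu> = X" "sets \<mu> = sigma_sets X {U. openin mtopology U}" using B by (auto simp: \<mu>_def)
  interpret \<mu>: prob_space \<mu> unfolding \<mu>_def using qm by (rule P.prob_space_distr)
  have radon: "radon_measure mtopology \<mu>"
    using \<mu> by (intro radon_measure_compact_metrizable metrizable_space_mtopology compact_space_X \<mu>.finite_measure_axioms) auto
  have ball_sets: "mball x r \<in> sets B" for x r using B by auto
  have em: "emeasure \<mu> (mball x r) = emeasure P (q -` mball x r \<inter> space P)" for x r
    unfolding \<mu>_def using qm ball_sets by (rule emeasure_distr)
  \<comment> \<open>At the stopping level below there are two cases: without a parent the radius is
    at most \<open>2 * Dmax\<close>, with one it is at most \<open>Cup\<close> times the weight of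
    the parent. The denominator covers both.\<close>
  define c where "c = rmin / (2 * Dmax + Cup)"
  have c: "0 < c" using rmin_pos Dmax_pos Cup_pos by (auto simp: c_def)
  define N where "N = real (4 * card E\<^sub>1)"
  \<comment> \<open>One factor \<open>rmin\<close> for the letter at the stopping level, one from
    the threshold \<open>rmin * wt (s n) < r\<close>, one for the weights of touching edges.\<close>
  define k where "k = 1 / rmin ^ 3"
  have N1: "1 \<le> N"
  proof -
    have "1 \<le> card E\<^sub>1" using E1_ne finE by (metis One_nat_def Suc_leI card_gt_0_iff)
    then show ?thesis by (simp add: N_def)
  qed
  have k1: "0 < k" using rmin_pos by (simp add: k_def)
  have lower: "ennreal ((c * r) powr Q) \<le> emeasure \<mu> (mball x r)" if x: "x \<in> X" and r: "0 < r" "r \<le> 2 * Dmax" for x r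
  proof -
    obtain s where s: "s \<in> \<Sigma>" "x = cls s" using X_cases x by blast
    have "(\<lambda>n. Cup * wt (s n)) \<longlonglongrightarrow> Cup * 0" by (intro tendsto_intros wt_symbol_tendsto s)
    then have "\<forall>\<^sub>F n in sequentially. Cup * wt (s n) < r" using r by (intro order_tendstoD(2)) auto
    then have "\<forall>\<^sub>F n in sequentially. n \<ge> 1 \<and> Cup * wt (s n) < r"
      using eventually_ge_at_top[of 1] by (intro eventually_conj)
    then have ex: "\<exists>n. n \<ge> 1 \<and> Cup * wt (s n) < r" by (auto dest: eventually_happens)
    \<comment> \<open>The first level at which the diameter bound puts the cell of
      \<open>s n\<close> inside the ball.\<close>
    define n where "n = (LEAST n. n \<ge> 1 \<and> Cup * wt (s n) < r)"
    have n: "n \<ge> 1" "Cup * wt (s n) < r" using LeastI_ex[OF ex] by (auto simp: n_def)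
    have sn: "s n \<in> W n" using symbol_in_words[OF s(1) n(1)] .
    have "c * r \<le> wt (s n)"
    proof (cases "n = 1")
      case True
      have "c * r \<le> c * (2 * Dmax + Cup)" using r c Cup_pos by (intro mult_left_mono) auto
      also have "\<dots> = rmin" using Dmax_pos Cup_pos by (simp add: c_def)
      also have "\<dots> \<le> wt (s n)" using wt_ge_rmin[OF sn] True by simp
      finally show ?thesis .
    next
      case False
      then obtain m where m: "n = Suc m" "m \<ge> 1" using n by (cases n) auto
      then have "\<not> (m \<ge> 1 \<and> Cup * wt (s m) < r)" using not_less_Least[of m] unfolding n_def by (metis lessI)
      then have rm: "r \<le> Cup * wt (s m)" using m by auto
      obtain a where a: "a \<in> E\<^sub>1" "s (Suc m) = a # s m" using symbol_Suc s m by blast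
      have wm: "0 < wt (s m)" using wt_pos symbol_in_words[OF s(1) m(2)] by blast
      have "c * r \<le> c * ((2 * Dmax + Cup) * wt (s m))"
        using rm c Dmax_pos wm by (intro mult_left_mono) (auto simp: algebra_simps intro: order_trans)
      also have "\<dots> = rmin * wt (s m)" using Dmax_pos Cup_pos by (simp add: c_def)
      also have "\<dots> \<le> wt (s n)" using a m rmin_le[OF a(1)] wm by simp
      finally show ?thesis .
    qed
    then have "ennreal ((c * r) powr Q) \<le> ennreal (wt (s n) powr Q)"
      using c r Q by (intro ennreal_leI powr_mono2) auto
    also have "\<dots> = emeasure P (Z n (s n))" using Z[OF n(1) sn] by simp
    also have "\<dots> \<le> emeasure P (q -` mball x r \<inter> space P)"
    proof (intro emeasure_mono subsetI)
      fix \<omega> assume w: "\<omega> \<in> Z n (s n)"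
      then have "q \<omega> \<in> cell n (s n)" "x \<in> cell n (s n)" using symin s by (auto simp: q_def cell_def Z_def)
      then have "dX x (q \<omega>) \<le> Cup * wt (s n)" "q \<omega> \<in> X" using cell_dist n cell_sub by blast+
      then show "\<omega> \<in> q -` mball x r \<inter> space P" using w n x by (auto simp: Z_def in_mball)
    next
      show "q -` mball x r \<inter> space P \<in> sets P" using qm ball_sets by (rule measurable_sets)
    qed
    finally show ?thesis using em by simp
  qed
  have upper: "emeasure \<mu> (mball x r) \<le> ennreal (N * (k * r) powr Q)" if x: "x \<in> X" and r: "0 < r" for x r
  proof -
    obtain s where s: "s \<in> \<Sigma>" "x = cls s" using X_cases x by blast
    have "(\<lambda>n. rmin * wt (s n)) \<longlonglongrightarrow> rmin * 0" by (intro tendsto_intros wt_symbol_tendsto s)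
    then have "\<forall>\<^sub>F n in sequentially. rmin * wt (s n) < r" using r by (intro order_tendstoD(2)) auto
    then have "\<forall>\<^sub>F n in sequentially. n \<ge> 1 \<and> rmin * wt (s n) < r"
      using eventually_ge_at_top[of 1] by (intro eventually_conj)
    then have ex: "\<exists>n. n \<ge> 1 \<and> rmin * wt (s n) < r" by (auto dest: eventually_happens)
    \<comment> \<open>One level earlier the radius is at most the distance forced by not touching,
      so the ball is covered by the cells whose words touch that of \<open>s\<close>.\<close>
    define n where "n = (LEAST n. n \<ge> 1 \<and> rmin * wt (s n) < r)"
    have n: "n \<ge> 1" "rmin * wt (s n) < r" using LeastI_ex[OF ex] by (auto simp: n_def)
    show ?thesis
    proof (cases "n = 1")
      case True
      have w1: "rmin \<le> wt (s 1)" using wt_ge_rmin[of "s 1" 1] symbol_in_words[OF s(1)] by simp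
      have "rmin ^ 3 \<le> rmin ^ 2" using rmin_pos rmin_less_1 by (intro power_decreasing) auto
      also have "rmin ^ 2 \<le> rmin * wt (s 1)" using w1 rmin_pos by (simp add: power2_eq_square)
      also have "\<dots> \<le> r" using n True by simp
      finally have "1 \<le> k * r" using rmin_pos by (simp add: k_def field_simps)
      then have "1 \<le> (k * r) powr Q" using Q by (simp add: ge_one_powr_ge_zero)
      then have "1 * 1 \<le> N * (k * r) powr Q" using N1 by (intro mult_mono) auto
      then have "ennreal 1 \<le> ennreal (N * (k * r) powr Q)" by (intro ennreal_leI) simp
      moreover have "emeasure \<mu> (mball x r) \<le> 1" by (rule \<mu>.measure_le_1)
      ultimately show ?thesis by (simp add: order_trans)
    next
      case False
      then obtain m where m: "n = Suc m" "m \<ge> 1" using n by (cases n) auto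
      then have "\<not> (m \<ge> 1 \<and> rmin * wt (s m) < r)" using not_less_Least[of m] unfolding n_def by (metis lessI)
      then have rm: "r \<le> rmin * wt (s m)" using m by auto
      obtain a where a: "a \<in> E\<^sub>1" "s (Suc m) = a # s m" using symbol_Suc s m by blast
      have sm: "s m \<in> W m" using symbol_in_words[OF s(1) m(2)] .
      have wm: "0 < wt (s m)" using wt_pos sm by blast
      have "rmin * (rmin * wt (s m)) \<le> rmin * wt (s n)" using a m rmin_le[OF a(1)] wm rmin_pos by simp
      then have wr: "rmin ^ 2 * wt (s m) \<le> r" using n by (simp add: power2_eq_square)
      let ?F = "{f \<in> W m. touch m (s m) f}"
      have finF: "finite ?F" using finite_words[OF finE] by simp
      have wF: "wt f \<le> k * r" if f: "f \<in> ?F" for f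
      proof -
        obtain p p' where "lb m p (s m) = lb m p' f" using touch_iff[OF m(2) sm] f by blast
        then have "rmin * wt f \<le> wt (s m)" using wt_ratio[OF m(2) _ sm, of f p' p] f by auto
        then have "rmin ^ 2 * (rmin * wt f) \<le> rmin ^ 2 * wt (s m)" using rmin_pos by (intro mult_left_mono) auto
        then have "rmin ^ 3 * wt f \<le> r" using wr by (simp add: power3_eq_cube power2_eq_square mult.assoc)
        then show ?thesis using rmin_pos by (simp add: k_def field_simps)
      qed
      have "q -` mball x r \<inter> space P \<subseteq> (\<Union>f\<in>?F. Z m f)"
      proof
        fix \<omega> assume w: "\<omega> \<in> q -` mball x r \<inter> space P"
        then have sy: "symbol_of \<omega> \<in> \<Sigma>" using symin by auto
        have "D s (symbol_of \<omega>) < r" using w s sy dX_cls by (auto simp: q_def in_mball)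
        then have "touch m (s m) (symbol_of \<omega> m)" using D_not_touch_ge[OF s(1) sy m(2)] rm by force
        then show "\<omega> \<in> (\<Union>f\<in>?F. Z m f)" using w symbol_in_words[OF sy m(2)] by (auto simp: Z_def)
      qed
      then have "emeasure P (q -` mball x r \<inter> space P) \<le> emeasure P (\<Union>f\<in>?F. Z m f)"
        using Z[OF m(2)] finF by (intro emeasure_mono) auto
      also have "\<dots> \<le> (\<Sum>f\<in>?F. emeasure P (Z m f))"
        using Z[OF m(2)] finF by (intro emeasure_subadditive_finite) auto
      also have "\<dots> = (\<Sum>f\<in>?F. ennreal (wt f powr Q))" using Z[OF m(2)] by (intro sum.cong) auto
      also have "\<dots> = ennreal (\<Sum>f\<in>?F. wt f powr Q)" by (rule sum_ennreal) simp
      also have "\<dots> \<le> ennreal (N * (k * r) powr Q)"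
      proof (rule ennreal_leI)
        have "(\<Sum>f\<in>?F. wt f powr Q) \<le> (\<Sum>f\<in>?F. (k * r) powr Q)"
          using wF Q wt_pos by (intro sum_mono powr_mono2) (auto intro: less_imp_le)
        also have "\<dots> = card ?F * (k * r) powr Q" by simp
        also have "\<dots> \<le> N * (k * r) powr Q"
          using card_touch[OF m(2) sm] by (intro mult_right_mono) (auto simp: N_def)
        finally show "(\<Sum>f\<in>?F. wt f powr Q) \<le> N * (k * r) powr Q" .
      qed
      finally show ?thesis using em by simp
    qed
  qed
  define C where "C = max 1 (max (1 / c powr Q) (N * k powr Q))"
  have C: "1 \<le> C" "1 / c powr Q \<le> C" "N * k powr Q \<le> C" by (auto simp: C_def)
  have bounds: "ennreal (inverse C * r powr Q) \<le> emeasure \<mu> (mball x r) \<and> emeasure \<mu> (mball x r) \<le> ennreal (C * r powr Q)"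
    if x: "x \<in> X" and r: "0 < r" "ennreal r \<le> 2 * ediam dX X" for x r
  proof
    have "ennreal r \<le> 2 * ennreal Dmax" using r(2) mult_left_mono[OF ediam_X, of 2] by (meson order_trans zero_le)
    also have "\<dots> = ennreal (2 * Dmax)" using Dmax_pos by (simp add: ennreal_mult')
    finally have rD: "r \<le> 2 * Dmax" using Dmax_pos by simp
    have "inverse C \<le> c powr Q" using C(2) C(1) c by (simp add: field_simps)
    then have "inverse C * r powr Q \<le> c powr Q * r powr Q" by (intro mult_right_mono) auto
    also have "\<dots> = (c * r) powr Q" by (simp add: powr_mult)
    finally have "inverse C * r powr Q \<le> (c * r) powr Q" .
    then show "ennreal (inverse C * r powr Q) \<le> emeasure \<mu> (mball x r)"
      using lower[OF x r(1) rD] by (meson ennreal_leI order_trans)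
    have "N * (k * r) powr Q = (N * k powr Q) * r powr Q" by (simp add: powr_mult)
    also have "\<dots> \<le> C * r powr Q" using C(3) by (intro mult_right_mono) auto
    finally show "emeasure \<mu> (mball x r) \<le> ennreal (C * r powr Q)"
      using upper[OF x r(1)] by (meson ennreal_leI order_trans)
  qed
  show ?thesis
    unfolding ahlfors_regular_def
    using Metric_space_axioms Q(1) radon C(1) bounds by blast
qed

end

section \<open>The flow of a minimizer\<close>

text \<open>Differentiability at 0, where p > 1 enters, allows a first variation on edges without a
  jump.\<close>

lemma abs_powr_has_real_derivative:
  fixes x p :: real
  assumes p: "1 < p"
  shows "((\<lambda>x. \<bar>x\<bar> powr p) has_real_derivative (p * (sgn x * \<bar>x\<bar> powr (p - 1)))) (at x)"
proof -
  consider "x > 0" | "x < 0" | "x = 0" by linarith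
  then show ?thesis
  proof cases
    case 1
    have "((\<lambda>x. x powr p) has_real_derivative (p * (sgn x * \<bar>x\<bar> powr (p - 1)))) (at x)"
      using has_real_derivative_powr[OF 1, of p] 1 by simp
    then show ?thesis
      by (rule has_field_derivative_transform_within_open[of _ _ _ "{0<..}"]) (use 1 in simp_all)
  next
    case 2
    have "((\<lambda>x. (- x) powr p) has_real_derivative (p * (- x) powr (p - 1) * (- 1))) (at x)"
      using 2 by (auto intro!: derivative_eq_intros)
    then have "((\<lambda>x. (- x) powr p) has_real_derivative (p * (sgn x * \<bar>x\<bar> powr (p - 1)))) (at x)"
      using 2 by simp
    then show ?thesis
      by (rule has_field_derivative_transform_within_open[of _ _ _ "{..<0}"]) (use 2 in simp_all)
  next
    case 3
    have "((\<lambda>h::real. \<bar>h\<bar> powr (p - 1)) \<longlongrightarrow> \<bar>0\<bar> powr (p - 1)) (at 0)"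
      using p by (intro tendsto_powr' tendsto_intros) auto
    then have "((\<lambda>h::real. \<bar>h\<bar> powr (p - 1)) \<longlongrightarrow> 0) (at 0)" by simp
    then have "((\<lambda>h::real. (\<bar>0 + h\<bar> powr p - \<bar>0\<bar> powr p) / h) \<longlongrightarrow> 0) (at 0)"
    proof (rule Lim_null_comparison[rotated])
      show "\<forall>\<^sub>F h in at 0. norm ((\<bar>0 + h\<bar> powr p - \<bar>0\<bar> powr p) / h) \<le> \<bar>h\<bar> powr (p - 1)"
      proof (rule eventually_at_filter[THEN iffD2], rule always_eventually, intro allI impI)
        fix h :: real assume "h \<noteq> 0"
        then show "norm ((\<bar>0 + h\<bar> powr p - \<bar>0\<bar> powr p) / h) \<le> \<bar>h\<bar> powr (p - 1)"
          by (simp add: powr_diff)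
      qed
    qed
    then show ?thesis using 3 by (simp add: DERIV_def)
  qed
qed

context laakso_igs
begin

lemma boundary_side:
  assumes "a \<in> E\<^sub>1" "i \<in> I" "j \<in> I" "l s a = \<phi> u i" "l t a = \<phi> v j"
  shows "s = t"
  using not_both_boundary[of a i j u v] not_both_boundary[of a j i v u] assms by (cases s; cases t) auto

text \<open>The gradient of the p-energy with respect to the jumps, up to the factor
  \<open>p\<close>; \<open>flow_dif_0\<close> says that it is divergence-free off the
  boundary.\<close>

definition flow :: "real \<Rightarrow> ('v \<Rightarrow> real) \<Rightarrow> 'e \<Rightarrow> real" where
  "flow p g a = sgn (dif g a) * \<bar>dif g a\<bar> powr (p - 1)"

text \<open>The Euler-Lagrange equation: a variation by \<open>k\<close> keeps the boundary values,
  and truncating it to [0,1] returns to \<open>pots\<close> without enlarging any jump, so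
  \<open>F\<close> is minimal at 0.\<close>

lemma flow_dif_0:
  assumes p: "1 < p" and g: "g \<in> pots" "energy p g = Md p"
    and k: "\<And>i u. i \<in> I \<Longrightarrow> k (\<phi> u i) = 0"
  shows "(\<Sum>a\<in>E\<^sub>1. flow p g a * dif k a) = 0"
proof -
  define F where "F t = (\<Sum>a\<in>E\<^sub>1. \<bar>dif g a + t * dif k a\<bar> powr p)" for t
  have "(F has_real_derivative (\<Sum>a\<in>E\<^sub>1. p * (sgn (dif g a + 0 * dif k a) * \<bar>dif g a + 0 * dif k a\<bar> powr (p - 1)) * dif k a)) (at 0)"
    unfolding F_def
  proof (rule DERIV_sum)
    fix a assume "a \<in> E\<^sub>1"
    have "((\<lambda>t. dif g a + t * dif k a) has_real_derivative dif k a) (at 0)"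
      by (auto intro!: derivative_eq_intros)
    then show "((\<lambda>t. \<bar>dif g a + t * dif k a\<bar> powr p) has_real_derivative
      p * (sgn (dif g a + 0 * dif k a) * \<bar>dif g a + 0 * dif k a\<bar> powr (p - 1)) * dif k a) (at 0)"
      by (rule DERIV_chain2[OF abs_powr_has_real_derivative[OF p]])
  qed
  moreover have "F 0 \<le> F t" for t
  proof -
    define T where "T v = (if v \<in> V\<^sub>1 then max 0 (min 1 (g v + t * k v)) else 0)" for v
    have "T \<in> pots"
      using g(1) k boundary_sub[of Minus] boundary_sub[of Plus]
      unfolding pots_iff by (auto simp: T_def boundary_def)
    then have "energy p g \<le> energy p T" using Md_le_energy[of p T] g p by simp
    also have "\<dots> \<le> F t"
      unfolding energy_def F_def
    proof (intro sum_mono powr_mono2)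
      fix a assume a: "a \<in> E\<^sub>1"
      show "\<bar>dif T a\<bar> \<le> \<bar>dif g a + t * dif k a\<bar>"
        using l_in_V[OF a] by (auto simp: dif_def T_def algebra_simps min_def max_def)
    qed (use p in auto)
    finally show ?thesis by (simp add: F_def energy_def)
  qed
  ultimately have "(\<Sum>a\<in>E\<^sub>1. p * (sgn (dif g a + 0 * dif k a) * \<bar>dif g a + 0 * dif k a\<bar> powr (p - 1)) * dif k a) = 0"
    by (intro DERIV_local_min[of F _ 0 1]) auto
  moreover have "(\<Sum>a\<in>E\<^sub>1. p * (sgn (dif g a + 0 * dif k a) * \<bar>dif g a + 0 * dif k a\<bar> powr (p - 1)) * dif k a)
    = p * (\<Sum>a\<in>E\<^sub>1. flow p g a * dif k a)"
    by (simp add: flow_def sum_distrib_left mult.assoc)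
  ultimately show ?thesis using p by simp
qed

text \<open>For a \<open>sympot\<close> the edge at the Minus vertex gives the same value, so what
  enters at \<open>\<phi> Minus i\<close> leaves at \<open>\<phi> Plus i\<close>.\<close>

definition flux :: "real \<Rightarrow> ('v \<Rightarrow> real) \<Rightarrow> 'i \<Rightarrow> real" where
  "flux p g i = \<bar>dif g (da Plus i)\<bar> powr (p - 1)"

text \<open>The left side is the flow oriented towards the boundary vertex. Its sign is known
  because \<open>g\<close> takes its extreme values 0 and 1 there.\<close>

lemma flow_boundary:
  assumes g: "sympot g" and i: "i \<in> I"
  shows "(if ds u i = Plus then 1 else - 1) * flow p g (da u i) = (if u = Plus then 1 else - 1) * flux p g i"
proof -
  have gp: "g \<in> pots" using g by (simp add: sympot_def)
  have a: "da u i \<in> E\<^sub>1" "l (ds u i) (da u i) = \<phi> u i" using da_in l_dart i by auto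
  have "\<bar>dif g (da u i)\<bar> = \<bar>dif g (da Plus i)\<bar>" using g i unfolding sympot_def by blast
  then have fx: "flux p g i = \<bar>dif g (da u i)\<bar> powr (p - 1)" by (simp add: flux_def)
  have r: "0 \<le> g (l s (da u i))" "g (l s (da u i)) \<le> 1" for s using gp l_in_V[OF a(1), of s] by (auto simp: pots_iff)
  have "g (\<phi> u i) = (if u = Plus then 1 else 0)" using pots_\<phi>[OF gp i] by (cases u) auto
  then have "(if ds u i = Plus then 1 else - 1) * dif g (da u i) = (if u = Plus then 1 else - 1) * \<bar>dif g (da u i)\<bar>"
    using a(2) r by (cases "ds u i"; cases u) (auto simp: dif_def)
  then show ?thesis unfolding fx flow_def
    by (cases "dif g (da u i) = 0") (auto simp: sgn_if abs_if split: if_splits)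
qed

text \<open>Summation by parts. Removing from \<open>k\<close> its boundary part \<open>kb\<close>
  leaves a test function killed by \<open>flow_dif_0\<close>; each indicator in \<open>kb\<close>
  meets a single edge, where \<open>flow_boundary\<close> evaluates the flow.\<close>

lemma flow_identity:
  assumes p: "1 < p" and g: "sympot g" "energy p g = Md p"
  shows "(\<Sum>a\<in>E\<^sub>1. flow p g a * dif k a) = (\<Sum>i\<in>I. flux p g i * (k (\<phi> Plus i) - k (\<phi> Minus i)))"
proof -
  have gp: "g \<in> pots" using g by (simp add: sympot_def)
  define B where "B = {Minus, Plus} \<times> I"
  have finB: "finite B" using finI by (simp add: B_def)
  define ch where "ch x v = (if v = \<phi> (fst x) (snd x) then 1 else 0 :: real)" for x v
  define kb where "kb v = (\<Sum>x\<in>B. k (\<phi> (fst x) (snd x)) * ch x v)" for v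
  have kb: "kb (\<phi> u i) = k (\<phi> u i)" if i: "i \<in> I" for u i
  proof -
    have ui: "(u, i) \<in> B" using i by (cases u) (auto simp: B_def)
    have "kb (\<phi> u i) = k (\<phi> u i) * ch (u, i) (\<phi> u i) + (\<Sum>x\<in>B - {(u, i)}. k (\<phi> (fst x) (snd x)) * ch x (\<phi> u i))"
      unfolding kb_def using sum.remove[OF finB ui, of "\<lambda>x. k (\<phi> (fst x) (snd x)) * ch x (\<phi> u i)"] by simp
    also have "(\<Sum>x\<in>B - {(u, i)}. k (\<phi> (fst x) (snd x)) * ch x (\<phi> u i)) = 0"
      using \<phi>_eq_iff[OF i] by (intro sum.neutral) (auto simp: ch_def B_def)
    finally show ?thesis by (simp add: ch_def)
  qed
  have ch: "(\<Sum>a\<in>E\<^sub>1. flow p g a * dif (ch x) a) = (if fst x = Plus then 1 else - 1) * flux p g (snd x)"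
    if x: "x \<in> B" for x
  proof -
    obtain u i where ui: "x = (u, i)" "i \<in> I" using x by (auto simp: B_def)
    have a: "da u i \<in> E\<^sub>1" "l (ds u i) (da u i) = \<phi> u i" using da_in l_dart ui by auto
    have z: "ch x (l s b) = (if s = ds u i \<and> b = da u i then 1 else 0)" if "b \<in> E\<^sub>1" for s b
    proof (cases "l s b = \<phi> u i")
      case True
      then show ?thesis using dart_unique[OF ui(2) that True] ui by (simp add: ch_def)
    next
      case False
      then have "\<not> (s = ds u i \<and> b = da u i)" using a(2) by blast
      then show ?thesis using False ui by (simp add: ch_def)
    qed
    have "(\<Sum>a\<in>E\<^sub>1. flow p g a * dif (ch x) a) = (\<Sum>a\<in>E\<^sub>1. if a = da u i then (if ds u i = Plus then 1 else - 1) * flow p g (da u i) else 0)"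
      by (intro sum.cong refl) (cases "ds u i"; simp add: dif_def z)
    also have "\<dots> = (if ds u i = Plus then 1 else - 1) * flow p g (da u i)" using finE a by simp
    also have "\<dots> = (if u = Plus then 1 else - 1) * flux p g i" by (rule flow_boundary[OF g(1) ui(2)])
    finally show ?thesis using ui by simp
  qed
  have "(\<Sum>a\<in>E\<^sub>1. flow p g a * dif (\<lambda>v. k v - kb v) a) = 0"
    by (rule flow_dif_0[OF p gp g(2)]) (simp add: kb)
  moreover have "dif (\<lambda>v. k v - kb v) a = dif k a - dif kb a" for a by (simp add: dif_def)
  ultimately have "(\<Sum>a\<in>E\<^sub>1. flow p g a * dif k a) = (\<Sum>a\<in>E\<^sub>1. flow p g a * dif kb a)"
    by (simp add: right_diff_distrib sum_subtractf)
  also have "\<dots> = (\<Sum>a\<in>E\<^sub>1. \<Sum>x\<in>B. k (\<phi> (fst x) (snd x)) * (flow p g a * dif (ch x) a))"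
    by (intro sum.cong refl) (simp add: dif_def kb_def sum_subtractf[symmetric] sum_distrib_left algebra_simps)
  also have "\<dots> = (\<Sum>x\<in>B. k (\<phi> (fst x) (snd x)) * (\<Sum>a\<in>E\<^sub>1. flow p g a * dif (ch x) a))"
    by (subst sum.swap) (simp add: sum_distrib_left)
  also have "\<dots> = (\<Sum>x\<in>B. k (\<phi> (fst x) (snd x)) * ((if fst x = Plus then 1 else - 1) * flux p g (snd x)))"
    using ch by (intro sum.cong) auto
  also have "\<dots> = (\<Sum>u\<in>{Minus, Plus}. \<Sum>i\<in>I. k (\<phi> u i) * ((if u = Plus then 1 else - 1) * flux p g i))"
    unfolding B_def by (subst sum.cartesian_product) (simp add: case_prod_beta)
  also have "\<dots> = (\<Sum>i\<in>I. flux p g i * (k (\<phi> Plus i) - k (\<phi> Minus i)))"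
    by (simp add: sum.distrib[symmetric] sum_negf[symmetric] algebra_simps sum_subtractf)
  finally show ?thesis .
qed

text \<open>Testing \<open>flow_identity\<close> with \<open>g\<close> itself turns the left side
  into the energy.\<close>

lemma sum_flux:
  assumes p: "1 < p" and g: "sympot g" "energy p g = Md p"
  shows "(\<Sum>i\<in>I. flux p g i) = Md p"
proof -
  have gp: "g \<in> pots" using g by (simp add: sympot_def)
  have "(\<Sum>i\<in>I. flux p g i) = (\<Sum>i\<in>I. flux p g i * (g (\<phi> Plus i) - g (\<phi> Minus i)))"
    using pots_\<phi>[OF gp] by (intro sum.cong) auto
  also have "\<dots> = (\<Sum>a\<in>E\<^sub>1. flow p g a * dif g a)" using flow_identity[OF assms] by simp
  also have "\<dots> = energy p g"
    unfolding energy_def flow_def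
  proof (intro sum.cong refl)
    fix a
    have "sgn (dif g a) * \<bar>dif g a\<bar> powr (p - 1) * dif g a = \<bar>dif g a\<bar> * \<bar>dif g a\<bar> powr (p - 1)"
      by (simp add: abs_sgn mult_ac)
    also have "\<dots> = \<bar>dif g a\<bar> powr p" by (cases "dif g a = 0") (auto simp: powr_mult_base)
    finally show "sgn (dif g a) * \<bar>dif g a\<bar> powr (p - 1) * dif g a = \<bar>dif g a\<bar> powr p" .
  qed
  finally show ?thesis using g by simp
qed

text \<open>The form of \<open>flow_identity\<close> used in inductions; agreement at common ends
  turns \<open>V\<close> into a function of vertices.\<close>

lemma flow_darts:
  assumes "1 < p" "sympot g" "energy p g = Md p"
    and V: "\<And>a b s t. a \<in> E\<^sub>1 \<Longrightarrow> b \<in> E\<^sub>1 \<Longrightarrow> l s a = l t b \<Longrightarrow> V s a = V t b"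
  shows "(\<Sum>a\<in>E\<^sub>1. flow p g a * (V Plus a - V Minus a)) =
    (\<Sum>i\<in>I. flux p g i * (V (ds Plus i) (da Plus i) - V (ds Minus i) (da Minus i)))"
proof -
  define k where "k v = (let x = SOME x. snd x \<in> E\<^sub>1 \<and> l (fst x) (snd x) = v in V (fst x) (snd x))" for v
  have k: "k (l s a) = V s a" if a: "a \<in> E\<^sub>1" for s a
  proof -
    let ?P = "\<lambda>x. snd x \<in> E\<^sub>1 \<and> l (fst x) (snd x) = l s a"
    have "?P (SOME x. ?P x)" by (rule someI[of ?P "(s, a)"]) (use a in auto)
    then show ?thesis using V[of "snd (SOME x. ?P x)" a "fst (SOME x. ?P x)" s] a unfolding k_def Let_def by blast
  qed
  have "k (\<phi> u i) = V (ds u i) (da u i)" if "i \<in> I" for u i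
    using k[OF da_in[OF that], of "ds u i" u] l_dart[OF that] by simp
  then show ?thesis using flow_identity[OF assms(1-3), of k] k by (simp add: dif_def)
qed

text \<open>\<open>bd \<sigma> s e\<close> says that the \<open>s\<close>-end of \<open>e\<close> lies on the side \<open>\<sigma>\<close> of the whole graph.\<close>

fun bd :: "side \<Rightarrow> side \<Rightarrow> 'e list \<Rightarrow> bool" where
  "bd \<sigma> s [] = False"
| "bd \<sigma> s [a] = (l s a \<in> boundary S \<sigma>)"
| "bd \<sigma> s (a # b # e) = (\<exists>t. \<exists>i\<in>I. bd \<sigma> t (b # e) \<and> l s a = \<phi> t i)"

lemma bd_Cons: "e \<noteq> [] \<Longrightarrow> bd \<sigma> s (a # e) = (\<exists>t. \<exists>i\<in>I. bd \<sigma> t e \<and> l s a = \<phi> t i)"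
  by (cases e) auto

lemma bd_dart: "e \<noteq> [] \<Longrightarrow> bd \<sigma> t e \<Longrightarrow> i \<in> I \<Longrightarrow> bd \<sigma> (ds t i) (da t i # e)"
  using l_dart[of i t] by (auto simp: bd_Cons)

lemma words_ne: "n \<ge> 1 \<Longrightarrow> e \<in> words A n \<Longrightarrow> e \<noteq> []"
  by (auto simp: words_def)

text \<open>Averaging a function of darts over the boundary fibres, with the fluxes as weights, reduces
  the level by one: the in- and outgoing fluxes agree by symmetry, so the product flow is conserved
  at the glued vertices.\<close>

lemma product_flow_ge:
  assumes p: "1 < p" and g: "sympot g" "energy p g = Md p" and n: "n \<ge> 1"
    and U: "\<And>e f s t. e \<in> W n \<Longrightarrow> f \<in> W n \<Longrightarrow> lb n s e = lb n t f \<Longrightarrow> U s e = U t f"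
    and U0: "\<And>e s. e \<in> W n \<Longrightarrow> bd Minus s e \<Longrightarrow> U s e \<le> 0"
    and Uc: "\<And>e s. e \<in> W n \<Longrightarrow> bd Plus s e \<Longrightarrow> c \<le> U s e"
  shows "c * Md p ^ n \<le> (\<Sum>e\<in>W n. weight (flow p g) e * (U Plus e - U Minus e))"
  using n U U0 Uc
proof (induction n arbitrary: U c rule: nat_induct_at_least)
  case base
  have fx: "0 \<le> flux p g i" for i by (simp add: flux_def)
  have "(\<Sum>e\<in>W 1. weight (flow p g) e * (U Plus e - U Minus e)) = (\<Sum>a\<in>E\<^sub>1. flow p g a * (U Plus [a] - U Minus [a]))"
    by (simp add: words_1 sum.reindex inj_on_def)
  also have "\<dots> = (\<Sum>i\<in>I. flux p g i * (U (ds Plus i) [da Plus i] - U (ds Minus i) [da Minus i]))"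
    by (rule flow_darts[OF p g, of "\<lambda>s a. U s [a]"]) (rule base(1), auto simp: words_1 lb_1)
  also have "\<dots> \<ge> (\<Sum>i\<in>I. flux p g i * c)"
  proof (intro sum_mono mult_left_mono fx)
    fix i assume i: "i \<in> I"
    have "[da u i] \<in> W 1" for u using da_in[OF i] by (auto simp: words_1)
    moreover have "bd u (ds u i) [da u i]" for u using l_dart[OF i] i by (auto simp: boundary_def)
    ultimately show "c \<le> U (ds Plus i) [da Plus i] - U (ds Minus i) [da Minus i]"
      using base(2)[of "[da Minus i]" "ds Minus i"] base(3)[of "[da Plus i]" "ds Plus i"] by fastforce
  qed
  also have "(\<Sum>i\<in>I. flux p g i * c) = c * Md p" by (simp add: sum_distrib_right[symmetric] sum_flux[OF p g])
  finally show ?case by simp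
next
  case (Suc n)
  have fx: "0 \<le> flux p g i" for i by (simp add: flux_def)
  define A where "A t f = (\<Sum>i\<in>I. flux p g i * U (ds t i) (da t i # f))" for t f
  \<comment> \<open>Averaging multiplies the gap between the two sides by the total flux
    \<open>Md p\<close>, so the induction hypothesis is used with this larger gap.\<close>
  have "c * Md p ^ Suc n = (c * Md p) * Md p ^ n" by simp
  also have "\<dots> \<le> (\<Sum>f\<in>W n. weight (flow p g) f * (A Plus f - A Minus f))"
  proof (rule Suc.IH)
    fix e f s t assume *: "e \<in> W n" "f \<in> W n" "lb n s e = lb n t f"
    show "A s e = A t f"
      unfolding A_def
    proof (intro sum.cong refl arg_cong2[where f = "(*)"])
      fix i assume i: "i \<in> I"
      show "U (ds s i) (da s i # e) = U (ds t i) (da t i # f)"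
        using Suc.prems(1) lb_cons_boundary[OF Suc.hyps *(1,2) i *(3)] da_in[OF i] * by simp
    qed
  next
    fix e s assume *: "e \<in> W n" "bd Minus s e"
    show "A s e \<le> 0"
      unfolding A_def
    proof (intro sum_nonpos mult_nonneg_nonpos fx)
      fix i assume i: "i \<in> I"
      show "U (ds s i) (da s i # e) \<le> 0"
        using * i da_in[OF i] words_ne[OF Suc.hyps] by (intro Suc.prems(2) bd_dart) auto
    qed
  next
    fix e s assume *: "e \<in> W n" "bd Plus s e"
    have "c * Md p = (\<Sum>i\<in>I. flux p g i * c)" by (simp add: sum_distrib_right[symmetric] sum_flux[OF p g])
    also have "\<dots> \<le> A s e"
      unfolding A_def
    proof (intro sum_mono mult_left_mono fx)
      fix i assume i: "i \<in> I"
      show "c \<le> U (ds s i) (da s i # e)"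
        using * i da_in[OF i] words_ne[OF Suc.hyps] by (intro Suc.prems(3) bd_dart) auto
    qed
    finally show "c * Md p \<le> A s e" .
  qed
  also have "\<dots> = (\<Sum>f\<in>W n. weight (flow p g) f * (\<Sum>a\<in>E\<^sub>1. flow p g a * (U Plus (a # f) - U Minus (a # f))))"
  proof (intro sum.cong refl arg_cong2[where f = "(*)"])
    fix f assume f: "f \<in> W n"
    have "(\<Sum>a\<in>E\<^sub>1. flow p g a * (U Plus (a # f) - U Minus (a # f))) =
      (\<Sum>i\<in>I. flux p g i * (U (ds Plus i) (da Plus i # f) - U (ds Minus i) (da Minus i # f)))"
    proof (rule flow_darts[OF p g, of "\<lambda>s a. U s (a # f)"])
      fix a b s t assume "a \<in> E\<^sub>1" "b \<in> E\<^sub>1" "l s a = l t b"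
      then show "U s (a # f) = U t (b # f)"
        using lb_Suc[of n a b f f s t] f Suc.hyps by (intro Suc.prems(1)) auto
    qed
    then show "A Plus f - A Minus f = (\<Sum>a\<in>E\<^sub>1. flow p g a * (U Plus (a # f) - U Minus (a # f)))"
      by (simp add: A_def right_diff_distrib sum_subtractf)
  qed
  also have "\<dots> = (\<Sum>f\<in>W n. \<Sum>a\<in>E\<^sub>1. weight (flow p g) (a # f) * (U Plus (a # f) - U Minus (a # f)))"
    by (simp add: sum_distrib_left mult_ac)
  also have "\<dots> = (\<Sum>a\<in>E\<^sub>1. \<Sum>f\<in>W n. weight (flow p g) (a # f) * (U Plus (a # f) - U Minus (a # f)))"
    by (rule sum.swap)
  also have "\<dots> = (\<Sum>(a, f)\<in>E\<^sub>1 \<times> W n. weight (flow p g) (a # f) * (U Plus (a # f) - U Minus (a # f)))"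
    by (rule sum.cartesian_product)
  also have "\<dots> = (\<Sum>e\<in>W (Suc n). weight (flow p g) e * (U Plus e - U Minus e))"
  proof -
    have "W (Suc n) = (\<lambda>(a, e). a # e) ` (E\<^sub>1 \<times> W n)" by (auto simp: words_Suc)
    then show ?thesis by (simp add: sum.reindex inj_on_def case_prod_beta)
  qed
  finally show ?case .
qed

text \<open>A Young-type inequality is tuned so that its first term sums to half of the lower bound
  in \<open>product_flow_ge\<close>, as the powers of \<open>w\<close> sum to
  \<open>Md p ^ n\<close>; that half is absorbed and the other half bounds the sum of the
  jumps.\<close>

lemma dif_powr_sum_ge:
  assumes p: "1 < p" and n: "n \<ge> 1" and c: "0 < c"
    and U: "\<And>e f s t. e \<in> W n \<Longrightarrow> f \<in> W n \<Longrightarrow> lb n s e = lb n t f \<Longrightarrow> U s e = U t f"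
    and U0: "\<And>e s. e \<in> W n \<Longrightarrow> bd Minus s e \<Longrightarrow> U s e \<le> 0"
    and Uc: "\<And>e s. e \<in> W n \<Longrightarrow> bd Plus s e \<Longrightarrow> c \<le> U s e"
  shows "(c / 2) powr p * Md p ^ n \<le> (\<Sum>e\<in>W n. \<bar>U Plus e - U Minus e\<bar> powr p)"
proof -
  obtain g where g: "sympot g" "energy p g = Md p" using symmetric_minimizer[of p] p by auto
  define w where "w e = weight (\<lambda>a. \<bar>dif g a\<bar>) e" for e
  define y where "y e = \<bar>U Plus e - U Minus e\<bar>" for e
  have w0: "0 \<le> w e" for e unfolding w_def by (induction e) auto
  have fw: "\<bar>weight (flow p g) e\<bar> = w e powr (p - 1)" for e
    unfolding w_def
  proof (induction e)
    case (Cons a e)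
    have "\<bar>flow p g a\<bar> = \<bar>dif g a\<bar> powr (p - 1)" using p by (cases "dif g a = 0") (auto simp: flow_def abs_mult)
    then show ?case using Cons by (simp add: abs_mult powr_mult)
  qed simp
  have sw: "(\<Sum>e\<in>W n. w e powr p) = Md p ^ n"
    using sum_weight_powr[OF finE, where \<rho> = "\<lambda>a. \<bar>dif g a\<bar>" and n = n and s = p] g(2) by (simp add: w_def energy_def)
  \<comment> \<open>Split at \<open>y e = (c / 2) * w e\<close>: on either side one of the two terms
    on the right suffices.\<close>
  have young: "w e powr (p - 1) * y e \<le> (c / 2) * w e powr p + (c / 2) powr (1 - p) * y e powr p" for e
  proof (cases "y e \<le> (c / 2) * w e")
    case True
    have "w e powr (p - 1) * y e \<le> w e powr (p - 1) * ((c / 2) * w e)" using True by (intro mult_left_mono) auto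
    also have "\<dots> = (c / 2) * (w e * w e powr (p - 1))" by simp
    also have "w e * w e powr (p - 1) = w e powr p"
      using w0[of e] by (cases "w e = 0") (auto simp: powr_mult_base)
    finally show ?thesis by (simp add: add_increasing2)
  next
    case False
    then have "w e \<le> y e / (c / 2)" using c by (simp add: field_simps)
    then have "w e powr (p - 1) \<le> (y e / (c / 2)) powr (p - 1)" using w0 p by (intro powr_mono2) auto
    also have "\<dots> = y e powr (p - 1) * (c / 2) powr (1 - p)"
    proof -
      have "(c / 2) powr (1 - p) = 1 / (c / 2) powr (p - 1)" using powr_minus_divide[of "c / 2" "p - 1"] by simp
      moreover have "(y e / (c / 2)) powr (p - 1) = y e powr (p - 1) / (c / 2) powr (p - 1)"
        by (rule powr_divide)
      ultimately show ?thesis by simp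
    qed
    finally have "w e powr (p - 1) * y e \<le> (y e powr (p - 1) * (c / 2) powr (1 - p)) * y e"
      by (intro mult_right_mono) (auto simp: y_def)
    also have "\<dots> = (c / 2) powr (1 - p) * (y e * y e powr (p - 1))" by simp
    also have "y e * y e powr (p - 1) = y e powr p"
      by (cases "y e = 0") (auto simp: powr_mult_base y_def)
    finally show ?thesis using c by (simp add: add_increasing)
  qed
  have "c * Md p ^ n \<le> (\<Sum>e\<in>W n. weight (flow p g) e * (U Plus e - U Minus e))"
    by (rule product_flow_ge[OF p g n U U0 Uc])
  also have "\<dots> \<le> (\<Sum>e\<in>W n. w e powr (p - 1) * y e)"
  proof (rule sum_mono)
    fix e
    have "weight (flow p g) e * (U Plus e - U Minus e) \<le> \<bar>weight (flow p g) e\<bar> * \<bar>U Plus e - U Minus e\<bar>"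
      by (metis abs_ge_self abs_mult)
    then show "weight (flow p g) e * (U Plus e - U Minus e) \<le> w e powr (p - 1) * y e" by (simp add: fw y_def)
  qed
  also have "\<dots> \<le> (\<Sum>e\<in>W n. (c / 2) * w e powr p + (c / 2) powr (1 - p) * y e powr p)"
    by (intro sum_mono young)
  also have "\<dots> = (c / 2) * Md p ^ n + (c / 2) powr (1 - p) * (\<Sum>e\<in>W n. y e powr p)"
    by (simp only: sum.distrib sum_distrib_left[symmetric] sw)
  finally have "(c / 2) * Md p ^ n \<le> (c / 2) powr (1 - p) * (\<Sum>e\<in>W n. y e powr p)" by simp
  then have "(c / 2) powr (p - 1) * ((c / 2) * Md p ^ n) \<le>
      (c / 2) powr (p - 1) * ((c / 2) powr (1 - p) * (\<Sum>e\<in>W n. y e powr p))"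
    by (intro mult_left_mono) auto
  moreover have "(c / 2) powr (p - 1) * (c / 2) powr (1 - p) = 1" using c by (simp add: powr_add[symmetric])
  moreover have "(c / 2) powr (p - 1) * (c / 2) = (c / 2) powr p" using c by (simp add: powr_diff)
  ultimately show ?thesis by (simp add: y_def mult.assoc[symmetric])
qed

section \<open>Points of the limit space over vertices\<close>

text \<open>Lifts a dart along the index \<open>i\<close> for ever, which turns a vertex of a finite
  level into a point of the limit space. The side is recorded because it decides which boundary edge
  comes next.\<close>

primrec rayw :: "side \<Rightarrow> 'e list \<Rightarrow> 'i \<Rightarrow> nat \<Rightarrow> side \<times> 'e list" where
  "rayw s e i 0 = (s, e)"
| "rayw s e i (Suc k) = (ds (fst (rayw s e i k)) i, da (fst (rayw s e i k)) i # snd (rayw s e i k))"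

lemma rayw_in: "i \<in> I \<Longrightarrow> e \<in> W n \<Longrightarrow> snd (rayw s e i k) \<in> W (n + k)"
  by (induction k) (auto simp: da_in)

lemma rayw_symbol:
  assumes i: "i \<in> I" and n: "n \<ge> 1" and e: "e \<in> W n"
  shows "\<exists>x\<in>\<Sigma>. \<forall>k. x (n + k) = snd (rayw s e i k)"
proof -
  define \<omega> where "\<omega> m = (if m < n then rev e ! m else da (fst (rayw s e i (m - n))) i)" for m
  have len: "length e = n" and sub: "set e \<subseteq> E\<^sub>1" using e by (auto simp: words_def)
  have "\<omega> m \<in> E\<^sub>1" for m using len sub nth_mem[of m "rev e"] da_in[OF i] by (auto simp: \<omega>_def)
  then have "symbol_of \<omega> \<in> \<Sigma>" by (rule symbol_of_in)
  moreover have "symbol_of \<omega> (n + k) = snd (rayw s e i k)" for k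
  proof (induction k)
    case 0
    have "map \<omega> [0..<n] = rev e" using len by (intro nth_equalityI) (auto simp: \<omega>_def)
    then show ?case using n by (simp add: symbol_of_nth)
  next
    case (Suc k)
    have "symbol_of \<omega> (n + Suc k) = \<omega> (n + k) # symbol_of \<omega> (n + k)"
      using n by (simp add: symbol_of_nth)
    moreover have "\<omega> (n + k) = da (fst (rayw s e i k)) i" by (simp add: \<omega>_def)
    ultimately show ?case using Suc by simp
  qed
  ultimately show ?thesis by blast
qed

definition ray :: "'i \<Rightarrow> nat \<Rightarrow> side \<Rightarrow> 'e list \<Rightarrow> nat \<Rightarrow> 'e list" where
  "ray i n s e = (SOME x. x \<in> \<Sigma> \<and> (\<forall>k. x (n + k) = snd (rayw s e i k)))"

lemma ray:
  assumes "i \<in> I" "n \<ge> 1" "e \<in> W n"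
  shows "ray i n s e \<in> \<Sigma>" "ray i n s e (n + k) = snd (rayw s e i k)" "ray i n s e n = e"
proof -
  have "\<exists>x. x \<in> \<Sigma> \<and> (\<forall>k. x (n + k) = snd (rayw s e i k))" using rayw_symbol[OF assms] by blast
  from someI_ex[OF this] have *: "ray i n s e \<in> \<Sigma> \<and> (\<forall>k. ray i n s e (n + k) = snd (rayw s e i k))"
    unfolding ray_def .
  then show "ray i n s e \<in> \<Sigma>" "ray i n s e (n + k) = snd (rayw s e i k)" by auto
  show "ray i n s e n = e" using conjunct2[OF *, THEN spec, of 0] by simp
qed

lemma touch_down:
  assumes "s \<in> \<Sigma>" "t \<in> \<Sigma>" "1 \<le> m" "m \<le> n" "touch n (s n) (t n)"
  shows "touch m (s m) (t m)"
  using assms(4,5)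
proof (induction n rule: dec_induct)
  case (step n)
  then have n: "n \<ge> 1" using assms by simp
  obtain a where a: "a \<in> E\<^sub>1" "s (Suc n) = a # s n" using symbol_Suc assms n by blast
  obtain b where b: "b \<in> E\<^sub>1" "t (Suc n) = b # t n" using symbol_Suc assms n by blast
  have "touch n (s n) (t n)"
    using touch_tl[OF n, of a "s n" b "t n"] symbol_in_words[OF assms(1), of n] symbol_in_words[OF assms(2), of n]
      a b n step.prems by simp
  then show ?case by (rule step.IH)
qed

text \<open>The lifts of a common vertex along \<open>i\<close> share a vertex on every later level,
  so the point obtained depends on the vertex alone.\<close>

lemma ray_rel:
  assumes i: "i \<in> I" and n: "n \<ge> 1" and e: "e \<in> W n" "f \<in> W n" and eq: "lb n s e = lb n t f"
  shows "(ray i n s e, ray i n t f) \<in> limit_rel S"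
proof -
  have "lb (n + k) (fst (rayw s e i k)) (snd (rayw s e i k)) = lb (n + k) (fst (rayw t f i k)) (snd (rayw t f i k))" for k
  proof (induction k)
    case (Suc k)
    show ?case
      using lb_cons_boundary[OF _ rayw_in[OF i e(1)] rayw_in[OF i e(2)] i Suc] n by simp
  qed (use eq in simp)
  note eqk = this
  have up: "touch (n + k) (ray i n s e (n + k)) (ray i n t f (n + k))" for k
  proof -
    have "touch (n + k) (snd (rayw s e i k)) (snd (rayw t f i k))"
      using touch_iff[of "n + k"] rayw_in[OF i e(1)] rayw_in[OF i e(2)] n eqk[of k] by (meson trans_le_add1)
    then show ?thesis using ray(2)[OF i n e(1)] ray(2)[OF i n e(2)] by simp
  qed
  have "touch m (ray i n s e m) (ray i n t f m)" if m: "m \<ge> 1" for m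
    using touch_down[OF ray(1)[OF i n e(1)] ray(1)[OF i n e(2)] m _ up[of m]] by simp
  then show ?thesis using ray(1)[OF i n] e by (simp add: limit_rel_iff)
qed

lemma bd_ex:
  assumes "n \<ge> 1"
  shows "\<exists>e\<in>W n. \<exists>s. bd \<sigma> s e"
  using assms
proof (induction n rule: nat_induct_at_least)
  case base
  obtain i where i: "i \<in> I" using I_ne by auto
  then have "[da \<sigma> i] \<in> W 1" "bd \<sigma> (ds \<sigma> i) [da \<sigma> i]" using da_in l_dart by (auto simp: words_1 boundary_def)
  then show ?case by blast
next
  case (Suc n)
  then obtain e s where e: "e \<in> W n" "bd \<sigma> s e" by blast
  obtain i where i: "i \<in> I" using I_ne by auto
  have "da s i # e \<in> W (Suc n)" "bd \<sigma> (ds s i) (da s i # e)"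
    using e i da_in[OF i] words_ne[OF Suc.hyps e(1)] bd_dart by auto
  then show ?case by blast
qed

text \<open>Reduces the separation of the two sides to level 2, uniformly in
  \<open>n\<close>.\<close>

lemma bd_drop:
  assumes "n \<ge> 2" "e \<in> W n" "bd \<sigma> s e"
  shows "\<exists>s'. bd \<sigma> s' (drop (n - 2) e)"
  using assms
proof (induction n arbitrary: e s rule: nat_induct_at_least)
  case (Suc n)
  then obtain a f where e: "e = a # f" "f \<in> W n" by (auto simp: words_Suc)
  then obtain t where "bd \<sigma> t f" using Suc.prems words_ne[of n f] Suc.hyps by (auto simp: bd_Cons)
  then have "\<exists>s'. bd \<sigma> s' (drop (n - 2) f)" by (rule Suc.IH[OF e(2)])
  moreover have eq: "Suc n - 2 = Suc (n - 2)" using Suc.hyps by arith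
  ultimately show ?case unfolding eq e(1) drop_Suc_Cons by simp
qed auto

text \<open>On level 1 edges at opposite sides may share an interior vertex, which is why level 2 is
  used. Touching edges here either have the same parent, which would then have two boundary ends, or
  are glued over a vertex lying on both sides.\<close>

lemma bd_not_touch:
  assumes e: "e \<in> W 2" "f \<in> W 2" and bd: "bd Minus s e" "bd Plus t f"
  shows "\<not> touch 2 e f"
proof
  assume tc: "touch 2 e f"
  have 2: "(2::nat) = Suc (Suc 0)" by simp
  obtain b a where ba: "e = [b, a]" "a \<in> E\<^sub>1" "b \<in> E\<^sub>1"
    using e(1) unfolding 2 words_Suc by (auto simp: words_def)
  obtain b' a' where ba': "f = [b', a']" "a' \<in> E\<^sub>1" "b' \<in> E\<^sub>1"
    using e(2) unfolding 2 words_Suc by (auto simp: words_def)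
  obtain u i where ui: "i \<in> I" "l u a \<in> boundary S Minus" "l s b = \<phi> u i" using bd(1) ba by auto
  obtain u' i' where ui': "i' \<in> I" "l u' a' \<in> boundary S Plus" "l t b' = \<phi> u' i'" using bd(2) ba' by auto
  obtain x y where "lb (Suc 1) x (b # [a]) = lb (Suc 1) y (b' # [a'])"
    using tc touch_iff[of 2 e f] e ba ba' by (auto simp: numeral_2_eq_2)
  then consider "a = a'" | j v v' where "j \<in> I" "l x b = \<phi> v j" "l y b' = \<phi> v' j" "lb 1 v [a] = lb 1 v' [a']"
    using lb_Suc[of 1 b b' "[a]" "[a']" x y] ba ba' by (auto simp: words_1)
  then show False
  proof cases
    case 1
    obtain i1 j1 where ij: "i1 \<in> I" "j1 \<in> I" "l u a = \<phi> Minus i1" "l u' a = \<phi> Plus j1"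
      using ui(2) ui'(2) 1 by (auto simp: boundary_def)
    then have "u = u'" using boundary_side ba by blast
    then show False using ij \<phi>_eq_iff[of i1 j1 Minus Plus] by auto
  next
    case 2
    have "s = x" using boundary_side[OF ba(3) ui(1) 2(1) ui(3) 2(2)] .
    then have "u = v" using ui 2 \<phi>_eq_iff[of i j u v] by auto
    have "t = y" using boundary_side[OF ba'(3) ui'(1) 2(1) ui'(3) 2(3)] .
    then have "u' = v'" using ui' 2 \<phi>_eq_iff[of i' j u' v'] by auto
    then have "l u a = l u' a'" using 2(4) \<open>u = v\<close> by (simp add: lb_1)
    then show False using ui(2) ui'(2) boundary_disj by auto
  qed
qed

text \<open>Here \<open>a\<close> is any edge, \<open>s\<close> an end of it off the boundary, and
  \<open>b\<close> the child edge placed at that end. The other end of \<open>b\<close> is interior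
  to its copy of the generator, so \<open>b # a # e\<close> shares vertices only with edges inside
  \<open>e\<close>.\<close>

lemma interior_subedge:
  "\<exists>a\<in>E\<^sub>1. \<exists>b\<in>E\<^sub>1. \<forall>n\<ge>1. \<forall>e\<in>W n. \<forall>f\<in>W (Suc (Suc n)). touch (Suc (Suc n)) (b # a # e) f \<longrightarrow> drop 2 f = e"
proof -
  obtain i where i: "i \<in> I" using I_ne by auto
  obtain a where a: "a \<in> E\<^sub>1" using E1_ne by auto
  obtain s where s: "\<And>u j. j \<in> I \<Longrightarrow> l s a \<noteq> \<phi> u j"
    using boundary_side[OF a] by (metis side.distinct(1))
  define b where "b = da s i"
  have b: "b \<in> E\<^sub>1" "l (ds s i) b = \<phi> s i" using da_in l_dart i by (auto simp: b_def)
  have "drop 2 f = e" if n: "n \<ge> 1" and e: "e \<in> W n" and f: "f \<in> W (Suc (Suc n))"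
    and tc: "touch (Suc (Suc n)) (b # a # e) f" for n e f
  proof -
    obtain b' a' e' where f': "f = b' # a' # e'" "b' \<in> E\<^sub>1" "a' \<in> E\<^sub>1" "e' \<in> W n"
      using f by (auto simp: words_Suc)
    obtain x y where xy: "lb (Suc (Suc n)) x (b # a # e) = lb (Suc (Suc n)) y (b' # a' # e')"
      using tc touch_iff[of "Suc (Suc n)" "b # a # e" f] f f' a b e by auto
    have "e' = e"
    proof -
      from xy consider "a # e = a' # e'" | j u v where "j \<in> I" "l x b = \<phi> u j" "l y b' = \<phi> v j"
        "lb (Suc n) u (a # e) = lb (Suc n) v (a' # e')"
        using lb_Suc[of "Suc n" b b' "a # e" "a' # e'" x y] f' a b e by auto
      then show ?thesis
      proof cases
        case 2
        have "ds s i = x" using boundary_side[OF b(1) i 2(1) b(2) 2(2)] .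
        then have "u = s" using b(2) 2 \<phi>_eq_iff[OF 2(1) i, of u s] by auto
        then show ?thesis using lb_Suc[OF n a f'(3) e f'(4), of u v] 2(4) s by auto
      qed auto
    qed
    then show ?thesis using f' by simp
  qed
  then show ?thesis using a b by blast
qed

end

section \<open>Lower bound for the conformal dimension\<close>

lemma quasisymmetric_gauge_bound:
  assumes "homeomorphic_map (top_of_set {0..}) (top_of_set {0..}) (\<psi> :: real \<Rightarrow> real)"
  shows "\<exists>K\<ge>1. \<forall>t. 0 \<le> t \<and> t \<le> T \<longrightarrow> \<psi> t \<le> K"
proof -
  have "continuous_map (top_of_set {0..}) (top_of_set {0..}) \<psi>" using assms by (rule homeomorphic_imp_continuous_map)
  then have "continuous_on {0..} \<psi>" by simp
  then have "continuous_on {0..T} \<psi>" by (rule continuous_on_subset) auto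
  then have "compact (\<psi> ` {0..T})" by (intro compact_continuous_image) auto
  then obtain B where "\<forall>x\<in>\<psi> ` {0..T}. norm x \<le> B" using compact_imp_bounded bounded_iff by metis
  then have "\<psi> t \<le> max 1 B" if "0 \<le> t" "t \<le> T" for t using that by (force simp: le_max_iff_disj)
  then show ?thesis by (intro exI[of _ "max 1 B"]) auto
qed

text \<open>Mass distribution principle: for s < Q a set of small diameter d has measure at most a
  constant times \<open>d powr s\<close>, so a vanishing s-dimensional measure would force the total
  mass to vanish.\<close>

lemma hausdorff_dim_ge:
  assumes AR: "ahlfors_regular M \<delta> Q" and xy: "x \<in> M" "y \<in> M" "x \<noteq> y"
  shows "ennreal Q \<le> hausdorff_dim M \<delta>"
  unfolding hausdorff_dim_def
proof (rule Inf_greatest, clarify)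
  fix s :: real assume s: "0 < s" and H: "hausdorff_meas M \<delta> s = 0"
  interpret Metric_space M \<delta> using AR by (simp add: ahlfors_regular_def)
  obtain \<mu> C where Q: "0 < Q" and \<mu>: "radon_measure mtopology \<mu>" "C \<ge> 1"
    and reg: "\<And>x r. x \<in> M \<Longrightarrow> 0 < r \<Longrightarrow> ennreal r \<le> 2 * ediam \<delta> M \<Longrightarrow>
      ennreal (inverse C * r powr Q) \<le> emeasure \<mu> (mball x r) \<and> emeasure \<mu> (mball x r) \<le> ennreal (C * r powr Q)"
    using AR unfolding ahlfors_regular_def by blast
  have sp: "space \<mu> = M" and se: "sets \<mu> = sigma_sets M {U. openin mtopology U}"
    using \<mu>(1) by (auto simp: radon_measure_def)
  have op: "U \<in> sets \<mu>" if "openin mtopology U" for U using that se by auto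
  show "ennreal Q \<le> ennreal s"
  proof (rule ccontr)
    assume "\<not> ennreal Q \<le> ennreal s"
    then have sQ: "s < Q" using s Q by (auto simp: ennreal_le_iff)
    \<comment> \<open>At most 1, so that \<open>d powr Q\<close> is below \<open>d powr s\<close>;
      at most \<open>\<delta> x y\<close>, so that the radii used stay in the range of the
      regularity bounds.\<close>
    define \<epsilon> where "\<epsilon> = min 1 (\<delta> x y)"
    have \<epsilon>: "0 < \<epsilon>" "\<epsilon> \<le> 1" using mdist_pos_less[OF xy(3,1,2)] by (auto simp: \<epsilon>_def)
    have diam: "ennreal (\<delta> a b) \<le> ediam \<delta> A" if "a \<in> A" "b \<in> A" for a b A
      unfolding ediam_def using that by (meson SUP_upper2 order_refl)
    have \<epsilon>M: "ennreal \<epsilon> \<le> ediam \<delta> M"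
    proof -
      have "ennreal \<epsilon> \<le> ennreal (\<delta> x y)" by (intro ennreal_leI) (simp add: \<epsilon>_def)
      then show ?thesis using diam[OF xy(1,2)] by (rule order_trans)
    qed
    have ball_small: "\<exists>B\<in>sets \<mu>. A \<subseteq> B \<and> emeasure \<mu> B \<le> ennreal (C * 2 powr Q) * ennreal (enn2real (ediam \<delta> A) powr s)"
      if A: "A \<subseteq> M" "ediam \<delta> A \<le> ennreal \<epsilon>" for A
    proof (cases "A = {}")
      case False
      then obtain a where a: "a \<in> A" "a \<in> M" using A by auto
      define d where "d = enn2real (ediam \<delta> A)"
      have "ediam \<delta> A < top" using A(2) ennreal_less_top by (rule order_le_less_trans)
      then have dA: "ediam \<delta> A = ennreal d" unfolding d_def by (rule ennreal_enn2real[symmetric])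
      have "ennreal d \<le> ennreal \<epsilon>" using A(2) dA by simp
      then have d: "0 \<le> d" "d \<le> \<epsilon>" using \<epsilon> by (auto simp: d_def)
      have ab: "\<delta> a b \<le> d" if "b \<in> A" for b
        using diam[OF a(1) that] dA d by simp
      show ?thesis
      proof (cases "d = 0")
        \<comment> \<open>No ball of radius \<open>2 * d\<close> is available; the set is a single
          point, which is null by letting the radius tend to 0.\<close>
        case True
        have "A \<subseteq> {a}"
        proof
          fix b assume b: "b \<in> A"
          then have "\<delta> a b = 0" using ab[OF b] True nonneg[of a b] by simp
          then show "b \<in> {a}" using zero[of a b] a b A by auto
        qed
        moreover have "emeasure \<mu> {a} = 0"
        proof -
          have sing: "emeasure \<mu> {a} \<le> ennreal (C * r powr Q)" if r: "0 < r" "r \<le> \<epsilon>" for r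
          proof -
            have "ennreal r \<le> ennreal \<epsilon>" using r by (intro ennreal_leI)
            also have "\<dots> \<le> 2 * ediam \<delta> M" using \<epsilon>M by (metis add_increasing mult_2 order_trans zero_le order_refl)
            finally have "emeasure \<mu> (mball a r) \<le> ennreal (C * r powr Q)" using reg a r by blast
            moreover have "emeasure \<mu> {a} \<le> emeasure \<mu> (mball a r)"
              using a r op[OF openin_mball] by (intro emeasure_mono) auto
            ultimately show ?thesis by simp
          qed
          have "((\<lambda>r. ennreal (C * r powr Q)) \<longlongrightarrow> ennreal (C * 0 powr Q)) (at_right 0)"
            using Q by (intro tendsto_ennrealI tendsto_intros tendsto_powr')
              (auto intro: eventually_mono[OF eventually_at_right_less[of 0]])
          moreover have "\<forall>\<^sub>F r in at_right 0. emeasure \<mu> {a} \<le> ennreal (C * r powr Q)"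
            unfolding eventually_at_right_field using sing \<epsilon> by (intro exI[of _ \<epsilon>]) auto
          ultimately have "emeasure \<mu> {a} \<le> ennreal (C * 0 powr Q)"
            by (intro tendsto_lowerbound[of _ _ "at_right (0::real)"]) auto
          then show ?thesis using Q by simp
        qed
        moreover have "{a} \<in> sets \<mu>"
        proof -
          have "closedin mtopology {a}" using a by (intro closedin_Hausdorff_sing_eq[THEN iffD2] Hausdorff_space_mtopology) auto
          then have "openin mtopology (M - {a})" by (auto simp: closedin_def)
          then have "space \<mu> - (M - {a}) \<in> sets \<mu>" using op by blast
          moreover have "space \<mu> - (M - {a}) = {a}" using a sp by auto
          ultimately show ?thesis by simp
        qed
        ultimately show ?thesis by (intro bexI[of _ "{a}"]) auto
      next
        case False
        then have d0: "0 < d" using d by simp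
        have "ennreal (2 * d) \<le> 2 * ediam \<delta> M"
        proof -
          have "ennreal (2 * d) = 2 * ennreal d" using d by (simp add: ennreal_mult')
          also have "\<dots> \<le> 2 * ediam \<delta> M"
            using d \<epsilon>M by (intro mult_left_mono) (auto intro: order_trans ennreal_leI)
          finally show ?thesis .
        qed
        then have "emeasure \<mu> (mball a (2 * d)) \<le> ennreal (C * (2 * d) powr Q)" using reg[OF a(2), of "2 * d"] d0 by simp
        also have "C * (2 * d) powr Q = (C * 2 powr Q) * d powr Q" by (simp add: powr_mult)
        also have "ennreal \<dots> \<le> ennreal ((C * 2 powr Q) * d powr s)"
          using \<mu>(2) sQ d d0 \<epsilon> by (intro ennreal_leI mult_left_mono powr_mono') auto
        also have "\<dots> = ennreal (C * 2 powr Q) * ennreal (d powr s)" using \<mu>(2) by (intro ennreal_mult) auto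
        finally have "emeasure \<mu> (mball a (2 * d)) \<le> ennreal (C * 2 powr Q) * ennreal (d powr s)" .
        moreover have "A \<subseteq> mball a (2 * d)"
        proof
          fix b assume "b \<in> A"
          then show "b \<in> mball a (2 * d)" using ab[of b] a A d0 by auto
        qed
        ultimately show ?thesis using op[OF openin_mball] by (auto simp: d_def)
      qed
    qed (use op in \<open>auto intro!: bexI[of _ "{}"]\<close>)
    have "hausdorff_content M \<delta> s \<epsilon> \<le> hausdorff_meas M \<delta> s"
      unfolding hausdorff_meas_def using \<epsilon> by (intro SUP_upper) auto
    then have H0: "hausdorff_content M \<delta> s \<epsilon> = 0" using H by simp
    let ?C = "C * 2 powr Q"
    have Cpos: "0 < ?C" using \<mu>(2) by simp
    have small: "emeasure \<mu> M \<le> ennreal (?C * \<eta>)" if \<eta>: "0 < \<eta>" for \<eta>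
    proof -
      have "hausdorff_content M \<delta> s \<epsilon> < ennreal \<eta>" using H0 \<eta> by simp
      then obtain U :: "nat \<Rightarrow> 'a set" where U: "\<And>i. U i \<subseteq> M \<and> ediam \<delta> (U i) \<le> ennreal \<epsilon>" "M \<subseteq> (\<Union>i. U i)"
        "(\<Sum>i. ennreal (enn2real (ediam \<delta> (U i)) powr s)) < ennreal \<eta>"
        unfolding hausdorff_content_def Inf_less_iff by blast
      have "\<forall>i. \<exists>B\<in>sets \<mu>. U i \<subseteq> B \<and> emeasure \<mu> B \<le> ennreal ?C * ennreal (enn2real (ediam \<delta> (U i)) powr s)"
        using ball_small U(1) by blast
      then obtain B where B: "\<And>i. B i \<in> sets \<mu>" "\<And>i. U i \<subseteq> B i"
        "\<And>i. emeasure \<mu> (B i) \<le> ennreal ?C * ennreal (enn2real (ediam \<delta> (U i)) powr s)" by metis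
      have "emeasure \<mu> M \<le> emeasure \<mu> (\<Union>i. B i)"
        using U(2) B(1,2) by (intro emeasure_mono) (blast, auto)
      also have "\<dots> \<le> (\<Sum>i. emeasure \<mu> (B i))" using B(1) by (intro emeasure_subadditive_countably) auto
      also have "\<dots> \<le> (\<Sum>i. ennreal ?C * ennreal (enn2real (ediam \<delta> (U i)) powr s))" using B(3) by (intro suminf_le) auto
      also have "\<dots> = ennreal ?C * (\<Sum>i. ennreal (enn2real (ediam \<delta> (U i)) powr s))" by simp
      also have "\<dots> \<le> ennreal ?C * ennreal \<eta>" using U(3) by (intro mult_left_mono) auto
      also have "\<dots> = ennreal (?C * \<eta>)" using Cpos \<eta> by (simp add: ennreal_mult)
      finally show ?thesis .
    qed
    have pos: "ennreal (inverse C * \<epsilon> powr Q) \<le> emeasure \<mu> M"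
    proof -
      have "ennreal \<epsilon> \<le> 2 * ediam \<delta> M" using \<epsilon>M by (metis add_increasing mult_2 order_trans zero_le order_refl)
      then have "ennreal (inverse C * \<epsilon> powr Q) \<le> emeasure \<mu> (mball x \<epsilon>)" using reg[OF xy(1) \<epsilon>(1)] by blast
      also have "\<dots> \<le> emeasure \<mu> M"
      proof (rule emeasure_mono)
        show "M \<in> sets \<mu>" using sets.top[of \<mu>] sp by simp
      qed auto
      finally show ?thesis .
    qed
    define \<eta> where "\<eta> = inverse C * \<epsilon> powr Q / (2 * ?C)"
    have "0 < inverse C * \<epsilon> powr Q" using \<mu>(2) \<epsilon> by simp
    moreover have half: "?C * \<eta> = inverse C * \<epsilon> powr Q / 2" using \<mu>(2) by (simp add: \<eta>_def)
    ultimately have \<eta>: "0 < \<eta>" "?C * \<eta> < inverse C * \<epsilon> powr Q" using Cpos unfolding \<eta>_def by (auto simp del: mult_eq_0_iff)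
    have "ennreal (inverse C * \<epsilon> powr Q) \<le> ennreal (?C * \<eta>)" using pos small[OF \<eta>(1)] by (rule order_trans)
    then have "inverse C * \<epsilon> powr Q \<le> ?C * \<eta>"
      using mult_pos_pos[OF Cpos \<eta>(1)] by (subst (asm) ennreal_le_iff) auto
    then show False using \<eta>(2) by simp
  qed
qed

context weighted_igs
begin

text \<open>One of \<open>y1\<close>, \<open>y2\<close> has \<delta>-distance from \<open>x\<close>
  at least half of their mutual distance. Quasisymmetry compares this distance with
  \<open>\<delta> x z\<close>, the ratio in the old metric being at most
  \<open>Dmax / c\<close>.\<close>

lemma quasisymmetric_separation:
  assumes qs: "quasisymmetric X dX \<delta>" and c: "0 < c" and y: "y1 \<in> X" "y2 \<in> X" "y1 \<noteq> y2"
  shows "\<exists>m>0. \<forall>x\<in>X. \<forall>z\<in>X. c \<le> dX x z \<longrightarrow> m \<le> \<delta> x z"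
proof -
  interpret B: Metric_space X \<delta> using qs by (simp add: quasisymmetric_def)
  obtain \<psi> where \<psi>: "homeomorphic_map (top_of_set {0..}) (top_of_set {0..}) (\<psi> :: real \<Rightarrow> real)"
    "\<And>x y z. x \<in> X \<Longrightarrow> y \<in> X \<Longrightarrow> z \<in> X \<Longrightarrow> x \<noteq> z \<Longrightarrow> \<delta> x y / \<delta> x z \<le> \<psi> (dX x y / dX x z)"
    using qs unfolding quasisymmetric_def by blast
  obtain K where K: "K \<ge> 1" "\<And>t. 0 \<le> t \<Longrightarrow> t \<le> Dmax / c \<Longrightarrow> \<psi> t \<le> K"
    using quasisymmetric_gauge_bound[OF \<psi>(1)] by blast
  define m where "m = \<delta> y1 y2 / (2 * K)"
  have y12: "0 < \<delta> y1 y2" using B.mdist_pos_less y by blast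
  have "m \<le> \<delta> x z" if xz: "x \<in> X" "z \<in> X" "c \<le> dX x z" for x z
  proof -
    have ne: "x \<noteq> z" using xz c mdist_zero by force
    have pz: "0 < \<delta> x z" using B.mdist_pos_less[OF ne xz(1,2)] .
    have "\<delta> y1 y2 \<le> \<delta> x y1 + \<delta> x y2" using B.triangle[OF y(1) xz(1) y(2)] B.commute[of y1 x] by simp
    then obtain w where w: "w \<in> X" "\<delta> y1 y2 / 2 \<le> \<delta> x w" using y
      by (metis add_mono field_sum_of_halves linorder_not_le add_strict_mono)
    have "dX x w / dX x z \<le> Dmax / c"
      using dX_le_Dmax[OF xz(1) w(1)] xz c Dmax_pos by (intro frac_le) auto
    then have "\<psi> (dX x w / dX x z) \<le> K" by (intro K) auto
    then have "\<delta> x w / \<delta> x z \<le> K" using \<psi>(2)[OF xz(1) w(1) xz(2) ne] by simp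
    then have "\<delta> x w \<le> K * \<delta> x z" using pz by (simp add: field_simps)
    then have "\<delta> y1 y2 / 2 \<le> K * \<delta> x z" using w by simp
    then show ?thesis using K(1) by (simp add: m_def field_simps)
  qed
  moreover have "0 < m" using y12 K by (simp add: m_def)
  ultimately show ?thesis by blast
qed

text \<open>Quasisymmetry turns the disjoint balls inside the cells into disjoint \<open>\<delta>\<close>-balls of radius
  comparable to the \<open>\<delta>\<close>-diameters of the cells.\<close>

lemma ahlfors_packing:
  assumes qs: "quasisymmetric X dX \<delta>" and AR: "ahlfors_regular X \<delta> Q"
  shows "\<exists>K\<ge>0. \<exists>z. \<forall>n\<ge>1. (\<forall>e\<in>W n. z n e \<in> X) \<and>
    (\<forall>y. (\<forall>e\<in>W n. y e \<in> cell n e) \<longrightarrow> (\<Sum>e\<in>W n. \<delta> (z n e) (y e) powr Q) \<le> K)"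
proof -
  interpret B: Metric_space X \<delta> using qs by (simp add: quasisymmetric_def)
  obtain \<psi> where \<psi>: "homeomorphic_map (top_of_set {0..}) (top_of_set {0..}) (\<psi> :: real \<Rightarrow> real)"
    "\<And>x y z. x \<in> X \<Longrightarrow> y \<in> X \<Longrightarrow> z \<in> X \<Longrightarrow> x \<noteq> z \<Longrightarrow> \<delta> x y / \<delta> x z \<le> \<psi> (dX x y / dX x z)"
    using qs unfolding quasisymmetric_def by blast
  obtain \<mu> C where Q: "0 < Q" and \<mu>: "radon_measure B.mtopology \<mu>" "C \<ge> 1"
    and reg: "\<And>x r. x \<in> X \<Longrightarrow> 0 < r \<Longrightarrow> ennreal r \<le> 2 * ediam \<delta> X \<Longrightarrow>
      ennreal (inverse C * r powr Q) \<le> emeasure \<mu> (B.mball x r)"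
    using AR unfolding ahlfors_regular_def by blast
  have sp: "space \<mu> = X" and se: "sets \<mu> = sigma_sets X {U. openin B.mtopology U}"
    using \<mu>(1) by (auto simp: radon_measure_def)
  have op: "U \<in> sets \<mu>" if "openin B.mtopology U" for U using that se by auto
  have "B.mtopology = mtopology"
    using qs unfolding quasisymmetric_def homeomorphic_map_id by blast
  then have "compactin B.mtopology X" using compact_space_X by (simp add: compact_space_def)
  then have fin: "emeasure \<mu> X < \<infinity>" using \<mu>(1) unfolding radon_measure_def by blast
  then interpret \<mu>: finite_measure \<mu> using sp by (intro finite_measureI) auto
  obtain a b where ab: "a \<in> E\<^sub>1" "b \<in> E\<^sub>1"
    "\<And>n e f. n \<ge> 1 \<Longrightarrow> e \<in> W n \<Longrightarrow> f \<in> W (Suc (Suc n)) \<Longrightarrow> touch (Suc (Suc n)) (b # a # e) f \<Longrightarrow> drop 2 f = e"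
    using interior_subedge by blast
  define zs where "zs n e = (SOME s. s \<in> \<Sigma> \<and> s (Suc (Suc n)) = b # a # e)" for n e
  have zs: "zs n e \<in> \<Sigma>" "zs n e (Suc (Suc n)) = b # a # e" "zs n e n = e" if "n \<ge> 1" "e \<in> W n" for n e
  proof -
    have "\<exists>s. s \<in> \<Sigma> \<and> s (Suc (Suc n)) = b # a # e" using symbol_extend[of "b # a # e" "Suc (Suc n)"] ab that by auto
    from someI_ex[OF this] have *: "zs n e \<in> \<Sigma>" "zs n e (Suc (Suc n)) = b # a # e" by (auto simp: zs_def)
    then show "zs n e \<in> \<Sigma>" "zs n e (Suc (Suc n)) = b # a # e" by auto
    show "zs n e n = e" using symbol_drop[OF *(1) that(1), of "Suc (Suc n)"] *(2) by simp
  qed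
  define z where "z n e = cls (zs n e)" for n e
  \<comment> \<open>One factor \<open>rmin\<close> for each of the letters \<open>a\<close> and
    \<open>b\<close>, and one from \<open>D_not_touch_ge\<close>.\<close>
  define c where "c = rmin ^ 3"
  have c: "0 < c" using rmin_pos by (simp add: c_def)
  have near: "t n = e" if n: "n \<ge> 1" and e: "e \<in> W n" and t: "t \<in> \<Sigma>" and D: "D (zs n e) t < c * wt e" for n e t
  proof -
    have "c * wt e = rmin * (rmin * (rmin * wt e))" by (simp add: c_def power3_eq_cube)
    also have "\<dots> \<le> rmin * (\<rho> b * (\<rho> a * wt e))"
      using rmin_pos rmin_le ab wt_pos[OF e] \<rho>_pos by (intro mult_left_mono mult_mono) (auto intro: less_imp_le)
    also have "\<dots> = rmin * wt (zs n e (Suc (Suc n)))" using zs[OF n e] by simp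
    finally have "touch (Suc (Suc n)) (zs n e (Suc (Suc n))) (t (Suc (Suc n)))"
      using D D_not_touch_ge[OF zs(1)[OF n e] t, of "Suc (Suc n)"] by force
    then have "drop 2 (t (Suc (Suc n))) = e"
      using ab(3)[OF n e symbol_in_words[OF t]] zs(2)[OF n e] by simp
    then show ?thesis using symbol_drop[OF t n, of "Suc (Suc n)"] by (simp add: numeral_2_eq_2)
  qed
  \<comment> \<open>\<open>Cup / c\<close> is the ratio of the diameter bound of a cell to the
    radius of the ball inside it, so \<open>K\<close> is the price of passing to \<delta>.\<close>
  obtain K where K: "K \<ge> 1" "\<And>t. 0 \<le> t \<Longrightarrow> t \<le> Cup / c \<Longrightarrow> \<psi> t \<le> K"
    using quasisymmetric_gauge_bound[OF \<psi>(1)] by blast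
  have zX: "z n e \<in> X" "z n e \<in> cell n e" if "n \<ge> 1" "e \<in> W n" for n e
    using zs[OF that] cls_in_X by (auto simp: z_def cell_def)
  have ball_in: "B.mball (z n e) (\<delta> (z n e) y / K) \<subseteq> mball (z n e) (c * wt e)"
    if n: "n \<ge> 1" and e: "e \<in> W n" and y: "y \<in> cell n e" for n e y
  proof
    fix x assume x: "x \<in> B.mball (z n e) (\<delta> (z n e) y / K)"
    have yX: "y \<in> X" using y cell_sub by blast
    show "x \<in> mball (z n e) (c * wt e)"
    proof (rule ccontr)
      assume "x \<notin> mball (z n e) (c * wt e)"
      then have d: "c * wt e \<le> dX (z n e) x" using x zX(1)[OF n e] by (auto simp: in_mball)
      have cw: "0 < c * wt e" using c wt_pos[OF e] by simp
      have ne: "z n e \<noteq> x" using d cw zX(1)[OF n e] mdist_zero[of x] by force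
      have "dX (z n e) y / dX (z n e) x \<le> (Cup * wt e) / (c * wt e)"
        using cell_dist[OF n zX(2)[OF n e] y] d cw less_imp_le[OF mult_pos_pos[OF Cup_pos wt_pos[OF e]]]
        by (intro frac_le) auto
      also have "\<dots> = Cup / c" using wt_pos[OF e] by simp
      finally have "\<psi> (dX (z n e) y / dX (z n e) x) \<le> K" by (intro K) auto
      then have "\<delta> (z n e) y / \<delta> (z n e) x \<le> K"
        using \<psi>(2)[OF zX(1)[OF n e] yX _ ne] x by (auto simp: B.in_mball)
      moreover have "0 < \<delta> (z n e) x" using B.mdist_pos_less[OF ne] zX[OF n e] x by (auto simp: B.in_mball)
      ultimately have "\<delta> (z n e) y / K \<le> \<delta> (z n e) x" using K(1) by (simp add: field_simps)
      then show False using x by (auto simp: B.in_mball)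
    qed
  qed
  have disj: "mball (z n e) (c * wt e) \<inter> mball (z n f) (c * wt f) = {}"
    if n: "n \<ge> 1" and e: "e \<in> W n" "f \<in> W n" "e \<noteq> f" for n e f
  proof (rule ccontr)
    assume "mball (z n e) (c * wt e) \<inter> mball (z n f) (c * wt f) \<noteq> {}"
    then obtain x where x: "x \<in> X" "dX (z n e) x < c * wt e" "dX (z n f) x < c * wt f" by (auto simp: in_mball)
    obtain t where t: "t \<in> \<Sigma>" "x = cls t" using X_cases x by blast
    have "t n = e" "t n = f" using near[OF n _ t(1)] e x t zs(1)[OF n] by (auto simp: z_def dX_cls)
    then show False using e by simp
  qed
  define Kc where "Kc = C * K powr Q * measure \<mu> X"
  have "(\<Sum>e\<in>W n. \<delta> (z n e) (y e) powr Q) \<le> Kc" if n: "n \<ge> 1" and y: "\<forall>e\<in>W n. y e \<in> cell n e" for n y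
  proof -
    let ?B = "\<lambda>e. B.mball (z n e) (\<delta> (z n e) (y e) / K)"
    have Bs: "?B e \<in> sets \<mu>" for e using op[OF B.openin_mball] .
    have finW: "finite (W n)" using finite_words[OF finE] .
    have bound: "\<delta> (z n e) (y e) powr Q \<le> (C * K powr Q) * measure \<mu> (?B e)" if e: "e \<in> W n" for e
    proof (cases "\<delta> (z n e) (y e) = 0")
      case True
      then show ?thesis using Q \<mu>(2) by simp
    next
      case False
      have yX: "y e \<in> X" using y e cell_sub by blast
      let ?d = "\<delta> (z n e) (y e)"
      have d0: "0 < ?d" using False B.nonneg[of "z n e" "y e"] by linarith
      have "ennreal (?d / K) \<le> ennreal ?d" using d0 K(1) by (intro ennreal_leI) (simp add: field_simps)
      also have "\<dots> \<le> ediam \<delta> X"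
        unfolding ediam_def using zX(1)[OF n e] yX by (meson SUP_upper2 order_refl)
      also have "\<dots> \<le> 2 * ediam \<delta> X" by (metis add_increasing mult_2 zero_le order_refl)
      finally have "ennreal (inverse C * (?d / K) powr Q) \<le> emeasure \<mu> (?B e)"
        using reg[OF zX(1)[OF n e], of "?d / K"] d0 K(1) by simp
      then have "inverse C * (?d / K) powr Q \<le> measure \<mu> (?B e)"
        by (simp add: \<mu>.emeasure_eq_measure)
      then have "(C * K powr Q) * (inverse C * (?d / K) powr Q) \<le> (C * K powr Q) * measure \<mu> (?B e)"
        using \<mu>(2) by (intro mult_left_mono) auto
      moreover have "(C * K powr Q) * (inverse C * (?d / K) powr Q) = ?d powr Q"
        using \<mu>(2) K(1) d0 by (simp add: powr_divide)
      ultimately show ?thesis by simp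
    qed
    have "(\<Sum>e\<in>W n. \<delta> (z n e) (y e) powr Q) \<le> (\<Sum>e\<in>W n. (C * K powr Q) * measure \<mu> (?B e))"
      by (intro sum_mono bound)
    also have "\<dots> = (C * K powr Q) * (\<Sum>e\<in>W n. measure \<mu> (?B e))" by (simp add: sum_distrib_left)
    also have "(\<Sum>e\<in>W n. measure \<mu> (?B e)) = measure \<mu> (\<Union>e\<in>W n. ?B e)"
    proof (rule \<mu>.finite_measure_finite_Union[symmetric, OF finW])
      show "?B ` W n \<subseteq> sets \<mu>" using Bs by auto
      show "disjoint_family_on ?B (W n)"
        unfolding disjoint_family_on_def
      proof (intro ballI impI)
        fix e f assume ef: "e \<in> W n" "f \<in> W n" "e \<noteq> f"
        have "?B e \<subseteq> mball (z n e) (c * wt e)" "?B f \<subseteq> mball (z n f) (c * wt f)"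
          using ball_in[OF n] ef y by blast+
        then show "?B e \<inter> ?B f = {}" using disj[OF n ef] by blast
      qed
    qed
    also have "(C * K powr Q) * measure \<mu> (\<Union>e\<in>W n. ?B e) \<le> (C * K powr Q) * measure \<mu> X"
    proof (intro mult_left_mono \<mu>.finite_measure_mono)
      show "(\<Union>e\<in>W n. ?B e) \<subseteq> X" by (auto simp: B.in_mball)
      show "X \<in> sets \<mu>" using sp sets.top by metis
    qed (use \<mu>(2) in auto)
    finally show ?thesis by (simp add: Kc_def)
  qed
  moreover have "0 \<le> Kc" using \<mu>(2) by (simp add: Kc_def)
  ultimately show ?thesis using zX(1) by (intro exI[of _ Kc] conjI exI[of _ z]) auto
qed

lemma two_points: "\<exists>x\<in>X. \<exists>y\<in>X. x \<noteq> y"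
proof -
  have n: "(2::nat) \<ge> 1" by simp
  obtain e s where e: "e \<in> W 2" "bd Minus s e" using bd_ex[OF n] by blast
  obtain f t where f: "f \<in> W 2" "bd Plus t f" using bd_ex[OF n] by blast
  obtain x where x: "x \<in> \<Sigma>" "x 2 = e" using symbol_extend[OF e(1) n] by blast
  obtain y where y: "y \<in> \<Sigma>" "y 2 = f" using symbol_extend[OF f(1) n] by blast
  have "\<not> touch 2 (x 2) (y 2)" using bd_not_touch[OF e(1) f(1) e(2) f(2)] x y by simp
  then have "(x, y) \<notin> limit_rel S" unfolding limit_rel_iff using n by blast
  then have "cls x \<noteq> cls y" using x(1) y(1) cls_eq_iff by simp
  then show ?thesis by (intro bexI[of _ "cls x"] bexI[of _ "cls y"] cls_in_X x(1) y(1))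
qed

lemma gauge_exponent_ge:
  assumes qs: "quasisymmetric X dX \<delta>" and AR: "ahlfors_regular X \<delta> Q" and p: "1 < p" "Q \<le> p"
  shows "Md p \<le> 1"
proof (rule ccontr)
  assume M: "\<not> Md p \<le> 1"
  interpret B: Metric_space X \<delta> using qs by (simp add: quasisymmetric_def)
  have Q: "0 < Q" using AR by (simp add: ahlfors_regular_def)
  obtain y1 y2 where y12: "y1 \<in> X" "y2 \<in> X" "y1 \<noteq> y2" using two_points by blast
  obtain i where i: "i \<in> I" using I_ne by auto
  \<comment> \<open>A point of the limit space over an end of an edge; by \<open>ray_rel\<close> the
    fixed index \<open>i\<close> makes it a function of the vertex.\<close>
  define P where "P n s e = cls (ray i n s e)" for n s e
  have PX: "P n s e \<in> X" "P n s e \<in> cell n e" if "n \<ge> 1" "e \<in> W n" for n s e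
    using ray[OF i that] cls_in_X by (auto simp: P_def cell_def)
  \<comment> \<open>The exponent counts two letters down to level 2 and one factor from
    \<open>D_not_touch_ge\<close>.\<close>
  obtain m where m: "0 < m" "\<And>x z. x \<in> X \<Longrightarrow> z \<in> X \<Longrightarrow> rmin ^ 3 \<le> dX x z \<Longrightarrow> m \<le> \<delta> x z"
    using quasisymmetric_separation[OF qs _ y12, of "rmin ^ 3"] rmin_pos by auto
  \<comment> \<open>The bound does not depend on \<open>n\<close>, because the two points are
    already separated on level 2.\<close>
  have far: "m \<le> \<delta> (P n s e) (P n t f)"
    if n: "n \<ge> 2" and e: "e \<in> W n" "f \<in> W n" and bd: "bd Plus s e" "bd Minus t f" for n s t e f
  proof (rule m(2))
    have n1: "n \<ge> 1" using n by simp
    show "P n s e \<in> X" "P n t f \<in> X" using PX n1 e by auto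
    let ?x = "ray i n s e" and ?y = "ray i n t f"
    have xy: "?x \<in> \<Sigma>" "?y \<in> \<Sigma>" "?x n = e" "?y n = f" using ray[OF i n1] e by auto
    have x2: "drop (n - 2) e = ?x 2" "drop (n - 2) f = ?y 2"
      using symbol_drop[OF xy(1), of 2 n] symbol_drop[OF xy(2), of 2 n] xy n by auto
    have w2: "?x 2 \<in> W 2" "?y 2 \<in> W 2" using symbol_in_words xy by auto
    obtain s' where s': "bd Plus s' (?x 2)" using bd_drop[OF n e(1) bd(1)] x2 by auto
    obtain t' where t': "bd Minus t' (?y 2)" using bd_drop[OF n e(2) bd(2)] x2 by auto
    have "\<not> touch 2 (?x 2) (?y 2)" using bd_not_touch[OF w2(2,1) t' s'] touch_sym by blast
    then have "rmin * wt (?x 2) \<le> D ?x ?y" using D_not_touch_ge[OF xy(1,2)] by simp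
    moreover have "rmin * rmin ^ 2 \<le> rmin * wt (?x 2)" using wt_ge_rmin[OF w2(1)] rmin_pos by (intro mult_left_mono) auto
    ultimately show "rmin ^ 3 \<le> dX (P n s e) (P n t f)"
      using dX_cls[OF xy(1,2)] by (simp add: P_def power3_eq_cube power2_eq_square mult.assoc)
  qed
  obtain K z where K: "0 \<le> K" and zp: "\<forall>n\<ge>1. (\<forall>e\<in>W n. z n e \<in> X) \<and>
    (\<forall>y. (\<forall>e\<in>W n. y e \<in> cell n e) \<longrightarrow> (\<Sum>e\<in>W n. \<delta> (z n e) (y e) powr Q) \<le> K)"
    using ahlfors_packing[OF qs AR] by (elim exE conjE)
  have z: "z n e \<in> X" if "n \<ge> 1" "e \<in> W n" for n e using zp that by simp
  have pack: "(\<Sum>e\<in>W n. \<delta> (z n e) (y e) powr Q) \<le> K" if "n \<ge> 1" "\<forall>e\<in>W n. y e \<in> cell n e" for n y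
    using zp that by simp
  have bnd: "\<exists>\<Delta>\<ge>1. \<forall>x\<in>X. \<forall>y\<in>X. \<delta> x y \<le> \<Delta>"
  proof -
    have "B.mtopology = mtopology" using qs unfolding quasisymmetric_def homeomorphic_map_id by blast
    then have "compactin B.mtopology X" using compact_space_X by (simp add: compact_space_def)
    then have "B.mbounded X" by (rule B.compactin_imp_mbounded)
    then obtain B where "\<forall>x\<in>X. \<forall>y\<in>X. \<delta> x y \<le> B" unfolding B.mbounded_alt by blast
    then show ?thesis by (intro exI[of _ "max 1 B"]) (auto simp: le_max_iff_disj)
  qed
  then obtain \<Delta> where \<Delta>: "\<Delta> \<ge> 1" "\<And>x y. x \<in> X \<Longrightarrow> y \<in> X \<Longrightarrow> \<delta> x y \<le> \<Delta>" by blast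
  \<comment> \<open>Packing controls the sum with exponent \<open>Q\<close>; boundedness of \<delta>
    carries it over to \<open>p\<close>.\<close>
  have powr_pQ: "x powr p \<le> \<Delta> powr (p - Q) * x powr Q" if "0 \<le> x" "x \<le> \<Delta>" for x
  proof -
    have "x powr p = x powr (p - Q) * x powr Q" by (simp add: powr_add[symmetric])
    also have "\<dots> \<le> \<Delta> powr (p - Q) * x powr Q" using that p by (intro mult_right_mono powr_mono2) auto
    finally show ?thesis .
  qed
  define L where "L = 2 powr p * \<Delta> powr (p - Q) * (K + K)"
  have bound: "(m / 2) powr p * Md p ^ n \<le> L" if n: "n \<ge> 2" for n
  proof -
    have n1: "n \<ge> 1" using n by simp
    define Y where "Y = {P n t f | t f. f \<in> W n \<and> bd Minus t f}"
    have Yne: "Y \<noteq> {}" using bd_ex[OF n1, of Minus] by (auto simp: Y_def)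
    have YX: "Y \<subseteq> X" using PX n1 by (auto simp: Y_def)
    define u where "u x = (INF y\<in>Y. \<delta> x y)" for x
    have bdd: "bdd_below (\<delta> x ` Y)" for x using B.nonneg by (intro bdd_belowI[of _ 0]) auto
    have ule: "u x \<le> \<delta> x y" if "y \<in> Y" for x y unfolding u_def by (rule cINF_lower[OF bdd that])
    have lipu: "u x \<le> u x' + \<delta> x x'" if x: "x \<in> X" "x' \<in> X" for x x'
    proof -
      have "u x - \<delta> x x' \<le> u x'"
        unfolding u_def[of x'] using Yne
      proof (rule cINF_greatest)
        fix y assume y: "y \<in> Y"
        show "u x - \<delta> x x' \<le> \<delta> x' y" using ule[OF y, of x] B.triangle[OF x(1,2), of y] y YX by auto
      qed
      then show ?thesis by simp
    qed
    define U where "U s e = u (P n s e)" for s e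
    have "(m / 2) powr p * Md p ^ n \<le> (\<Sum>e\<in>W n. \<bar>U Plus e - U Minus e\<bar> powr p)"
    proof (rule dif_powr_sum_ge[OF p(1) n1 m(1)])
      fix e f s t assume *: "e \<in> W n" "f \<in> W n" "lb n s e = lb n t f"
      have "P n s e = P n t f"
        unfolding P_def using ray_rel[OF i n1 *] cls_eq_iff ray(1)[OF i n1] * by blast
      then show "U s e = U t f" by (simp add: U_def)
    next
      fix e s assume *: "e \<in> W n" "bd Minus s e"
      then have "P n s e \<in> Y" by (auto simp: Y_def)
      then have "U s e \<le> \<delta> (P n s e) (P n s e)" unfolding U_def by (rule ule)
      then show "U s e \<le> 0" using PX(1)[OF n1 *(1)] by simp
    next
      fix e s assume *: "e \<in> W n" "bd Plus s e"
      show "m \<le> U s e"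
        unfolding U_def u_def using Yne
        by (rule cINF_greatest) (use far[OF n *(1) _ *(2)] in \<open>auto simp: Y_def\<close>)
    qed
    also have "\<dots> \<le> (\<Sum>e\<in>W n. 2 powr p * \<Delta> powr (p - Q) * (\<delta> (z n e) (P n Plus e) powr Q + \<delta> (z n e) (P n Minus e) powr Q))"
    proof (rule sum_mono)
      fix e assume e: "e \<in> W n"
      let ?a = "\<delta> (z n e) (P n Plus e)" and ?b = "\<delta> (z n e) (P n Minus e)"
      have X: "P n Plus e \<in> X" "P n Minus e \<in> X" "z n e \<in> X" using PX(1)[OF n1 e] z[OF n1 e] by auto
      have ab: "0 \<le> ?a" "0 \<le> ?b" "?a \<le> \<Delta>" "?b \<le> \<Delta>" using \<Delta>(2) X by auto
      have "\<bar>U Plus e - U Minus e\<bar> \<le> \<delta> (P n Plus e) (P n Minus e)"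
        using lipu[OF X(1,2)] lipu[OF X(2,1)] B.commute[of "P n Plus e" "P n Minus e"] by (auto simp: U_def)
      also have "\<dots> \<le> ?a + ?b" using B.triangle[OF X(1,3,2)] B.commute[of "P n Plus e" "z n e"] by simp
      also have "\<dots> \<le> 2 * max ?a ?b" by simp
      finally have "\<bar>U Plus e - U Minus e\<bar> powr p \<le> (2 * max ?a ?b) powr p" using p by (intro powr_mono2) auto
      also have "\<dots> = 2 powr p * max ?a ?b powr p" by (simp add: powr_mult)
      also have "max ?a ?b powr p \<le> \<Delta> powr (p - Q) * max ?a ?b powr Q" using ab by (intro powr_pQ) (auto simp: le_max_iff_disj)
      also have "max ?a ?b powr Q \<le> ?a powr Q + ?b powr Q" by (simp add: max_def)
      finally show "\<bar>U Plus e - U Minus e\<bar> powr p \<le> 2 powr p * \<Delta> powr (p - Q) * (?a powr Q + ?b powr Q)"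
        by (simp add: mult.assoc mult_left_mono)
    qed
    also have "\<dots> = 2 powr p * \<Delta> powr (p - Q) *
        ((\<Sum>e\<in>W n. \<delta> (z n e) (P n Plus e) powr Q) + (\<Sum>e\<in>W n. \<delta> (z n e) (P n Minus e) powr Q))"
      by (simp add: sum_distrib_left sum.distrib distrib_left)
    also have "\<dots> \<le> L"
      unfolding L_def using PX(2)[OF n1] by (intro mult_left_mono add_mono pack n1) auto
    finally show ?thesis .
  qed
  have mp: "0 < (m / 2) powr p" using m by simp
  obtain n where n: "L / (m / 2) powr p < Md p ^ n" using M real_arch_pow[of "Md p"] by auto
  \<comment> \<open>The shift by 2 is made because \<open>bound\<close> starts at level 2.\<close>
  have "Md p ^ n \<le> Md p ^ (n + 2)" using M by (intro power_increasing) auto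
  then have "L / (m / 2) powr p < Md p ^ (n + 2)" using n by simp
  then have "L < (m / 2) powr p * Md p ^ (n + 2)" using mp by (simp add: field_simps)
  then show False using bound[of "n + 2"] by simp
qed

end

theorem theorem1p7:
  fixes S :: "('v, 'e, 'i) igs"
  assumes "simple_igs S" and "doubling_igs S" and "nondegenerate_igs S" and "symmetric_igs S"
  shows "(\<exists>!Q. Q \<ge> 1 \<and> modulus Q (Theta1 S) (gen S) = 1) \<and>
    AR_conformal_dim (limit_space S) (limit_dist S) =
      ennreal (THE Q. Q \<ge> 1 \<and> modulus Q (Theta1 S) (gen S) = 1)"
proof -
  interpret L: laakso_igs S by unfold_locales fact+
  define Q where "Q = (THE Q. Q \<ge> 1 \<and> L.Md Q = 1)"
  have Q: "1 \<le> Q" "L.Md Q = 1" using theI'[OF L.ex1_Md_eq_1] by (auto simp: Q_def)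
  let ?\<sigma> = "\<lambda>_::'e. inverse (real (Lstar S))"
  obtain k where k: "weighted_igs S ?\<sigma> k" using L.weighted_igs_Lstar by blast
  interpret A: weighted_igs S ?\<sigma> k by fact
  have dL: "limit_dist S = A.dX" by (rule limit_dist_eq_wlimit_dist)
  have "AR_conformal_dim L.X A.dX = ennreal Q"
  proof (rule antisym)
    show "AR_conformal_dim L.X A.dX \<le> ennreal Q"
    proof (rule ennreal_le_epsilon)
      fix e :: real assume e: "0 < e"
      have "L.Md (Q + e) < 1" using L.Md_less_1[of Q "Q + e"] Q e by simp
      then obtain \<rho> g where \<rho>: "weighted_igs S \<rho> g" "(\<Sum>a\<in>L.E\<^sub>1. \<rho> a powr (Q + e)) = 1"
        using L.weighted_igs_above_Q[of "Q + e"] Q e by auto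
      interpret R: weighted_igs S \<rho> g by fact
      have Qe: "0 < Q + e" using Q e by simp
      have "R.dX \<in> AR_gauge L.X A.dX"
        using weighted_quasisymmetric[OF \<rho>(1) k] R.ahlfors_regular_dX[OF Qe \<rho>(2)] Q e
        by (auto simp: AR_gauge_def intro!: exI[of _ "Q + e"])
      then have "AR_conformal_dim L.X A.dX \<le> hausdorff_dim L.X R.dX"
        unfolding AR_conformal_dim_def by (intro INF_lower)
      also have "\<dots> \<le> ennreal (Q + e)" by (rule R.hausdorff_dim_le[OF Qe \<rho>(2)])
      also have "\<dots> = ennreal Q + ennreal e" using Q e by (simp add: ennreal_plus)
      finally show "AR_conformal_dim L.X A.dX \<le> ennreal Q + ennreal e" .
    qed
    show "ennreal Q \<le> AR_conformal_dim L.X A.dX"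
      unfolding AR_conformal_dim_def
    proof (rule INF_greatest)
      fix \<delta> assume "\<delta> \<in> AR_gauge L.X A.dX"
      then obtain R where R: "quasisymmetric L.X A.dX \<delta>" "1 \<le> R" "ahlfors_regular L.X \<delta> R" by (auto simp: AR_gauge_def)
      have "Q \<le> R"
      proof (rule ccontr)
        assume "\<not> Q \<le> R"
        \<comment> \<open>The midpoint exceeds 1 because R is at least 1 and Q is larger; strictly
          below Q, it lets \<open>Md_less_1\<close> contradict the value 1 at Q.\<close>
        define p where "p = (R + Q) / 2"
        have p: "1 < p" "R \<le> p" "p < Q" using R \<open>\<not> Q \<le> R\<close> by (auto simp: p_def)
        have "L.Md p \<le> 1" by (rule A.gauge_exponent_ge[OF R(1,3) p(1,2)])
        then have "L.Md Q < 1" using L.Md_less_1[of p Q] p by simp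
        then show False using Q by simp
      qed
      moreover obtain x y where "x \<in> L.X" "y \<in> L.X" "x \<noteq> y" using A.two_points by blast
      ultimately show "ennreal Q \<le> hausdorff_dim L.X \<delta>"
        using hausdorff_dim_ge[OF R(3)] by (meson ennreal_leI order_trans)
    qed
  qed
  then show ?thesis using L.ex1_Md_eq_1 by (simp add: dL Q_def)
qed

end
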